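(* Let $C$ be a smooth curve over an algebraically closed field $k$ of characteristic $p>0$, and $\mathcal{E}$ a vector bundle on $C$. A rational connection $\nabla$ on $\mathcal{E}$ (having at least one pole) is logarithmic with vanishing $p$-curvature if and only if, formally locally at every pole, with $t$ a local coordinate there, the connection may be transported so as to have diagonal connection matrix with each diagonal entry of the form $e_it^{-1}dt$ with $e_i\in\mathbb{F}_p$; or equivalently, if and only if formally locally at every pole the connection decomposes as a direct sum of connections on line bundles, each with logarithmic poles and vanishing $p$-curvature.
   Context: A rational connection on $\mathcal{E}$ is a connection on the restriction of $\mathcal{E}$ to a dense open subset of $C$, regarded as a connection on $\mathcal{E}$ with possible poles; it is logarithmic if all its poles are simple. "Formally locally at a point" means after passing to the completed local ring $k[[t]]$. With respect to a trivialization, $\nabla$ has connection matrix $T$ if $\nabla(s)=ds+Ts$; transport by an automorphism given by an invertible matrix $M$ changes $T$ to $M^{-1}TM+M^{-1}dM$. *)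

theory Defs
  imports
    "HOL-Analysis.Abstract_Topology"
    "HOL-Library.FuncSet"
    "HOL-Algebra.Ideal"
    "HOL-Computational_Algebra.Polynomial"
    "HOL-Computational_Algebra.Formal_Laurent_Series"
    "Jordan_Normal_Form.Matrix"
begin

section \<open>Varieties over an algebraically closed field\<close>

text \<open>
  A variety is given by its closed points, its Zariski topology and its sheaf of regular
  functions, which are functions with values in the ground field. A section over \<open>U\<close> is
  represented by a total function of which only the values on \<open>U\<close> matter.
\<close>

record ('x, 'k) fun_space =
  zariski :: "'x topology"
  regular :: "'x set \<Rightarrow> ('x \<Rightarrow> 'k) set"

text \<open>The sheaf condition, for a presheaf of functions \<open>F\<close> with restriction of functions as
  restriction maps.\<close>

definition function_sheaf :: "'x topology \<Rightarrow> ('x set \<Rightarrow> ('x \<Rightarrow> 'a) set) \<Rightarrow> bool" where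
  "function_sheaf X F \<longleftrightarrow>
    (\<forall>U f g. openin X U \<and> f \<in> F U \<and> (\<forall>x\<in>U. g x = f x) \<longrightarrow> g \<in> F U) \<and>
    (\<forall>U V f. openin X U \<and> openin X V \<and> V \<subseteq> U \<and> f \<in> F U \<longrightarrow> f \<in> F V) \<and>
    (\<forall>U f. openin X U \<and> (\<forall>x\<in>U. \<exists>V. openin X V \<and> x \<in> V \<and> V \<subseteq> U \<and> f \<in> F V) \<longrightarrow> f \<in> F U)"

definition space_with_functions :: "('x, 'k::field) fun_space \<Rightarrow> bool" where
  "space_with_functions C \<longleftrightarrow>
    function_sheaf (zariski C) (regular C) \<and>
    (\<forall>U. openin (zariski C) U \<longrightarrow>
      (\<forall>c. (\<lambda>_. c) \<in> regular C U) \<and>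
      (\<forall>f\<in>regular C U. \<forall>g\<in>regular C U.
        (\<lambda>x. f x + g x) \<in> regular C U \<and> (\<lambda>x. f x * g x) \<in> regular C U))"

inductive_set generated_algebra :: "('x \<Rightarrow> 'k::field) set \<Rightarrow> ('x \<Rightarrow> 'k) set"
  for G :: "('x \<Rightarrow> 'k) set" where
  const: "(\<lambda>_. c) \<in> generated_algebra G"
| gen: "g \<in> G \<Longrightarrow> g \<in> generated_algebra G"
| add: "f \<in> generated_algebra G \<Longrightarrow> g \<in> generated_algebra G \<Longrightarrow>
    (\<lambda>x. f x + g x) \<in> generated_algebra G"
| mult: "f \<in> generated_algebra G \<Longrightarrow> g \<in> generated_algebra G \<Longrightarrow>
    (\<lambda>x. f x * g x) \<in> generated_algebra G"

definition algebra_hom_to_field ::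
  "('x, 'k::field) fun_space \<Rightarrow> 'x set \<Rightarrow> (('x \<Rightarrow> 'k) \<Rightarrow> 'k) \<Rightarrow> bool" where
  "algebra_hom_to_field C U \<phi> \<longleftrightarrow>
    (\<forall>f\<in>regular C U. \<forall>g\<in>regular C U.
      \<phi> (\<lambda>x. f x + g x) = \<phi> f + \<phi> g \<and> \<phi> (\<lambda>x. f x * g x) = \<phi> f * \<phi> g \<and>
      ((\<forall>x\<in>U. f x = g x) \<longrightarrow> \<phi> f = \<phi> g)) \<and>
    (\<forall>c. \<phi> (\<lambda>_. c) = c)"

text \<open>
  An affine open set: its coordinate ring \<open>A\<close> is a finitely generated algebra, its points are the
  algebra homomorphisms from \<open>A\<close> to the ground field (the maximal ideals of \<open>A\<close>), and its topology
  and structure sheaf are those of the maximal spectrum of \<open>A\<close>: the principal open sets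
  \<open>D(f)\<close> form a base, and the ring of functions on \<open>D(f)\<close> is \<open>A[1/f]\<close>.
\<close>

definition affine_open :: "('x, 'k::field) fun_space \<Rightarrow> 'x set \<Rightarrow> bool" where
  "affine_open C U \<longleftrightarrow>
    openin (zariski C) U \<and>
    (\<exists>G. finite G \<and> G \<subseteq> regular C U \<and>
      (\<forall>f\<in>regular C U. \<exists>g\<in>generated_algebra G. \<forall>x\<in>U. f x = g x)) \<and>
    (\<forall>\<phi>. algebra_hom_to_field C U \<phi> \<longrightarrow> (\<exists>!x. x \<in> U \<and> (\<forall>f\<in>regular C U. \<phi> f = f x))) \<and>
    (\<forall>f\<in>regular C U. openin (zariski C) {x\<in>U. f x \<noteq> 0}) \<and>
    (\<forall>V x. openin (zariski C) V \<and> V \<subseteq> U \<and> x \<in> V \<longrightarrow>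
      (\<exists>f\<in>regular C U. f x \<noteq> 0 \<and> {y\<in>U. f y \<noteq> 0} \<subseteq> V)) \<and>
    (\<forall>f\<in>regular C U. \<forall>h.
      h \<in> regular C {x\<in>U. f x \<noteq> 0} \<longleftrightarrow>
      (\<exists>g\<in>regular C U. \<exists>n::nat. \<forall>x\<in>U. f x \<noteq> 0 \<longrightarrow> h x = g x / f x ^ n))"

text \<open>
  The diagonal is closed in the product variety \<open>C \<times> C\<close>, whose topology has as a base the sets of
  pairs \<open>(a, b) \<in> U \<times> V\<close> with \<open>\<Sum>\<^sub>i f\<^sub>i(a) g\<^sub>i(b) \<noteq> 0\<close>, where \<open>f\<^sub>i\<close> and \<open>g\<^sub>i\<close> are regular on the affine
  open sets \<open>U\<close> and \<open>V\<close>.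
\<close>

definition separated :: "('x, 'k::field) fun_space \<Rightarrow> bool" where
  "separated C \<longleftrightarrow>
    (\<forall>x\<in>topspace (zariski C). \<forall>y\<in>topspace (zariski C). x \<noteq> y \<longrightarrow>
      (\<exists>U V (m::nat) f g. affine_open C U \<and> affine_open C V \<and> x \<in> U \<and> y \<in> V \<and>
        (\<forall>i<m. f i \<in> regular C U \<and> g i \<in> regular C V) \<and>
        (\<Sum>i<m. f i x * g i y) \<noteq> 0 \<and>
        (\<forall>z\<in>U \<inter> V. (\<Sum>i<m. f i z * g i z) = 0)))"

definition variety :: "('x, 'k::field) fun_space \<Rightarrow> bool" where
  "variety C \<longleftrightarrow>
    space_with_functions C \<and>
    (\<exists>\<U>. finite \<U> \<and> (\<forall>U\<in>\<U>. affine_open C U) \<and> \<Union>\<U> = topspace (zariski C)) \<and>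
    separated C"

definition irreducible_space :: "'x topology \<Rightarrow> bool" where
  "irreducible_space X \<longleftrightarrow> topspace X \<noteq> {} \<and>
    (\<forall>U V. openin X U \<and> openin X V \<and> U \<noteq> {} \<and> V \<noteq> {} \<longrightarrow> U \<inter> V \<noteq> {})"


section \<open>Local rings and smooth curves\<close>

definition regular_at :: "('x, 'k::field) fun_space \<Rightarrow> 'x \<Rightarrow> ('x \<Rightarrow> 'k) \<Rightarrow> bool" where
  "regular_at C x f \<longleftrightarrow> (\<exists>U. openin (zariski C) U \<and> x \<in> U \<and> f \<in> regular C U)"

definition same_germ :: "('x, 'k::field) fun_space \<Rightarrow> 'x \<Rightarrow> ('x \<Rightarrow> 'k) \<Rightarrow> ('x \<Rightarrow> 'k) \<Rightarrow> bool" where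
  "same_germ C x f g \<longleftrightarrow> (\<exists>U. openin (zariski C) U \<and> x \<in> U \<and> (\<forall>y\<in>U. f y = g y))"

definition germ :: "('x, 'k::field) fun_space \<Rightarrow> 'x \<Rightarrow> ('x \<Rightarrow> 'k) \<Rightarrow> ('x \<Rightarrow> 'k) set" where
  "germ C x f = {g. regular_at C x g \<and> same_germ C x f g}"

definition local_ring :: "('x, 'k::field) fun_space \<Rightarrow> 'x \<Rightarrow> ('x \<Rightarrow> 'k) set ring" where
  "local_ring C x =
    \<lparr>carrier = germ C x ` {f. regular_at C x f},
     monoid.mult = (\<lambda>A B. \<Union>f\<in>A. \<Union>g\<in>B. germ C x (\<lambda>y. f y * g y)),
     one = germ C x (\<lambda>_. 1),
     zero = germ C x (\<lambda>_. 0),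
     add = (\<lambda>A B. \<Union>f\<in>A. \<Union>g\<in>B. germ C x (\<lambda>y. f y + g y))\<rparr>"

definition local_max_ideal :: "('x, 'k::field) fun_space \<Rightarrow> 'x \<Rightarrow> ('x \<Rightarrow> 'k) set set" where
  "local_max_ideal C x = germ C x ` {f. regular_at C x f \<and> f x = 0}"

definition prime_chain :: "('a, 'b) ring_scheme \<Rightarrow> 'a set list \<Rightarrow> bool" where
  "prime_chain R Ps \<longleftrightarrow> (\<forall>P\<in>set Ps. primeideal P R) \<and> sorted_wrt (\<subset>) Ps"

definition krull_dimension :: "('a, 'b) ring_scheme \<Rightarrow> nat \<Rightarrow> bool" where
  "krull_dimension R d \<longleftrightarrow>
    (\<exists>Ps. prime_chain R Ps \<and> length Ps = d + 1) \<and>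
    (\<forall>Ps. prime_chain R Ps \<longrightarrow> length Ps \<le> d + 1)"

text \<open>A local coordinate at \<open>x\<close> is a generator of the maximal ideal of the local ring.\<close>

definition local_coordinate :: "('x, 'k::field) fun_space \<Rightarrow> 'x \<Rightarrow> ('x \<Rightarrow> 'k) \<Rightarrow> bool" where
  "local_coordinate C x t \<longleftrightarrow> regular_at C x t \<and>
    local_max_ideal C x = PIdl\<^bsub>local_ring C x\<^esub> (germ C x t)"

text \<open>
  Over an algebraically closed field, smoothness means that all local rings are regular. At the
  points of a curve, these are the regular local rings of dimension one, i.e. those of Krull
  dimension one whose maximal ideal is generated by one element.
\<close>

definition smooth_curve :: "('x, 'k::alg_closed_field) fun_space \<Rightarrow> bool" where
  "smooth_curve C \<longleftrightarrow>
    variety C \<and>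
    irreducible_space (zariski C) \<and>
    (\<forall>x\<in>topspace (zariski C). krull_dimension (local_ring C x) 1 \<and> (\<exists>t. local_coordinate C x t))"


section \<open>Vector bundles\<close>

text \<open>
  A vector bundle is given by its fibres, which are vector spaces inside one large ambient space
  (any family of vector spaces can be put in this form), and by its sheaf of sections, a
  section being represented by the function of its values in the fibres.
\<close>

record ('x, 'k, 'v) vbundle =
  scale :: "'k \<Rightarrow> 'v \<Rightarrow> 'v"
  fibre :: "'x \<Rightarrow> 'v set"
  sections :: "'x set \<Rightarrow> ('x \<Rightarrow> 'v) set"

text \<open>A trivialization of \<open>E\<close> over \<open>U\<close>.\<close>

definition frame_on ::
  "('x, 'k::field) fun_space \<Rightarrow> ('x, 'k, 'v::ab_group_add) vbundle \<Rightarrow> nat \<Rightarrow>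
    'x set \<Rightarrow> (nat \<Rightarrow> 'x \<Rightarrow> 'v) \<Rightarrow> bool" where
  "frame_on C E n U e \<longleftrightarrow>
    openin (zariski C) U \<and>
    (\<forall>x\<in>U. \<forall>v\<in>fibre E x. \<exists>!c. c \<in> extensional {..<n} \<and> v = (\<Sum>i<n. scale E (c i) (e i x))) \<and>
    (\<forall>x\<in>U. \<forall>i<n. e i x \<in> fibre E x) \<and>
    (\<forall>V s. openin (zariski C) V \<and> V \<subseteq> U \<longrightarrow>
      (s \<in> sections E V \<longleftrightarrow>
        (\<exists>f. (\<forall>i<n. f i \<in> regular C V) \<and>
          (\<forall>x\<in>V. s x = (\<Sum>i<n. scale E (f i x) (e i x))))))"

definition frame_at ::
  "('x, 'k::field) fun_space \<Rightarrow> ('x, 'k, 'v::ab_group_add) vbundle \<Rightarrow> nat \<Rightarrow>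
    'x \<Rightarrow> (nat \<Rightarrow> 'x \<Rightarrow> 'v) \<Rightarrow> bool" where
  "frame_at C E n x e \<longleftrightarrow> (\<exists>U. x \<in> U \<and> frame_on C E n U e)"

definition vector_bundle ::
  "('x, 'k::field) fun_space \<Rightarrow> ('x, 'k, 'v::ab_group_add) vbundle \<Rightarrow> nat \<Rightarrow> bool" where
  "vector_bundle C E n \<longleftrightarrow>
    vector_space (scale E) \<and>
    (\<forall>x\<in>topspace (zariski C). module.subspace (scale E) (fibre E x)) \<and>
    function_sheaf (zariski C) (sections E) \<and>
    (\<forall>x\<in>topspace (zariski C). \<exists>e. frame_at C E n x e)"


section \<open>Connections\<close>

text \<open>The tangent space at \<open>x\<close>, i.e. the dual of the fibre at \<open>x\<close> of the sheaf of differentials: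
  derivations of the local ring with values in the residue field.\<close>

definition tangent_vector ::
  "('x, 'k::field) fun_space \<Rightarrow> 'x \<Rightarrow> (('x \<Rightarrow> 'k) \<Rightarrow> 'k) \<Rightarrow> bool" where
  "tangent_vector C x \<delta> \<longleftrightarrow>
    (\<forall>f g. regular_at C x f \<and> regular_at C x g \<longrightarrow>
      \<delta> (\<lambda>y. f y + g y) = \<delta> f + \<delta> g \<and>
      \<delta> (\<lambda>y. f y * g y) = f x * \<delta> g + g x * \<delta> f \<and>
      (same_germ C x f g \<longrightarrow> \<delta> f = \<delta> g)) \<and>
    (\<forall>c. \<delta> (\<lambda>_. c) = 0)"

text \<open>
  Sections over \<open>U\<close> of \<open>\<Omega>\<^sup>1 \<otimes> E\<close>. The fibre of \<open>\<Omega>\<^sup>1 \<otimes> E\<close> at \<open>x\<close> is the space of linear maps from the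
  tangent space at \<open>x\<close> to the fibre of \<open>E\<close>, and a section is represented by the function of its
  values in these fibres. The regular ones are those locally of the form \<open>\<Sum>\<^sub>i dg\<^sub>i \<otimes> s\<^sub>i\<close>, where
  \<open>dg\<close> sends \<open>\<delta>\<close> to \<open>\<delta> g\<close>. Only the values at tangent vectors matter.
\<close>

definition bundle_forms ::
  "('x, 'k::field) fun_space \<Rightarrow> ('x, 'k, 'v::ab_group_add) vbundle \<Rightarrow> 'x set \<Rightarrow>
    ('x \<Rightarrow> (('x \<Rightarrow> 'k) \<Rightarrow> 'k) \<Rightarrow> 'v) set" where
  "bundle_forms C E U = {\<omega>. \<forall>x\<in>U. \<exists>V (m::nat) g s.
    openin (zariski C) V \<and> x \<in> V \<and> V \<subseteq> U \<and>
    (\<forall>i<m. g i \<in> regular C V \<and> s i \<in> sections E V) \<and>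
    (\<forall>y\<in>V. \<forall>\<delta>. tangent_vector C y \<delta> \<longrightarrow> \<omega> y \<delta> = (\<Sum>i<m. scale E (\<delta> (g i)) (s i y)))}"

type_synonym ('x, 'k, 'v) conn = "('x \<Rightarrow> 'v) \<Rightarrow> 'x \<Rightarrow> (('x \<Rightarrow> 'k) \<Rightarrow> 'k) \<Rightarrow> 'v"

text \<open>
  A connection on the restriction of \<open>E\<close> to the open set \<open>W\<close>, as a map of sheaves from \<open>E\<close> to
  \<open>\<Omega>\<^sup>1 \<otimes> E\<close>. One operator on total functions serves for all open subsets of \<open>W\<close>; the second
  clause says that it is well defined on sections. Linearity over the ground field follows from
  additivity and the Leibniz rule.
\<close>

definition connection_on ::
  "('x, 'k::field) fun_space \<Rightarrow> ('x, 'k, 'v::ab_group_add) vbundle \<Rightarrow> 'x set \<Rightarrow>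
    ('x, 'k, 'v) conn \<Rightarrow> bool" where
  "connection_on C E W nabla \<longleftrightarrow> openin (zariski C) W \<and>
    (\<forall>U. openin (zariski C) U \<and> U \<subseteq> W \<longrightarrow>
      (\<forall>s\<in>sections E U. nabla s \<in> bundle_forms C E U) \<and>
      (\<forall>s\<in>sections E U. \<forall>s'\<in>sections E U. (\<forall>y\<in>U. s y = s' y) \<longrightarrow>
        (\<forall>x\<in>U. \<forall>\<delta>. tangent_vector C x \<delta> \<longrightarrow> nabla s x \<delta> = nabla s' x \<delta>)) \<and>
      (\<forall>s\<in>sections E U. \<forall>s'\<in>sections E U. \<forall>x\<in>U. \<forall>\<delta>. tangent_vector C x \<delta> \<longrightarrow>
        nabla (\<lambda>y. s y + s' y) x \<delta> = nabla s x \<delta> + nabla s' x \<delta>) \<and>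
      (\<forall>f\<in>regular C U. \<forall>s\<in>sections E U. \<forall>x\<in>U. \<forall>\<delta>. tangent_vector C x \<delta> \<longrightarrow>
        nabla (\<lambda>y. scale E (f y) (s y)) x \<delta> = scale E (\<delta> f) (s x) + scale E (f x) (nabla s x \<delta>)))"

definition rational_connection ::
  "('x, 'k::field) fun_space \<Rightarrow> ('x, 'k, 'v::ab_group_add) vbundle \<Rightarrow> 'x set \<Rightarrow>
    ('x, 'k, 'v) conn \<Rightarrow> bool" where
  "rational_connection C E W nabla \<longleftrightarrow>
    connection_on C E W nabla \<and> zariski C closure_of W = topspace (zariski C)"

text \<open>\<open>\<nabla>\<close> has at \<open>x\<close> at most a pole of order \<open>m\<close>: for a local coordinate \<open>t\<close> at \<open>x\<close> and every local
  section \<open>s\<close> of \<open>E\<close> near \<open>x\<close>, the section \<open>t\<^sup>m \<nabla> s\<close> of \<open>\<Omega>\<^sup>1 \<otimes> E\<close> extends regularly to a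
  neighbourhood of \<open>x\<close>.\<close>

definition pole_order_le ::
  "('x, 'k::field) fun_space \<Rightarrow> ('x, 'k, 'v::ab_group_add) vbundle \<Rightarrow> 'x set \<Rightarrow>
    ('x, 'k, 'v) conn \<Rightarrow> 'x \<Rightarrow> nat \<Rightarrow> bool" where
  "pole_order_le C E W nabla x m \<longleftrightarrow>
    (\<exists>t. local_coordinate C x t \<and>
      (\<forall>U s. openin (zariski C) U \<and> x \<in> U \<and> s \<in> sections E U \<longrightarrow>
        (\<exists>V. openin (zariski C) V \<and> x \<in> V \<and> V \<subseteq> U \<and>
          (\<exists>\<omega>\<in>bundle_forms C E V. \<forall>y\<in>V \<inter> W. \<forall>\<delta>. tangent_vector C y \<delta> \<longrightarrow>
            \<omega> y \<delta> = scale E (t y ^ m) (nabla s y \<delta>)))))"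

definition poles ::
  "('x, 'k::field) fun_space \<Rightarrow> ('x, 'k, 'v::ab_group_add) vbundle \<Rightarrow> 'x set \<Rightarrow>
    ('x, 'k, 'v) conn \<Rightarrow> 'x set" where
  "poles C E W nabla = {x \<in> topspace (zariski C). \<not> pole_order_le C E W nabla x 0}"

definition logarithmic ::
  "('x, 'k::field) fun_space \<Rightarrow> ('x, 'k, 'v::ab_group_add) vbundle \<Rightarrow> 'x set \<Rightarrow>
    ('x, 'k, 'v) conn \<Rightarrow> bool" where
  "logarithmic C E W nabla \<longleftrightarrow> (\<forall>x\<in>poles C E W nabla. pole_order_le C E W nabla x 1)"


section \<open>The p-curvature\<close>

text \<open>Vector fields over \<open>U\<close>: derivations of the structure sheaf of \<open>U\<close>.\<close>

definition vector_field ::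
  "('x, 'k::field) fun_space \<Rightarrow> 'x set \<Rightarrow> (('x \<Rightarrow> 'k) \<Rightarrow> 'x \<Rightarrow> 'k) \<Rightarrow> bool" where
  "vector_field C U \<theta> \<longleftrightarrow>
    (\<forall>V. openin (zariski C) V \<and> V \<subseteq> U \<longrightarrow>
      (\<forall>f\<in>regular C V. \<theta> f \<in> regular C V) \<and>
      (\<forall>f\<in>regular C V. \<forall>g\<in>regular C V. \<forall>x\<in>V.
        \<theta> (\<lambda>y. f y + g y) x = \<theta> f x + \<theta> g x \<and>
        \<theta> (\<lambda>y. f y * g y) x = f x * \<theta> g x + g x * \<theta> f x \<and>
        ((\<forall>y\<in>V. f y = g y) \<longrightarrow> \<theta> f x = \<theta> g x)) \<and>
      (\<forall>c. \<forall>x\<in>V. \<theta> (\<lambda>_. c) x = 0))"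

text \<open>The covariant derivative \<open>\<nabla>\<^sub>\<theta>\<close>, i.e. \<open>\<nabla>\<close> contracted with \<open>\<theta>\<close>.\<close>

definition covariant_derivative ::
  "('x, 'k, 'v) conn \<Rightarrow> (('x \<Rightarrow> 'k) \<Rightarrow> 'x \<Rightarrow> 'k) \<Rightarrow>
    ('x \<Rightarrow> 'v) \<Rightarrow> 'x \<Rightarrow> 'v" where
  "covariant_derivative nabla \<theta> s x = nabla s x (\<lambda>f. \<theta> f x)"

text \<open>The vanishing of the p-curvature, which sends \<open>\<theta>\<close> to \<open>(\<nabla>\<^sub>\<theta>)\<^sup>p - \<nabla>\<^bsub>\<theta>\<^sup>p\<^esub>\<close>, where \<open>p\<close> is the
  characteristic.\<close>

definition vanishing_p_curvature ::
  "('x, 'k::field) fun_space \<Rightarrow> ('x, 'k, 'v::ab_group_add) vbundle \<Rightarrow> 'x set \<Rightarrow>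
    ('x, 'k, 'v) conn \<Rightarrow> bool" where
  "vanishing_p_curvature C E W nabla \<longleftrightarrow>
    (\<forall>U \<theta>. openin (zariski C) U \<and> U \<subseteq> W \<and> vector_field C U \<theta> \<longrightarrow>
      (\<forall>s\<in>sections E U. \<forall>x\<in>U.
        (covariant_derivative nabla \<theta> ^^ CHAR('k)) s x -
        covariant_derivative nabla (\<theta> ^^ CHAR('k)) s x = 0))"


section \<open>Passage to the completed local ring\<close>

text \<open>
  The image of a function regular at \<open>x\<close> in the completed local ring \<open>k[[t]]\<close>: its image modulo
  the \<open>m\<close>-th power of the maximal ideal, which is generated by \<open>t\<^sup>m\<close>, is a polynomial in \<open>t\<close>.
\<close>

definition taylor_expansion ::
  "('x, 'k::field) fun_space \<Rightarrow> 'x \<Rightarrow> ('x \<Rightarrow> 'k) \<Rightarrow> ('x \<Rightarrow> 'k) \<Rightarrow> 'k fps \<Rightarrow> bool" where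
  "taylor_expansion C x t f F \<longleftrightarrow> regular_at C x f \<and>
    (\<forall>m::nat. \<exists>g. regular_at C x g \<and>
      same_germ C x f (\<lambda>y. (\<Sum>i<m. fps_nth F i * t y ^ i) + t y ^ m * g y))"

text \<open>The image in \<open>k((t))\<close> of a rational function \<open>a\<close>, which is written as a fraction \<open>g / h\<close>.\<close>

definition laurent_expansion ::
  "('x, 'k::field) fun_space \<Rightarrow> 'x \<Rightarrow> ('x \<Rightarrow> 'k) \<Rightarrow> ('x \<Rightarrow> 'k) \<Rightarrow> 'k fls \<Rightarrow> bool" where
  "laurent_expansion C x t a F \<longleftrightarrow>
    (\<exists>g h G H V. taylor_expansion C x t g G \<and> taylor_expansion C x t h H \<and> H \<noteq> 0 \<and>
      openin (zariski C) V \<and> V \<noteq> {} \<and> a \<in> regular C V \<and>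
      (\<forall>y\<in>V. a y * h y = g y) \<and>
      F * fps_to_fls H = fps_to_fls G)"

text \<open>
  \<open>A\<close> is the matrix over \<open>k((t))\<close> for which \<open>A dt\<close> is the connection matrix of \<open>\<nabla>\<close> formally locally
  at \<open>x\<close>, with respect to the local coordinate \<open>t\<close> and the trivialization \<open>e\<close>: generically
  \<open>\<nabla> e\<^sub>j = \<Sum>\<^sub>i a\<^sub>i\<^sub>j dt \<otimes> e\<^sub>i\<close> with rational functions \<open>a\<^sub>i\<^sub>j\<close>, and \<open>A\<close> has as entries the images
  of the \<open>a\<^sub>i\<^sub>j\<close> in \<open>k((t))\<close>.
\<close>

definition formal_connection_matrix ::
  "('x, 'k::field) fun_space \<Rightarrow> ('x, 'k, 'v::ab_group_add) vbundle \<Rightarrow> nat \<Rightarrow> 'x set \<Rightarrow>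
    ('x, 'k, 'v) conn \<Rightarrow>
    'x \<Rightarrow> ('x \<Rightarrow> 'k) \<Rightarrow> (nat \<Rightarrow> 'x \<Rightarrow> 'v) \<Rightarrow> 'k fls mat \<Rightarrow> bool" where
  "formal_connection_matrix C E n W nabla x t e A \<longleftrightarrow>
    A \<in> carrier_mat n n \<and>
    (\<exists>a V. openin (zariski C) V \<and> V \<noteq> {} \<and> V \<subseteq> W \<and> frame_on C E n V e \<and> t \<in> regular C V \<and>
      (\<forall>i<n. \<forall>j<n. a i j \<in> regular C V \<and> laurent_expansion C x t (a i j) (A $$ (i, j))) \<and>
      (\<forall>j<n. \<forall>y\<in>V. \<forall>\<delta>. tangent_vector C y \<delta> \<longrightarrow>
        nabla (e j) y \<delta> = (\<Sum>i<n. scale E (a i j y * \<delta> t) (e i y))))"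


section \<open>Formal connections\<close>

text \<open>
  The formal completion of \<open>E\<close> at \<open>x\<close> is the lattice \<open>k[[t]]\<^sup>n\<close> in \<open>k((t))\<^sup>n\<close>, with the
  connection \<open>v \<mapsto> dv + A v dt\<close>. Matrices over \<open>k[[t]]\<close> and \<open>k((t))\<close> are written with \<open>dt\<close> left out.
\<close>

text \<open>Transport by an automorphism \<open>M\<close> over \<open>k[[t]]\<close> changes \<open>A\<close> to \<open>M\<^sup>-\<^sup>1 A M + M\<^sup>-\<^sup>1 dM/dt\<close>; here \<open>N\<close>
  is the inverse of \<open>M\<close>.\<close>

definition formal_transport ::
  "nat \<Rightarrow> 'k::field fls mat \<Rightarrow> 'k fls mat \<Rightarrow> bool" where
  "formal_transport n A B \<longleftrightarrow>
    (\<exists>M N. M \<in> carrier_mat n n \<and> N \<in> carrier_mat n n \<and> inverts_mat M N \<and> inverts_mat N M \<and>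
      B = map_mat fps_to_fls N * A * map_mat fps_to_fls M +
          map_mat fps_to_fls N * map_mat fls_deriv (map_mat fps_to_fls M))"

text \<open>In characteristic \<open>p\<close>, \<open>\<int>\<close> is the image of the integers in \<open>k\<close>, which is the prime field.\<close>

definition formally_diagonalizable :: "nat \<Rightarrow> 'k::field fls mat \<Rightarrow> bool" where
  "formally_diagonalizable n A \<longleftrightarrow>
    (\<exists>c. (\<forall>i<n. c i \<in> \<int>) \<and>
      formal_transport n A (mat_diag n (\<lambda>i. fls_const (c i) * inverse fls_X)))"

definition fls_derivation :: "('k::field fls \<Rightarrow> 'k fls) \<Rightarrow> bool" where
  "fls_derivation D \<longleftrightarrow>
    (\<forall>f g. D (f + g) = D f + D g \<and> D (f * g) = f * D g + g * D f) \<and>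
    (\<forall>c. D (fls_const c) = 0)"

text \<open>The contraction with the derivation \<open>D\<close> of the connection \<open>v \<mapsto> dv + A v dt\<close>. Over a perfect
  field of positive characteristic, all derivations of \<open>k((t))\<close> are multiples of \<open>d/dt\<close>.\<close>

definition formal_covariant_derivative ::
  "'k::field fls mat \<Rightarrow> ('k fls \<Rightarrow> 'k fls) \<Rightarrow> 'k fls vec \<Rightarrow> 'k fls vec" where
  "formal_covariant_derivative A D v = map_vec D v + D fls_X \<cdot>\<^sub>v (A *\<^sub>v v)"

definition formal_lattice :: "nat \<Rightarrow> 'k::field fls vec set" where
  "formal_lattice n = map_vec fps_to_fls ` carrier_vec n"

definition formal_line :: "'k::field fls vec \<Rightarrow> 'k fls vec set" where
  "formal_line m = {fps_to_fls f \<cdot>\<^sub>v m | f. True}"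

definition generic_line :: "'k::field fls vec \<Rightarrow> 'k fls vec set" where
  "generic_line m = {f \<cdot>\<^sub>v m | f. True}"

definition formal_direct_sum ::
  "nat \<Rightarrow> 'k::field fls vec set \<Rightarrow> (nat \<Rightarrow> 'k fls vec set) \<Rightarrow> bool" where
  "formal_direct_sum n S L \<longleftrightarrow>
    (\<forall>j<n. L j \<subseteq> S) \<and>
    (\<forall>v\<in>S. \<exists>!u. u \<in> (\<Pi>\<^sub>E j\<in>{..<n}. L j) \<and> v = vec n (\<lambda>i. \<Sum>j<n. u j $ i))"

text \<open>
  The line bundle over \<open>k[[t]]\<close> with generator \<open>m\<close> is stable under the formal connection (which has
  values in its generic fibre, tensored with \<open>dt\<close>), and the induced connection has at most a simple
  pole and vanishing p-curvature.
\<close>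

definition formal_log_line_connection ::
  "'k::field fls mat \<Rightarrow> 'k fls vec \<Rightarrow> bool" where
  "formal_log_line_connection A m \<longleftrightarrow>
    (\<forall>D. fls_derivation D \<longrightarrow>
      (\<forall>v\<in>generic_line m. formal_covariant_derivative A D v \<in> generic_line m)) \<and>
    (\<forall>v\<in>formal_line m. fls_X \<cdot>\<^sub>v formal_covariant_derivative A fls_deriv v \<in> formal_line m) \<and>
    (\<forall>D. fls_derivation D \<longrightarrow>
      (\<forall>v\<in>generic_line m.
        (formal_covariant_derivative A D ^^ CHAR('k)) v =
        formal_covariant_derivative A (D ^^ CHAR('k)) v))"

definition formally_sum_of_log_lines :: "nat \<Rightarrow> 'k::field fls mat \<Rightarrow> bool" where
  "formally_sum_of_log_lines n A \<longleftrightarrow>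
    (\<exists>m. (\<forall>j<n. m j \<in> formal_lattice n \<and> m j \<noteq> 0\<^sub>v n \<and> formal_log_line_connection A (m j)) \<and>
      formal_direct_sum n (formal_lattice n) (\<lambda>j. formal_line (m j)))"

end

theory Submission
  imports Defs "HOL-Analysis.Abstract_Limits" "Jordan_Normal_Form.Determinant"
begin

text \<open>
  Let \<open>t\<close> be a local coordinate at a pole, and let \<open>\<theta> = t d/dt\<close>. A logarithmic connection has a
  connection matrix \<open>B dt/t\<close> with \<open>B\<close> regular, so contraction with \<open>\<theta>\<close> gives an operator
  \<open>\<nabla> = \<theta> + B\<close> that preserves the formal lattice \<open>k[[t]]\<^sup>n\<close>. In characteristic \<open>p\<close> one has
  \<open>\<theta>\<^sup>p = \<theta>\<close>, so the p-curvature, evaluated at \<open>\<theta>\<close>, is \<open>\<nabla>\<^sup>p - \<nabla>\<close>. If it vanishes, then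
  \<open>X\<^sup>p - X\<close>, which is the product of all \<open>X - m\<close> with \<open>m\<close> in the prime field, annihilates \<open>\<nabla>\<close>, and
  every standard basis vector \<open>e\<^sub>j\<close> is a sum of eigenvectors \<open>u\<^sub>j\<^sub>m\<close> with eigenvalues \<open>m\<close>. The
  determinant is multilinear, so one component of each \<open>e\<^sub>j\<close> can be chosen such that the constant
  terms of the chosen eigenvectors form a basis of \<open>k\<^sup>n\<close>. The eigenvectors then form a basis of the
  lattice, in which the matrix of \<open>\<nabla>\<close> is diagonal. This is \<open>formal_diagonalization\<close>.

  A diagonal form decomposes the lattice into the lines spanned by the columns of the transporting
  matrix. If \<open>m\<close> is such a column, with eigenvalue \<open>c\<close>, then \<open>t\<^sup>-\<^sup>c m\<close> is horizontal for every
  derivation of \<open>k((t))\<close>, so the p-curvature of the line vanishes. All derivations have to be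
  considered here; they are multiples of \<open>d/dt\<close> because \<open>k((t))\<close> is generated by \<open>t\<close> and the p-th
  powers. Conversely, if the lattice is a sum of logarithmic lines of p-curvature zero, then \<open>\<nabla>\<close>
  preserves the lattice and \<open>\<nabla>\<^sup>p = \<nabla>\<close> holds on each line. Thus the two formal conditions and the
  condition \<open>log_p_curvature_zero\<close> on \<open>B\<close> are equivalent.

  It remains to compare \<open>B\<close> with the connection on the curve. A local coordinate generates the
  differentials on a whole neighbourhood \<open>D\<close> of the pole (\<open>etale_neighbourhood\<close>), which gives
  \<open>d/dt\<close> a meaning there. The entries of \<open>B\<close> are the Taylor expansions of functions on \<open>D\<close>, and
  Taylor expansion is compatible with \<open>\<theta>\<close>. It is also injective
  (\<open>infinitely_divisible_zero\<close>): the germs divisible by all powers of \<open>t\<close> form a prime ideal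
  different from the maximal ideal, and the local ring has dimension one. Hence \<open>\<nabla>\<^sup>p = \<nabla>\<close> holds
  formally if and only if it holds on \<open>D\<close> (\<open>log_p_curvature_zero_iff\<close>).

  Finally, \<open>\<nabla>\<^sup>p = \<nabla>\<close> near a single pole makes the p-curvature vanish everywhere
  (\<open>log_derivative_imp_p_curvature_zero\<close>). Where \<open>t\<close> is invertible, the eigenvectors \<open>u\<^sub>j\<^sub>m\<close> multiplied
  by \<open>t\<^sup>p\<^sup>-\<^sup>m\<close> are horizontal sections, and they generate the bundle. On a function multiple of a
  horizontal section, \<open>\<nabla>\<^sub>\<eta>\<close> only differentiates the function, so \<open>(\<nabla>\<^sub>\<eta>)\<^sup>p\<close> agrees with
  \<open>\<nabla>\<close> along \<open>\<eta>\<^sup>p\<close> for all vector fields \<open>\<eta>\<close>. The curve is irreducible and the p-curvature of a section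
  is a section, so its vanishing on a nonempty open set implies its vanishing everywhere. This direction
  uses that the connection has a pole.
\<close>

section \<open>Operators annihilated by \<open>X\<^sup>p - X\<close>\<close>

lemma of_nat_power_CHAR:
  fixes k :: nat
  assumes "CHAR('r::idom) > 0"
  shows "(of_nat k :: 'r) ^ CHAR('r) = of_nat k"
proof (induction k)
  case 0 then show ?case using assms by (simp add: power_0_left)
next
  case (Suc k)
  have "prime CHAR('r)" using assms by (rule prime_CHAR_semidom)
  then have "(1 + of_nat k :: 'r) ^ CHAR('r) = 1 ^ CHAR('r) + of_nat k ^ CHAR('r)"
    by (rule freshmans_dream) simp
  then show ?case using Suc by simp
qed

lemma of_int_eq_of_nat_less_CHAR:
  fixes z :: int
  assumes "CHAR('r::idom) > 0"
  obtains m where "m < CHAR('r)" "(of_int z :: 'r) = of_nat m"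
proof
  let ?p = "CHAR('r)"
  show "nat (z mod int ?p) < ?p" using assms by (simp add: nat_less_iff)
  have "(of_int z :: 'r) = of_int (z mod int ?p)"
  proof -
    have "(of_int z :: 'r) = of_int (int ?p * (z div int ?p) + z mod int ?p)" by simp
    also have "\<dots> = of_int (z mod int ?p)" unfolding of_int_add of_int_mult by simp
    finally show ?thesis .
  qed
  then show "(of_int z :: 'r) = of_nat (nat (z mod int ?p))" using assms by simp
qed

lemma of_int_power_CHAR:
  assumes "CHAR('r::idom) > 0"
  shows "(of_int z :: 'r) ^ CHAR('r) = of_int z"
proof -
  obtain m where m: "(of_int z :: 'r) = of_nat m"
    using of_int_eq_of_nat_less_CHAR[OF assms] by blast
  show ?thesis unfolding m by (rule of_nat_power_CHAR[OF assms])
qed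

text \<open>
  An operator annihilated by \<open>X\<^sup>p - X\<close> is diagonalizable with eigenvalues in the prime field; the
  projection to the eigenspace of \<open>m\<close> is a polynomial in the operator, with coefficients \<open>c m k\<close>.
  The lemma is about the sequence \<open>a k\<close> of the iterates of the operator on a vector, so that it can be
  applied to each coefficient of a power series and to each value of a function.
\<close>

lemma eigenprojection_coefficients:
  fixes p :: nat
  assumes p: "p = CHAR('r::idom)" "p > 0"
  obtains c :: "nat \<Rightarrow> nat \<Rightarrow> 'r::idom" where
    "\<And>a m. a p = a 1 \<Longrightarrow>
      (\<Sum>k<p. c m k * a (Suc k)) = of_nat m * (\<Sum>k<p. c m k * a k)"
    "\<And>a. (\<Sum>m<p. \<Sum>k<p. c m k * a k) = a 0"
proof -
  have prime: "prime p" using p prime_CHAR_semidom by blast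
  have p1: "p > 1" using prime prime_gt_1_nat by blast
  \<comment> \<open>\<open>P m\<close> has the value 1 at \<open>m\<close> and 0 at the other elements of the prime field.\<close>
  define P :: "nat \<Rightarrow> 'r poly" where "P m = 1 - [:- of_nat m, 1:] ^ (p - 1)" for m
  have deg: "degree (P m) < p" for m
  proof -
    have "degree ([:- of_nat m, 1:] ^ (p - 1) :: 'r poly) \<le> p - 1"
      by (rule order.trans[OF degree_power_le]) simp
    then have "degree (P m) \<le> p - 1" unfolding P_def
      by (intro degree_diff_le) auto
    then show ?thesis using p1 by simp
  qed
  have shift: "[:- of_nat m, 1:] * P m = monom 1 1 - monom 1 p" for m
  proof -
    have "[:- of_nat m, 1:] * [:- of_nat m, 1:] ^ (p - 1) = ([:- of_nat m, 1:] :: 'r poly) ^ p"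
      using p1 by (cases p) auto
    also have "[:- of_nat m, 1:] ^ p = (monom 1 1 + [:- of_nat m :: 'r:]) ^ p"
      by (simp add: monom_Suc monom_0)
    also have "\<dots> = monom 1 1 ^ p + [:- of_nat m:] ^ p"
      by (rule freshmans_dream) (use prime p in auto)
    also have "monom (1::'r) 1 ^ p = monom 1 p" by (simp add: monom_power)
    also have "[:- of_nat m:] ^ p = [:(- of_nat m :: 'r) ^ p:]" by (simp add: poly_const_pow)
    also have "(- of_nat m :: 'r) ^ p = - of_nat m"
      using of_int_power_CHAR[of "- int m", where 'r='r] p by simp
    finally have power: "[:- of_nat m, 1:] * [:- of_nat m, 1:] ^ (p - 1)
      = monom 1 p + [:- of_nat m :: 'r:]" .
    have "[:- of_nat m, 1:] * P m
      = [:- of_nat m, 1:] - [:- of_nat m, 1:] * [:- of_nat m, 1:] ^ (p - 1)"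
      by (simp only: P_def right_diff_distrib mult_1_right)
    then show ?thesis unfolding power by (simp add: monom_Suc monom_0)
  qed
  \<comment> \<open>Both sides have degree less than \<open>p\<close> and agree at the \<open>p\<close> elements of the prime field.\<close>
  have sumP: "(\<Sum>m<p. P m) = 1"
  proof (rule poly_eqI_degree)
    let ?A = "of_nat ` {..<p} :: 'r set"
    have inj: "inj_on (of_nat :: nat \<Rightarrow> 'r) {..<p}"
    proof (rule inj_onI)
      have "i = j" if "of_nat i = (of_nat j :: 'r)" "i \<le> j" "j < p" for i j
      proof -
        have "(of_nat (j - i) :: 'r) = 0" using that by (simp add: of_nat_diff)
        then have "p dvd j - i" using p by (simp add: of_nat_eq_0_iff_char_dvd)
        then show ?thesis using that by (metis diff_is_0_eq' diff_less_mono2 dvd_imp_le le_antisym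
              less_imp_diff_less linorder_not_less zero_less_diff)
      qed
      then show "i = j" if "i \<in> {..<p}" "j \<in> {..<p}" "of_nat i = (of_nat j :: 'r)" for i j
        using that by (metis lessThan_iff linorder_le_cases)
    qed
    then have card: "card ?A = p" by (simp add: card_image)
    show "degree (\<Sum>m<p. P m) < card ?A"
      using deg card by (intro degree_sum_less) (use p in auto)
    show "degree (1::'r poly) < card ?A" using card p by simp
    fix x assume "x \<in> ?A"
    then obtain j where j: "j < p" "x = of_nat j" by auto
    have "poly (P m) x = (if m = j then 1 else 0)" if m: "m < p" for m
    proof (cases "m = j")
      case True then show ?thesis using p1 j by (simp add: P_def power_0_left)
    next
      case False
      define d where "d = (of_int (int j - int m) :: 'r)"
      have "d \<noteq> 0" using inj j m False by (auto simp: inj_on_def d_def)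
      moreover have "d * d ^ (p - 1) = d"
        using of_int_power_CHAR[where 'r='r, of "int j - int m"] p power_eq_if[of d p]
        by (simp add: d_def)
      ultimately have "d ^ (p - 1) = 1" by simp
      then have "(of_nat j - of_nat m :: 'r) ^ (p - 1) = 1" by (simp add: d_def)
      then show ?thesis using False j by (simp add: P_def)
    qed
    then have "poly (\<Sum>m<p. P m) x = (\<Sum>m<p. if m = j then 1 else 0)"
      by (simp add: poly_sum)
    then show "poly (\<Sum>m<p. P m) x = poly 1 x" using j by simp
  qed
  show thesis
  proof (rule that[of "\<lambda>m k. coeff (P m) k"])
    fix a :: "nat \<Rightarrow> 'r" and m :: nat
    assume a: "a p = a 1"
    have z: "coeff (P m) p = 0" using deg coeff_eq_0 by blast
    have "(\<Sum>k\<le>p. coeff ([:- of_nat m, 1:] * P m) k * a k)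
        = (\<Sum>k\<le>p. (if k = 1 then 1 else 0) * a k) - (\<Sum>k\<le>p. (if k = p then 1 else 0) * a k)"
      unfolding shift by (simp add: left_diff_distrib sum_subtractf eq_commute)
    also have "\<dots> = a 1 - a p" using p1 by (simp add: if_distrib[of "\<lambda>x. x * _"] cong: if_cong)
    finally have 0: "(\<Sum>k\<le>p. coeff ([:- of_nat m, 1:] * P m) k * a k) = 0" using a by simp
    have "(\<Sum>k\<le>p. coeff ([:- of_nat m, 1:] * P m) k * a k)
       = (\<Sum>k\<le>p. coeff (pCons 0 (P m)) k * a k) - of_nat m * (\<Sum>k\<le>p. coeff (P m) k * a k)"
      by (simp add: sum_distrib_left sum_subtractf[symmetric] algebra_simps)
    also have "(\<Sum>k\<le>p. coeff (pCons 0 (P m)) k * a k) = (\<Sum>k<p. coeff (P m) k * a (Suc k))"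
      by (simp add: sum.atMost_shift)
    also have "(\<Sum>k\<le>p. coeff (P m) k * a k) = (\<Sum>k<p. coeff (P m) k * a k)"
      using z by (simp add: lessThan_Suc_atMost[symmetric])
    finally show "(\<Sum>k<p. coeff (P m) k * a (Suc k)) = of_nat m * (\<Sum>k<p. coeff (P m) k * a k)"
      using 0 by simp
  next
    fix a :: "nat \<Rightarrow> 'r"
    have "(\<Sum>m<p. \<Sum>k<p. coeff (P m) k * a k) = (\<Sum>k<p. coeff (\<Sum>m<p. P m) k * a k)"
      by (subst sum.swap) (simp add: coeff_sum sum_distrib_right)
    also have "\<dots> = (\<Sum>k<p. if k = 0 then a 0 else 0)"
      unfolding sumP by (intro sum.cong) auto
    also have "\<dots> = a 0" using p by simp
    finally show "(\<Sum>m<p. \<Sum>k<p. coeff (P m) k * a k) = a 0" .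
  qed
qed

text \<open>
  The determinant is multilinear in the rows, so it is the sum of the determinants on the right over
  all choices \<open>\<phi>\<close>.
\<close>

lemma det_sum_rows_nonzero:
  fixes a :: "nat \<Rightarrow> nat \<Rightarrow> nat \<Rightarrow> 'r::comm_ring_1"
  assumes "det (mat n n (\<lambda>(i, j). \<Sum>m<q. a i m j)) \<noteq> 0"
  obtains \<phi> where "\<And>i. i < n \<Longrightarrow> \<phi> i < q" "det (mat n n (\<lambda>(i, j). a i (\<phi> i) j)) \<noteq> 0"
proof -
  let ?F = "PiE {0..<n} (\<lambda>_. {..<q})"
  have "det (mat n n (\<lambda>(i, j). \<Sum>m<q. a i m j))
      = (\<Sum>\<pi> | \<pi> permutes {0..<n}. signof \<pi> * (\<Prod>i = 0..<n. \<Sum>m<q. a i m (\<pi> i)))"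
    by (subst det_def') (auto intro!: sum.cong prod.cong simp: permutes_def)
  also have "\<dots> = (\<Sum>\<pi> | \<pi> permutes {0..<n}. \<Sum>\<phi>\<in>?F. signof \<pi> * (\<Prod>i = 0..<n. a i (\<phi> i) (\<pi> i)))"
    by (subst prod_sum_PiE) (auto simp: sum_distrib_left)
  also have "\<dots> = (\<Sum>\<phi>\<in>?F. det (mat n n (\<lambda>(i, j). a i (\<phi> i) j)))"
    by (subst sum.swap, rule sum.cong[OF refl], subst det_def')
      (auto intro!: sum.cong prod.cong simp: permutes_def)
  finally have "\<exists>\<phi>\<in>?F. det (mat n n (\<lambda>(i, j). a i (\<phi> i) j)) \<noteq> 0"
    by (rule_tac ccontr) (use assms in simp)
  then obtain \<phi> where \<phi>: "\<phi> \<in> ?F" "det (mat n n (\<lambda>(i, j). a i (\<phi> i) j)) \<noteq> 0" by blast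
  show thesis by (rule that[of \<phi>]) (use \<phi> in auto)
qed

section \<open>Diagonalization over the ring of power series\<close>

text \<open>The contraction of the connection \<open>v \<mapsto> dv + B v dt/t\<close> with \<open>t d/dt\<close>.\<close>

definition log_connection ::
  "nat \<Rightarrow> (nat \<Rightarrow> nat \<Rightarrow> 'k::comm_ring_1 fps) \<Rightarrow> (nat \<Rightarrow> 'k fps) \<Rightarrow> nat \<Rightarrow> 'k fps" where
  "log_connection n B v i = fps_X * fps_deriv (v i) + (\<Sum>l<n. B i l * v l)"

definition std_basis :: "nat \<Rightarrow> nat \<Rightarrow> 'r::zero_neq_one" where
  "std_basis j i = (if i = j then 1 else 0)"

lemma log_connection_combination:
  "log_connection n B (\<lambda>i. \<Sum>k\<in>K. fps_const (c k) * w k i) i =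
    (\<Sum>k\<in>K. fps_const (c k) * log_connection n B (w k) i)"
proof -
  have "(\<Sum>l<n. B i l * (\<Sum>k\<in>K. fps_const (c k) * w k l)) =
    (\<Sum>k\<in>K. fps_const (c k) * (\<Sum>l<n. B i l * w k l))"
    unfolding sum_distrib_left by (subst sum.swap) (simp add: mult_ac)
  then show ?thesis
    unfolding log_connection_def
    by (simp add: fps_deriv_sum sum_distrib_left distrib_left sum.distrib mult_ac)
qed

lemma fps_mat_invertible:
  fixes M :: "'k::field fps mat"
  assumes M: "M \<in> carrier_mat n n" and det: "fps_nth (det M) 0 \<noteq> 0"
  obtains N where "N \<in> carrier_mat n n" "inverts_mat M N" "inverts_mat N M"
proof
  let ?N = "inverse (det M) \<cdot>\<^sub>m adj_mat M"
  have inv: "inverse (det M) * det M = 1" using det by (rule inverse_mult_eq_1)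
  note adj = adj_mat[OF M]
  show N: "?N \<in> carrier_mat n n" using adj by simp
  have "M * ?N = 1\<^sub>m n"
    using mult_smult_distrib[OF M adj(1)] adj(2) inv by (auto simp: mult_smult_assoc_mat)
  then show "inverts_mat M ?N" using M by (simp add: inverts_mat_def)
  have "?N * M = 1\<^sub>m n"
    using mult_smult_assoc_mat[OF adj(1) M] adj(3) inv by auto
  then show "inverts_mat ?N M" using adj(1) by (simp add: inverts_mat_def)
qed

text \<open>
  The eigenprojections split \<open>e\<^sub>j\<close> into eigenvectors \<open>u j m\<close>. Their constant terms add up to the
  identity matrix, so some choice of one eigenvector for each \<open>j\<close> has constant terms with nonzero
  determinant, and then it is a basis over the power series.
\<close>

theorem formal_diagonalization:
  fixes B :: "nat \<Rightarrow> nat \<Rightarrow> 'k::field fps"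
  assumes p: "p = CHAR('k)" "p > 0"
    and pcurv: "\<And>j i. j < n \<Longrightarrow> i < n \<Longrightarrow>
      (log_connection n B ^^ p) (std_basis j) i = log_connection n B (std_basis j) i"
  obtains M N \<phi> where "M \<in> carrier_mat n n" "N \<in> carrier_mat n n"
    "inverts_mat M N" "inverts_mat N M"
    "\<And>i j. i < n \<Longrightarrow> j < n \<Longrightarrow>
      log_connection n B (\<lambda>i. M $$ (i, j)) i = of_nat (\<phi> j) * M $$ (i, j)"
proof -
  let ?L = "log_connection n B"
  obtain c :: "nat \<Rightarrow> nat \<Rightarrow> 'k" where
    c1: "\<And>a m. a p = a 1 \<Longrightarrow>
      (\<Sum>k<p. c m k * a (Suc k)) = of_nat m * (\<Sum>k<p. c m k * a k)" and
    c2: "\<And>a. (\<Sum>m<p. \<Sum>k<p. c m k * a k) = a 0"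
    by (rule eigenprojection_coefficients[OF p]) (erule that; assumption)
  define w where "w j k = (?L ^^ k) (std_basis j)" for j k
  define u where "u j m i = (\<Sum>k<p. fps_const (c m k) * w j k i)" for j m i
  have Lw: "?L (w j k) = w j (Suc k)" for j k by (simp add: w_def)
  have eigen: "?L (u j m) i = of_nat m * u j m i" if "j < n" "i < n" for j m i
  proof (rule fps_ext)
    fix r
    have "?L (u j m) i = (\<Sum>k<p. fps_const (c m k) * w j (Suc k) i)"
      unfolding u_def log_connection_combination Lw ..
    then have "fps_nth (?L (u j m) i) r = (\<Sum>k<p. c m k * fps_nth (w j (Suc k) i) r)"
      by (simp add: fps_sum_nth)
    also have "\<dots> = of_nat m * (\<Sum>k<p. c m k * fps_nth (w j k i) r)"
      by (rule c1[of "\<lambda>k. fps_nth (w j k i) r"]) (use pcurv that in \<open>simp add: w_def\<close>)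
    also have "\<dots> = fps_nth (of_nat m * u j m i) r"
      by (simp add: u_def fps_sum_nth fps_of_nat[symmetric])
    finally show "fps_nth (?L (u j m) i) r = fps_nth (of_nat m * u j m i) r" .
  qed
  have total: "(\<Sum>m<p. fps_nth (u j m i) r) = fps_nth (std_basis j i) r" for j i r
    using c2[of "\<lambda>k. fps_nth (w j k i) r"] by (simp add: u_def fps_sum_nth w_def)
  have "mat n n (\<lambda>(j, i). \<Sum>m<p. fps_nth (u j m i) 0) = 1\<^sub>m n"
    by (rule eq_matI) (auto simp: total std_basis_def)
  then have "det (mat n n (\<lambda>(j, i). \<Sum>m<p. fps_nth (u j m i) 0)) \<noteq> 0" by simp
  then obtain \<phi> where \<phi>: "det (mat n n (\<lambda>(j, i). fps_nth (u j (\<phi> j) i) 0)) \<noteq> 0"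
    by (rule det_sum_rows_nonzero)
  define M where "M = transpose_mat (mat n n (\<lambda>(j, i). u j (\<phi> j) i))"
  have M: "M \<in> carrier_mat n n" by (simp add: M_def)
  interpret const_coeff: comm_ring_hom "\<lambda>f :: 'k fps. fps_nth f 0"
    by unfold_locales (auto simp: fps_mult_nth_0)
  have "det M = det (mat n n (\<lambda>(j, i). u j (\<phi> j) i))"
    unfolding M_def by (rule det_transpose[of _ n]) simp
  then have "fps_nth (det M) 0 = det (map_mat (\<lambda>f. fps_nth f 0) (mat n n (\<lambda>(j, i). u j (\<phi> j) i)))"
    by (simp add: const_coeff.hom_det)
  also have "map_mat (\<lambda>f. fps_nth f 0) (mat n n (\<lambda>(j, i). u j (\<phi> j) i))
      = mat n n (\<lambda>(j, i). fps_nth (u j (\<phi> j) i) 0)"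
    by (rule eq_matI) auto
  finally have "fps_nth (det M) 0 \<noteq> 0" using \<phi> by simp
  then obtain N where N: "N \<in> carrier_mat n n" "inverts_mat M N" "inverts_mat N M"
    using fps_mat_invertible[OF M] by blast
  show thesis
  proof (rule that[OF M N])
    fix i j assume ij: "i < n" "j < n"
    have "?L (\<lambda>i. M $$ (i, j)) i = ?L (u j (\<phi> j)) i"
      unfolding log_connection_def M_def using ij by simp
    then show "?L (\<lambda>i. M $$ (i, j)) i = of_nat (\<phi> j) * M $$ (i, j)"
      using eigen ij by (simp add: M_def)
  qed
qed

section \<open>Derivations of the field of Laurent series\<close>

text \<open>The induction step of the Leibniz rule for powers of a derivation; \<open>F i j\<close> stands for the product
  of the \<open>i\<close>-th derivative of one factor and the \<open>j\<close>-th derivative of the other.\<close>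

lemma sum_choose_Suc:
  fixes F :: "nat \<Rightarrow> nat \<Rightarrow> 'r::comm_semiring_1"
  shows "(\<Sum>i\<le>m. of_nat (m choose i) * (F (Suc i) (m - i) + F i (Suc (m - i)))) =
    (\<Sum>i\<le>Suc m. of_nat (Suc m choose i) * F i (Suc m - i))"
proof -
  have "(\<Sum>i\<le>Suc m. of_nat (Suc m choose i) * F i (Suc m - i))
      = F 0 (Suc m) + (\<Sum>i\<le>m. of_nat (m choose i) * F (Suc i) (m - i))
        + (\<Sum>i\<le>m. of_nat (m choose Suc i) * F (Suc i) (m - i))"
    by (simp only: sum.atMost_Suc_shift) (simp add: distrib_right sum.distrib add_ac)
  also have "F 0 (Suc m) + (\<Sum>i\<le>m. of_nat (m choose i) * F (Suc i) (m - i))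
        + (\<Sum>i\<le>m. of_nat (m choose Suc i) * F (Suc i) (m - i))
      = (\<Sum>i\<le>m. of_nat (m choose i) * F (Suc i) (m - i))
        + (\<Sum>i\<le>Suc m. of_nat (m choose i) * F i (Suc m - i))"
    by (simp only: sum.atMost_Suc_shift) (simp add: add_ac)
  also have "(\<Sum>i\<le>Suc m. of_nat (m choose i) * F i (Suc m - i))
      = (\<Sum>i\<le>m. of_nat (m choose i) * F i (Suc (m - i)))"
    by (simp add: Suc_diff_le binomial_eq_0)
  finally show ?thesis by (simp add: distrib_left sum.distrib)
qed

lemma sum_choose_CHAR:
  fixes F :: "nat \<Rightarrow> nat \<Rightarrow> 'r::comm_semiring_1"
  assumes p: "prime p" "p = CHAR('r)"
  shows "(\<Sum>i\<le>p. of_nat (p choose i) * F i (p - i)) = F 0 p + F p 0"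
proof -
  have "(\<Sum>i\<le>p. of_nat (p choose i) * F i (p - i)) = (\<Sum>i\<in>{0, p}. of_nat (p choose i) * F i (p - i))"
  proof (rule sum.mono_neutral_right)
    show "\<forall>i\<in>{..p} - {0, p}. of_nat (p choose i) * F i (p - i) = 0"
    proof
      fix i assume "i \<in> {..p} - {0, p}"
      then have "p dvd (p choose i)" using p(1) by (intro dvd_choose_prime) auto
      then have "of_nat (p choose i) = (0::'r)" by (simp add: of_nat_eq_0_iff_char_dvd p(2))
      then show "of_nat (p choose i) * F i (p - i) = 0" by simp
    qed
  qed auto
  also have "\<dots> = F 0 p + F p 0" using prime_gt_0_nat[OF p(1)] by simp
  finally show ?thesis .
qed

text \<open>The Frobenius is additive on polynomials, and a coefficient of \<open>f\<^sup>p\<close> depends only on a truncation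
  of \<open>f\<close>.\<close>

lemma fps_power_CHAR_nth:
  fixes f :: "'k::field fps"
  assumes p: "p = CHAR('k)" "p > 0"
  shows "fps_nth (f ^ p) m = (if p dvd m then fps_nth f (m div p) ^ p else 0)"
proof -
  have prime: "prime CHAR('k fps)" using p prime_CHAR_semidom[where 'a='k] by simp
  let ?N = "Suc m"
  let ?t = "\<lambda>i. fps_const (fps_nth f i) * fps_X ^ i"
  have f: "f = (\<Sum>i<?N. ?t i) + fps_X ^ ?N * fps_shift ?N f"
    by (rule fps_ext) (auto simp: fps_sum_nth fps_X_power_mult_nth
        if_distrib[of "\<lambda>x. _ * x"] cong: if_cong simp del: power_Suc sum.lessThan_Suc)
  have "f ^ p = (\<Sum>i<?N. ?t i) ^ p + (fps_X ^ ?N * fps_shift ?N f) ^ p"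
    by (subst f, rule freshmans_dream[OF prime]) (simp add: p)
  also have "(\<Sum>i<?N. ?t i) ^ p = (\<Sum>i<?N. ?t i ^ p)"
    by (rule freshmans_dream_sum[OF prime]) (simp add: p)
  also have "(fps_X ^ ?N * fps_shift ?N f) ^ p = fps_X ^ (?N * p) * fps_shift ?N f ^ p"
    by (simp only: power_mult_distrib power_mult)
  finally have fp: "f ^ p = (\<Sum>i<?N. ?t i ^ p) + fps_X ^ (?N * p) * fps_shift ?N f ^ p" .
  have lt: "m < ?N * p" using p(2) by (cases p) auto
  have t: "fps_nth (?t i ^ p) m = (if m = i * p then fps_nth f i ^ p else 0)" for i
    by (simp add: power_mult_distrib fps_const_power power_mult[symmetric])
  have "fps_nth (f ^ p) m = (\<Sum>i<?N. if m = i * p then fps_nth f i ^ p else 0)"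
    unfolding fp using lt by (simp add: fps_sum_nth t fps_X_power_mult_nth del: sum.lessThan_Suc)
  also have "\<dots> = (if p dvd m then fps_nth f (m div p) ^ p else 0)"
  proof (cases "p dvd m")
    case True
    then obtain j where j: "m = j * p" by (auto simp: dvd_def mult.commute)
    have "(\<Sum>i<?N. if m = i * p then fps_nth f i ^ p else 0)
        = (\<Sum>i<?N. if i = j then fps_nth f i ^ p else 0)"
      using p(2) by (intro sum.cong) (auto simp: j)
    moreover have "j < ?N" using p(2) by (cases p) (auto simp: j)
    ultimately show ?thesis using True p(2) j by (simp del: sum.lessThan_Suc)
  qed (auto intro!: sum.neutral)
  finally show ?thesis .
qed

lemma fps_to_fls_sum: "fps_to_fls (\<Sum>i\<in>I. f i) = (\<Sum>i\<in>I. fps_to_fls (f i))"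
  by (induction I rule: infinite_finite_induct) simp_all

text \<open>The coefficients of the exponents in one residue class modulo \<open>p\<close> form a power of \<open>t\<close> times a p-th
  power, because every coefficient has a p-th root.\<close>

lemma fls_eq_sum_power_CHAR:
  fixes f :: "'k::alg_closed_field fls"
  assumes p: "p = CHAR('k)" "p > 0"
  obtains g where "f = (\<Sum>i<p. fls_X ^ i * g i ^ p)"
proof -
  \<comment> \<open>A shift by a multiple of \<open>p\<close> removes the pole and is itself a p-th power.\<close>
  define s where "s = nat (- fls_subdegree f)"
  have s: "- int (p * s) \<le> fls_subdegree f"
  proof -
    have "int s \<le> int (p * s)" using p(2) by (cases p) auto
    moreover have "- fls_subdegree f \<le> int s" by (simp add: s_def)
    ultimately show ?thesis by linarith
  qed
  define F where "F = fls_regpart (fls_shift (- int (p * s)) f)"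
  have F: "fps_to_fls F = fls_shift (- int (p * s)) f"
    by (rule fls_eqI) (use s in \<open>auto simp: F_def fls_eq0_below_subdegree\<close>)
  have fF: "f = fls_X_inv ^ (p * s) * fps_to_fls F"
    unfolding F by (simp add: fls_X_inv_power_times_conv_shift)
  have "\<exists>r. r ^ p = c" for c :: 'k
    using nth_root_exists[of p c] p(2) by auto
  then obtain r where r: "r c ^ p = c" for c :: 'k by metis
  define h where "h i = Abs_fps (\<lambda>m. r (fps_nth F (m * p + i)))" for i
  have "F = (\<Sum>i<p. fps_X ^ i * h i ^ p)"
  proof (rule fps_ext)
    fix m
    have "fps_nth (fps_X ^ i * h i ^ p) m = (if i = m mod p then fps_nth F m else 0)" if "i < p" for i
    proof (cases "i \<le> m \<and> p dvd m - i")
      case True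
      then obtain q where "m = q * p + i" by (metis dvd_div_mult_self le_add_diff_inverse2)
      then show ?thesis using that by (simp add: fps_X_power_mult_nth fps_power_CHAR_nth[OF p] h_def r)
    next
      case False
      then have "i \<noteq> m mod p" by (auto simp: minus_mod_eq_mult_div)
      then show ?thesis using False by (auto simp: fps_X_power_mult_nth fps_power_CHAR_nth[OF p])
    qed
    then have "(\<Sum>i<p. fps_nth (fps_X ^ i * h i ^ p) m) = (\<Sum>i<p. if i = m mod p then fps_nth F m else 0)"
      by (intro sum.cong) auto
    then show "fps_nth F m = fps_nth (\<Sum>i<p. fps_X ^ i * h i ^ p) m"
      using p(2) by (simp add: fps_sum_nth)
  qed
  then have "fps_to_fls F = (\<Sum>i<p. fls_X ^ i * fps_to_fls (h i) ^ p)"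
    by (simp add: fps_to_fls_sum fls_times_fps_to_fls fps_to_fls_power)
  then have "f = (\<Sum>i<p. fls_X ^ i * (fls_X_inv ^ s * fps_to_fls (h i)) ^ p)"
    by (subst fF) (simp add: sum_distrib_left power_mult_distrib power_mult[symmetric] mult_ac)
  then show thesis by (rule that)
qed

lemma fls_derivation_simps:
  assumes "fls_derivation D"
  shows "D (f + g) = D f + D g" "D (f * g) = f * D g + g * D f" "D (fls_const c) = 0"
    "D 0 = 0" "D 1 = 0" "D (of_nat m) = 0"
  using assms unfolding fls_derivation_def
  by (simp_all add: fls_of_nat) (metis fls_const_0 fls_const_1)+

lemma fls_derivation_sum:
  assumes "fls_derivation D"
  shows "D (\<Sum>i\<in>I. f i) = (\<Sum>i\<in>I. D (f i))"
  by (induction I rule: infinite_finite_induct) (simp_all add: fls_derivation_simps[OF assms])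

lemma fls_derivation_power:
  assumes "fls_derivation D"
  shows "D (f ^ m) = of_nat m * f ^ (m - 1) * D f"
proof (induction m)
  case (Suc m)
  then show ?case
    by (cases m) (simp_all add: fls_derivation_simps[OF assms] algebra_simps)
qed (simp add: fls_derivation_simps[OF assms])

lemma fls_derivation_fls_deriv: "fls_derivation fls_deriv"
  by (simp add: fls_derivation_def algebra_simps)

text \<open>A derivation annihilates p-th powers, so it is determined by its value at \<open>t\<close>.\<close>

lemma fls_derivation_eq_multiple_deriv:
  fixes f :: "'k::alg_closed_field fls"
  assumes D: "fls_derivation D" and p: "CHAR('k) > 0"
  shows "D f = D fls_X * fls_deriv f"
proof -
  obtain g where f: "f = (\<Sum>i<CHAR('k). fls_X ^ i * g i ^ CHAR('k))"
    using fls_eq_sum_power_CHAR[OF refl p] .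
  have zero: "(of_nat CHAR('k) :: 'k fls) = 0"
    by (simp add: of_nat_eq_0_iff_char_dvd)
  have "D' f = (\<Sum>i<CHAR('k). g i ^ CHAR('k) * (of_nat i * fls_X ^ (i - 1) * D' fls_X))"
    if "fls_derivation D'" for D'
    unfolding f using that
    by (simp add: fls_derivation_sum fls_derivation_simps fls_derivation_power zero)
  from this[OF D] this[OF fls_derivation_fls_deriv]
  show ?thesis by (simp add: sum_distrib_left mult_ac)
qed

lemma fls_derivation_funpow_mult:
  assumes D: "fls_derivation D"
  shows "(D ^^ m) (f * g) = (\<Sum>i\<le>m. of_nat (m choose i) * ((D ^^ i) f * (D ^^ (m - i)) g))"
proof (induction m)
  case (Suc m)
  have "(D ^^ Suc m) (f * g) = (\<Sum>i\<le>m. of_nat (m choose i) *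
      ((D ^^ Suc i) f * (D ^^ (m - i)) g + (D ^^ i) f * (D ^^ Suc (m - i)) g))"
    by (simp add: Suc fls_derivation_sum[OF D] fls_derivation_simps[OF D] algebra_simps)
  then show ?case by (simp only: sum_choose_Suc[of m "\<lambda>i j. (D ^^ i) f * (D ^^ j) g"])
qed simp

text \<open>In the Leibniz rule for the p-th power, the inner binomial coefficients are divisible by \<open>p\<close>.\<close>

lemma fls_derivation_power_CHAR:
  fixes D :: "'k::field fls \<Rightarrow> 'k fls"
  assumes D: "fls_derivation D" and p: "CHAR('k) > 0"
  shows "fls_derivation (D ^^ CHAR('k))"
proof -
  let ?p = "CHAR('k)"
  have prime: "prime ?p" using p by (rule prime_CHAR_semidom)
  have add: "(D ^^ m) (f + g) = (D ^^ m) f + (D ^^ m) g" for m f g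
    by (induction m) (simp_all add: fls_derivation_simps[OF D])
  have "(D ^^ m) 0 = 0" for m by (induction m) (simp_all add: fls_derivation_simps[OF D])
  then have const: "(D ^^ ?p) (fls_const c) = 0" for c
    using p by (cases ?p) (simp_all add: funpow_Suc_right fls_derivation_simps[OF D] del: funpow.simps)
  have "(D ^^ ?p) (f * g) = f * (D ^^ ?p) g + g * (D ^^ ?p) f" for f g
    unfolding fls_derivation_funpow_mult[OF D]
    by (subst sum_choose_CHAR[OF prime]) (simp_all add: mult_ac)
  with add const show ?thesis by (simp add: fls_derivation_def)
qed

section \<open>Formal logarithmic connections\<close>

definition log_matrix :: "nat \<Rightarrow> (nat \<Rightarrow> nat \<Rightarrow> 'k::field fps) \<Rightarrow> 'k fls mat" where
  "log_matrix n B = mat n n (\<lambda>(i, j). fps_to_fls (B i j) * inverse fls_X)"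

text \<open>The p-curvature of \<open>d + B dt/t\<close>, evaluated at \<open>t d/dt\<close>, on the standard basis. It contains
  \<open>log_connection n B\<close> itself because \<open>t d/dt\<close> is its own p-th power.\<close>

definition log_p_curvature_zero :: "nat \<Rightarrow> (nat \<Rightarrow> nat \<Rightarrow> 'k::field fps) \<Rightarrow> bool" where
  "log_p_curvature_zero n B \<longleftrightarrow> (\<forall>j<n. \<forall>i<n.
    (log_connection n B ^^ CHAR('k)) (std_basis j) i = log_connection n B (std_basis j) i)"

interpretation fps_to_fls: comm_ring_hom fps_to_fls
  by unfold_locales (auto simp: fls_times_fps_to_fls)

lemma fls_X_mult_inverse_mult: "fls_X * (inverse fls_X * a) = (a :: 'k::field fls)"
  by (simp add: mult.assoc[symmetric])

lemma log_matrix_eigenvector_iff: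
  assumes "i < n"
  shows "(\<Sum>l<n. log_matrix n B $$ (i, l) * fps_to_fls (v l)) + fls_deriv (fps_to_fls (v i)) =
      fps_to_fls (v i) * (fls_const c * inverse fls_X) \<longleftrightarrow>
    log_connection n B v i = fps_const c * v i" (is "?l = ?r \<longleftrightarrow> _")
proof -
  have l: "fls_X * ?l = fps_to_fls (log_connection n B v i)"
    using assms
    by (simp add: log_connection_def log_matrix_def fls_times_fps_to_fls fps_to_fls_sum
        fls_deriv_fps_to_fls distrib_left sum_distrib_left mult_ac fls_X_mult_inverse_mult)
  have r: "fls_X * ?r = fps_to_fls (fps_const c * v i)"
    by (simp add: fls_times_fps_to_fls mult_ac)
  have "?l = ?r \<longleftrightarrow> fls_X * ?l = fls_X * ?r" by simp
  then show ?thesis unfolding l r by simp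
qed

text \<open>Transport by \<open>M\<close> to a diagonal matrix means that the columns of \<open>M\<close> are eigenvectors; this form
  no longer contains the inverse of \<open>M\<close>.\<close>

lemma formal_transport_mat_diag_iff:
  fixes A :: "'k::field fls mat"
  assumes A: "A \<in> carrier_mat n n"
  shows "formal_transport n A (mat_diag n d) \<longleftrightarrow>
    (\<exists>M N. M \<in> carrier_mat n n \<and> N \<in> carrier_mat n n \<and> inverts_mat M N \<and> inverts_mat N M \<and>
      (\<forall>i<n. \<forall>j<n. (\<Sum>l<n. A $$ (i, l) * fps_to_fls (M $$ (l, j))) + fls_deriv (fps_to_fls (M $$ (i, j)))
        = fps_to_fls (M $$ (i, j)) * d j))"
proof -
  have "mat_diag n d = map_mat fps_to_fls N * A * map_mat fps_to_fls M +
          map_mat fps_to_fls N * map_mat fls_deriv (map_mat fps_to_fls M) \<longleftrightarrow>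
      (\<forall>i<n. \<forall>j<n. (\<Sum>l<n. A $$ (i, l) * fps_to_fls (M $$ (l, j))) + fls_deriv (fps_to_fls (M $$ (i, j)))
        = fps_to_fls (M $$ (i, j)) * d j)" (is "?D = ?N * A * ?M + ?N * ?M' \<longleftrightarrow> ?entries")
    if M: "M \<in> carrier_mat n n" and N: "N \<in> carrier_mat n n"
      and MN: "inverts_mat M N" and NM: "inverts_mat N M" for M N :: "'k fps mat"
  proof -
    have c: "?M \<in> carrier_mat n n" "?N \<in> carrier_mat n n" "?M' \<in> carrier_mat n n" "?D \<in> carrier_mat n n"
      "A * ?M + ?M' \<in> carrier_mat n n" "A * ?M \<in> carrier_mat n n"
      using M N A by auto
    have NM1: "?N * ?M = 1\<^sub>m n"
      using fps_to_fls.mat_hom_mult[OF N M] NM N by (simp add: inverts_mat_def fps_to_fls.mat_hom_one)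
    have MN1: "?M * ?N = 1\<^sub>m n"
      using fps_to_fls.mat_hom_mult[OF M N] MN M by (simp add: inverts_mat_def fps_to_fls.mat_hom_one)
    have rhs: "?N * A * ?M + ?N * ?M' = ?N * (A * ?M + ?M')"
      using c A by (simp add: assoc_mult_mat[of _ n n _ n _ n] mult_add_distrib_mat[of _ n n _ n])
    have "?D = ?N * (A * ?M + ?M') \<longleftrightarrow> ?M * ?D = A * ?M + ?M'"
    proof
      assume "?D = ?N * (A * ?M + ?M')"
      then have "?M * ?D = (?M * ?N) * (A * ?M + ?M')"
        using c by (simp add: assoc_mult_mat[of _ n n _ n _ n])
      then show "?M * ?D = A * ?M + ?M'" using MN1 c by simp
    next
      assume "?M * ?D = A * ?M + ?M'"
      then have "?N * (A * ?M + ?M') = (?N * ?M) * ?D"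
        using c by (simp add: assoc_mult_mat[of _ n n _ n _ n])
      then show "?D = ?N * (A * ?M + ?M')" using NM1 c by simp
    qed
    also have "\<dots> \<longleftrightarrow> ?entries"
      using A M by (auto simp: mat_eq_iff mat_diag_mult_right[of _ n] scalar_prod_def
          atLeast0LessThan mult.commute)
    finally show ?thesis unfolding rhs .
  qed
  then show ?thesis unfolding formal_transport_def by blast
qed

theorem log_p_curvature_zero_imp_diagonalizable:
  fixes B :: "nat \<Rightarrow> nat \<Rightarrow> 'k::field fps"
  assumes p: "CHAR('k) > 0" and B: "log_p_curvature_zero n B"
  shows "formally_diagonalizable n (log_matrix n B)"
proof -
  obtain M N \<phi> where MN: "M \<in> carrier_mat n n" "N \<in> carrier_mat n n" "inverts_mat M N" "inverts_mat N M"
    and eigen: "\<And>i j. i < n \<Longrightarrow> j < n \<Longrightarrow>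
      log_connection n B (\<lambda>i. M $$ (i, j)) i = of_nat (\<phi> j) * M $$ (i, j)"
    using formal_diagonalization[OF refl p, of n B] B unfolding log_p_curvature_zero_def by blast
  have "formal_transport n (log_matrix n B)
      (mat_diag n (\<lambda>j. fls_const (of_nat (\<phi> j)) * inverse fls_X))"
  proof (subst formal_transport_mat_diag_iff)
    show "log_matrix n B \<in> carrier_mat n n" by (simp add: log_matrix_def)
    show "\<exists>M N. M \<in> carrier_mat n n \<and> N \<in> carrier_mat n n \<and> inverts_mat M N \<and> inverts_mat N M \<and>
      (\<forall>i<n. \<forall>j<n. (\<Sum>l<n. log_matrix n B $$ (i, l) * fps_to_fls (M $$ (l, j)))
          + fls_deriv (fps_to_fls (M $$ (i, j)))
        = fps_to_fls (M $$ (i, j)) * (fls_const (of_nat (\<phi> j)) * inverse fls_X))"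
    proof (rule exI[of _ M], rule exI[of _ N], intro conjI allI impI MN)
      fix i j assume "i < n" "j < n"
      then show "(\<Sum>l<n. log_matrix n B $$ (i, l) * fps_to_fls (M $$ (l, j)))
          + fls_deriv (fps_to_fls (M $$ (i, j)))
        = fps_to_fls (M $$ (i, j)) * (fls_const (of_nat (\<phi> j)) * inverse fls_X)"
        using log_matrix_eigenvector_iff[of i n B "\<lambda>i. M $$ (i, j)" "of_nat (\<phi> j)"] eigen[of i j]
        by (simp add: fps_of_nat)
    qed
  qed
  then show ?thesis
    unfolding formally_diagonalizable_def by (auto intro!: exI[of _ "\<lambda>j. of_nat (\<phi> j)"])
qed

lemma formal_covariant_derivative_vec:
  assumes "A \<in> carrier_mat n n"
  shows "formal_covariant_derivative A D (vec n v) =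
    vec n (\<lambda>i. D (v i) + D fls_X * (\<Sum>l<n. A $$ (i, l) * v l))"
  using assms by (intro eq_vecI)
    (auto simp: formal_covariant_derivative_def scalar_prod_def atLeast0LessThan)

lemma formal_covariant_derivative_sum:
  assumes A: "A \<in> carrier_mat n n" and D: "fls_derivation D" and u: "\<And>l. l < n \<Longrightarrow> u l \<in> carrier_vec n"
  shows "(formal_covariant_derivative A D ^^ k) (vec n (\<lambda>i. \<Sum>l<n. u l $ i)) =
      vec n (\<lambda>i. \<Sum>l<n. (formal_covariant_derivative A D ^^ k) (u l) $ i) \<and>
    (\<forall>l<n. (formal_covariant_derivative A D ^^ k) (u l) \<in> carrier_vec n)"
proof (induction k)
  case 0 then show ?case using u by simp
next
  case (Suc k)
  let ?w = "\<lambda>l. (formal_covariant_derivative A D ^^ k) (u l)"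
  have w: "formal_covariant_derivative A D (?w l) =
      vec n (\<lambda>i. D (?w l $ i) + D fls_X * (\<Sum>j<n. A $$ (i, j) * ?w l $ j))" if "l < n" for l
  proof -
    have "?w l = vec n (\<lambda>i. ?w l $ i)" using Suc that by auto
    then show ?thesis using formal_covariant_derivative_vec[OF A, of D "\<lambda>i. ?w l $ i"] by simp
  qed
  have "(\<Sum>j<n. A $$ (i, j) * (\<Sum>l<n. ?w l $ j)) = (\<Sum>l<n. \<Sum>j<n. A $$ (i, j) * ?w l $ j)" for i
    unfolding sum_distrib_left by (rule sum.swap)
  then have "formal_covariant_derivative A D (vec n (\<lambda>i. \<Sum>l<n. ?w l $ i)) =
      vec n (\<lambda>i. \<Sum>l<n. formal_covariant_derivative A D (?w l) $ i)"
    unfolding formal_covariant_derivative_vec[OF A]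
    by (intro eq_vecI) (simp_all add: w fls_derivation_sum[OF D] sum.distrib sum_distrib_left)
  then show ?case using Suc w by auto
qed

text \<open>On the coefficient of \<open>t\<^sup>m\<close>, the operator \<open>t d/dt\<close> is multiplication by \<open>m\<close>, and \<open>m\<^sup>p = m\<close> in the
  prime field.\<close>

lemma fls_euler_derivation:
  defines "\<theta> \<equiv> \<lambda>f :: 'k::field fls. fls_X * fls_deriv f"
  assumes p: "CHAR('k) > 0"
  shows "fls_derivation \<theta>" "\<theta> ^^ CHAR('k) = \<theta>"
proof -
  show "fls_derivation \<theta>" by (simp add: fls_derivation_def \<theta>_def algebra_simps)
  have nth: "fls_nth (\<theta> f) m = of_int m * fls_nth f m" for f m
    by (simp add: \<theta>_def fls_X_times_conv_shift)
  have "fls_nth ((\<theta> ^^ k) f) m = of_int m ^ k * fls_nth f m" for k f m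
    by (induction k) (simp_all add: nth mult_ac)
  then show "\<theta> ^^ CHAR('k) = \<theta>"
    by (intro ext fls_eqI) (simp add: nth of_int_power_CHAR[OF p])
qed

lemma formal_covariant_derivative_log_matrix:
  fixes B :: "nat \<Rightarrow> nat \<Rightarrow> 'k::field fps"
  shows "(formal_covariant_derivative (log_matrix n B) (\<lambda>f. fls_X * fls_deriv f) ^^ k)
      (vec n (\<lambda>i. fps_to_fls (v i))) =
    vec n (\<lambda>i. fps_to_fls ((log_connection n B ^^ k) v i))"
proof (induction k)
  case (Suc k)
  have A: "log_matrix n B \<in> carrier_mat n n" by (simp add: log_matrix_def)
  have "formal_covariant_derivative (log_matrix n B) (\<lambda>f. fls_X * fls_deriv f)
      (vec n (\<lambda>i. fps_to_fls (w i))) = vec n (\<lambda>i. fps_to_fls (log_connection n B w i))" for w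
    unfolding formal_covariant_derivative_vec[OF A]
    by (intro eq_vecI) (simp_all add: log_connection_def log_matrix_def fls_times_fps_to_fls
        fps_to_fls_sum fls_deriv_fps_to_fls sum_distrib_left mult_ac fls_X_mult_inverse_mult)
  then show ?case using Suc by simp
qed simp

lemma fls_derivation_X_intpow:
  fixes D :: "'k::alg_closed_field fls \<Rightarrow> 'k fls"
  assumes D: "fls_derivation D" and p: "CHAR('k) > 0"
  shows "D (fls_X_intpow z) * fls_X = of_int z * fls_X_intpow z * D fls_X"
proof -
  have "fls_X_intpow (z - 1) * fls_X = (fls_X_intpow z :: 'k fls)"
    by (simp add: fls_X_conv_shift_1 fls_times_both_shifted_simp)
  then show ?thesis
    unfolding fls_derivation_eq_multiple_deriv[OF D p, of "fls_X_intpow z"] fls_deriv_X_intpow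
    by (simp add: mult_ac)
qed

text \<open>
  The lines are spanned by the columns of the transporting matrix. On the line of an eigenvector with
  eigenvalue \<open>z\<close>, the vector \<open>t\<^sup>-\<^sup>z m\<close> is horizontal, so with respect to this generator of the
  generic line the covariant derivative along \<open>D\<close> is \<open>D\<close>, and its p-th power is the one along \<open>D\<^sup>p\<close>.
\<close>

theorem formally_diagonalizable_imp_sum_of_log_lines:
  fixes A :: "'k::alg_closed_field fls mat"
  assumes A: "A \<in> carrier_mat n n" and p: "CHAR('k) > 0" and diag: "formally_diagonalizable n A"
  shows "formally_sum_of_log_lines n A"
proof -
  obtain c M N where c: "\<And>j. j < n \<Longrightarrow> c j \<in> \<int>"
    and M: "M \<in> carrier_mat n n" and N: "N \<in> carrier_mat n n"
    and inv: "inverts_mat M N" "inverts_mat N M"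
    and eigen: "\<And>i j. i < n \<Longrightarrow> j < n \<Longrightarrow>
      (\<Sum>l<n. A $$ (i, l) * fps_to_fls (M $$ (l, j))) + fls_deriv (fps_to_fls (M $$ (i, j)))
        = fps_to_fls (M $$ (i, j)) * (fls_const (c j) * inverse fls_X)"
    using diag unfolding formally_diagonalizable_def formal_transport_mat_diag_iff[OF A]
    by blast
  have MN: "M * N = 1\<^sub>m n" and NM: "N * M = 1\<^sub>m n"
    using inv M N by (auto simp: inverts_mat_def)
  define m where "m j = vec n (\<lambda>i. fps_to_fls (M $$ (i, j)))" for j
  have line: "f \<cdot>\<^sub>v m j = vec n (\<lambda>i. f * fps_to_fls (M $$ (i, j)))" for f j
    by (auto simp: m_def)
  have deriv: "formal_covariant_derivative A D (f \<cdot>\<^sub>v m j) =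
      (D f + f * D fls_X * (fls_const (c j) * inverse fls_X)) \<cdot>\<^sub>v m j"
    if D: "fls_derivation D" and j: "j < n" for D f j
  proof (unfold line formal_covariant_derivative_vec[OF A], rule eq_vecI, simp_all)
    fix i assume i: "i < n"
    let ?g = "fps_to_fls (M $$ (i, j))"
    have "D (f * ?g) + D fls_X * (\<Sum>l<n. A $$ (i, l) * (f * fps_to_fls (M $$ (l, j)))) =
      ?g * D f + f * D fls_X *
        ((\<Sum>l<n. A $$ (i, l) * fps_to_fls (M $$ (l, j))) + fls_deriv ?g)"
      unfolding fls_derivation_simps(2)[OF D] fls_derivation_eq_multiple_deriv[OF D p, of ?g]
      by (simp add: sum_distrib_left algebra_simps)
    then show "D (f * ?g) + D fls_X * (\<Sum>l<n. A $$ (i, l) * (f * fps_to_fls (M $$ (l, j)))) =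
      (D f + f * D fls_X * (fls_const (c j) * inverse fls_X)) * ?g"
      unfolding eigen[OF i j] by (simp add: algebra_simps)
  qed
  have "formal_log_line_connection A (m j)" if j: "j < n" for j
    unfolding formal_log_line_connection_def
  proof (intro conjI allI impI ballI)
    fix D :: "'k fls \<Rightarrow> 'k fls" and v assume "fls_derivation D" "v \<in> generic_line (m j)"
    then show "formal_covariant_derivative A D v \<in> generic_line (m j)"
      by (auto simp: generic_line_def deriv j)
  next
    fix v assume "v \<in> formal_line (m j)"
    then obtain f where v: "v = fps_to_fls f \<cdot>\<^sub>v m j" by (auto simp: formal_line_def)
    have "fls_X \<cdot>\<^sub>v formal_covariant_derivative A fls_deriv v =
      fps_to_fls (fps_X * fps_deriv f + f * fps_const (c j)) \<cdot>\<^sub>v m j"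
      unfolding v deriv[OF fls_derivation_fls_deriv j]
      by (simp add: smult_smult_assoc fls_times_fps_to_fls fls_deriv_fps_to_fls
          distrib_left mult_ac fls_X_mult_inverse_mult)
    then show "fls_X \<cdot>\<^sub>v formal_covariant_derivative A fls_deriv v \<in> formal_line (m j)"
      unfolding formal_line_def by blast
  next
    fix D :: "'k fls \<Rightarrow> 'k fls" and v assume D: "fls_derivation D" and "v \<in> generic_line (m j)"
    then obtain f where v: "v = f \<cdot>\<^sub>v m j" by (auto simp: generic_line_def)
    obtain z where z: "c j = of_int z" using c[OF j] by (auto elim: Ints_cases)
    define x where "x = (fls_X_intpow (- z) :: 'k fls)"
    have flat: "formal_covariant_derivative A D' ((x * g) \<cdot>\<^sub>v m j) = (x * D' g) \<cdot>\<^sub>v m j"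
      if D': "fls_derivation D'" for D' g
    proof -
      have "(D' x + x * D' fls_X * (fls_const (c j) * inverse fls_X)) * fls_X
          = D' x * fls_X + of_int z * x * D' fls_X"
        by (simp add: z fls_of_int algebra_simps)
      also have "\<dots> = 0" unfolding x_def fls_derivation_X_intpow[OF D' p] by (simp add: algebra_simps)
      finally have 0: "D' x + x * D' fls_X * (fls_const (c j) * inverse fls_X) = 0" by simp
      have "D' (x * g) + x * g * D' fls_X * (fls_const (c j) * inverse fls_X)
          = x * D' g + g * (D' x + x * D' fls_X * (fls_const (c j) * inverse fls_X))"
        unfolding fls_derivation_simps(2)[OF D'] by (simp add: algebra_simps)
      then show ?thesis unfolding deriv[OF D' j] 0 by simp
    qed
    have iter: "(formal_covariant_derivative A D ^^ k) ((x * g) \<cdot>\<^sub>v m j) = (x * (D ^^ k) g) \<cdot>\<^sub>v m j" for k g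
      by (induction k) (simp_all add: flat[OF D])
    have f: "f = x * (fls_X_intpow z * f)"
      unfolding x_def mult.assoc[symmetric] fls_X_intpow_times_fls_X_intpow by simp
    show "(formal_covariant_derivative A D ^^ CHAR('k)) v =
        formal_covariant_derivative A (D ^^ CHAR('k)) v"
      unfolding v by (subst (1 2) f) (simp only: iter flat[OF fls_derivation_power_CHAR[OF D p]])
  qed
  moreover have "m j \<in> formal_lattice n" for j
    unfolding formal_lattice_def m_def by (rule image_eqI[of _ _ "vec n (\<lambda>i. M $$ (i, j))"]) auto
  moreover have "m j \<noteq> 0\<^sub>v n" if j: "j < n" for j
  proof
    assume 0: "m j = 0\<^sub>v n"
    have "M $$ (i, j) = 0" if "i < n" for i
      using arg_cong[OF 0, of "\<lambda>v. vec_index v i"] that by (simp add: m_def)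
    then have "(N * M) $$ (j, j) = 0" using M N j by (simp add: scalar_prod_def)
    then show False using NM j by simp
  qed
  moreover have "formal_direct_sum n (formal_lattice n) (\<lambda>j. formal_line (m j))"
    unfolding formal_direct_sum_def
  proof (intro conjI allI impI ballI)
    fix j assume "j < n"
    show "formal_line (m j) \<subseteq> formal_lattice n"
    proof
      fix v assume "v \<in> formal_line (m j)"
      then obtain f where "v = fps_to_fls f \<cdot>\<^sub>v m j" by (auto simp: formal_line_def)
      then have "v = map_vec fps_to_fls (vec n (\<lambda>i. f * M $$ (i, j)))"
        by (auto simp: m_def fls_times_fps_to_fls)
      then show "v \<in> formal_lattice n" by (auto simp: formal_lattice_def)
    qed
  next
    fix v :: "'k fls vec" assume "v \<in> formal_lattice n"
    then obtain x where x: "x \<in> carrier_vec n" "v = map_vec fps_to_fls x"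
      by (auto simp: formal_lattice_def)
    have sum: "vec n (\<lambda>i. \<Sum>j<n. (fps_to_fls (f j) \<cdot>\<^sub>v m j) $ i) = map_vec fps_to_fls (M *\<^sub>v vec n f)" for f
      using M by (intro eq_vecI) (auto simp: m_def scalar_prod_def fps_to_fls_sum
          fls_times_fps_to_fls atLeast0LessThan mult.commute)
    define y where "y = N *\<^sub>v x"
    have y: "y \<in> carrier_vec n" "vec n (\<lambda>j. y $ j) = y" "M *\<^sub>v y = x"
      using x N M MN by (auto simp: y_def assoc_mult_mat_vec[of _ n n _ n, symmetric])
    show "\<exists>!u. u \<in> (\<Pi>\<^sub>E j\<in>{..<n}. formal_line (m j)) \<and> v = vec n (\<lambda>i. \<Sum>j<n. u j $ i)"
    proof (rule ex1I)
      show "restrict (\<lambda>j. fps_to_fls (y $ j) \<cdot>\<^sub>v m j) {..<n} \<in> (\<Pi>\<^sub>E j\<in>{..<n}. formal_line (m j)) \<and>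
        v = vec n (\<lambda>i. \<Sum>j<n. restrict (\<lambda>j. fps_to_fls (y $ j) \<cdot>\<^sub>v m j) {..<n} j $ i)"
        using sum[of "\<lambda>j. y $ j"] x y by (auto simp: formal_line_def)
    next
      fix u assume u: "u \<in> (\<Pi>\<^sub>E j\<in>{..<n}. formal_line (m j)) \<and> v = vec n (\<lambda>i. \<Sum>j<n. u j $ i)"
      then have "\<forall>j\<in>{..<n}. \<exists>f. u j = fps_to_fls f \<cdot>\<^sub>v m j"
        by (auto simp: formal_line_def PiE_iff)
      then obtain f where f: "\<And>j. j < n \<Longrightarrow> u j = fps_to_fls (f j) \<cdot>\<^sub>v m j" by (metis lessThan_iff)
      have "v = map_vec fps_to_fls (M *\<^sub>v vec n f)"
        unfolding sum[symmetric] using u f by (auto intro!: eq_vecI)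
      then have "map_vec fps_to_fls x = map_vec fps_to_fls (M *\<^sub>v vec n f)" using x by simp
      then have "x = M *\<^sub>v vec n f"
        using x M by (auto simp: vec_eq_iff)
      then have "y = vec n f"
        using M N NM by (simp add: y_def assoc_mult_mat_vec[of _ n n _ n, symmetric])
      then show "u = restrict (\<lambda>j. fps_to_fls (y $ j) \<cdot>\<^sub>v m j) {..<n}"
        using u f by (auto simp: PiE_iff extensional_def restrict_def)
    qed
  qed
  ultimately show ?thesis unfolding formally_sum_of_log_lines_def by blast
qed

text \<open>
  Each \<open>e\<^sub>j\<close> is a sum of vectors in the lines. Each line is stable under the covariant derivative along
  \<open>t d/dt\<close>, so the image of \<open>e\<^sub>j\<close> lies in the lattice; its coordinates are the entries of \<open>B\<close>. The
  p-th power of this operator agrees with the operator on each line, hence on \<open>e\<^sub>j\<close>.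
\<close>

theorem sum_of_log_lines_imp_log_p_curvature_zero:
  fixes A :: "'k::field fls mat"
  assumes A: "A \<in> carrier_mat n n" and p: "CHAR('k) > 0" and lines: "formally_sum_of_log_lines n A"
  obtains B where "A = log_matrix n B" "log_p_curvature_zero n B"
proof -
  let ?\<theta> = "\<lambda>f :: 'k fls. fls_X * fls_deriv f"
  let ?cd = "formal_covariant_derivative A"
  obtain m where m: "\<And>j. j < n \<Longrightarrow> m j \<in> formal_lattice n" "\<And>j. j < n \<Longrightarrow> formal_log_line_connection A (m j)"
    and sum: "formal_direct_sum n (formal_lattice n) (\<lambda>j. formal_line (m j))"
    using lines unfolding formally_sum_of_log_lines_def by blast
  note \<theta> = fls_euler_derivation[OF p]
  define e where "e j = vec n (\<lambda>i. fps_to_fls (std_basis j i) :: 'k fls)" for j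
  have "\<exists>u :: nat \<Rightarrow> 'k fls vec. (\<forall>l<n. u l \<in> formal_line (m l)) \<and> e j = vec n (\<lambda>i. \<Sum>l<n. u l $ i)" for j
  proof -
    have "e j = map_vec fps_to_fls (vec n (std_basis j))" by (auto simp: e_def)
    then have "e j \<in> formal_lattice n" by (auto simp: formal_lattice_def)
    then show ?thesis using sum unfolding formal_direct_sum_def by (metis PiE_mem lessThan_iff)
  qed
  then obtain u :: "nat \<Rightarrow> nat \<Rightarrow> 'k fls vec" where u: "\<And>j l. l < n \<Longrightarrow> u j l \<in> formal_line (m l)"
    "\<And>j. e j = vec n (\<lambda>i. \<Sum>l<n. u j l $ i)" by metis
  have line_lattice: "v \<in> formal_lattice n" if "l < n" "v \<in> formal_line (m l)" for l v
    using sum that unfolding formal_direct_sum_def by blast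
  have lattice_carrier: "v \<in> carrier_vec n" if "v \<in> formal_lattice n" for v :: "'k fls vec"
    using that by (auto simp: formal_lattice_def)
  have line_generic: "v \<in> generic_line (m l)" if "v \<in> formal_line (m l)" for l v
    using that by (auto simp: formal_line_def generic_line_def)
  have u_carrier: "u j l \<in> carrier_vec n" if "l < n" for j l
    using that u(1) line_lattice lattice_carrier by blast
  have "?cd ?\<theta> (u j l) = fls_X \<cdot>\<^sub>v ?cd fls_deriv (u j l)" if "l < n" for j l
    using u_carrier[OF that, of j] A
    by (intro eq_vecI) (auto simp: formal_covariant_derivative_def distrib_left)
  then have cd_line: "?cd ?\<theta> (u j l) \<in> formal_line (m l)" if "l < n" for j l
    using m(2)[OF that] u(1)[OF that] that unfolding formal_log_line_connection_def by auto
  have cd_sum: "(?cd ?\<theta> ^^ k) (e j) = vec n (\<lambda>i. \<Sum>l<n. (?cd ?\<theta> ^^ k) (u j l) $ i)" for j k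
    using formal_covariant_derivative_sum[OF A \<theta>(1), of "u j" k, OF u_carrier]
    unfolding u(2)[symmetric] by blast
  have cd_e: "?cd ?\<theta> (e j) = vec n (\<lambda>i. \<Sum>l<n. ?cd ?\<theta> (u j l) $ i)" for j
    using cd_sum[of 1 j] by simp
  have "\<exists>b. \<forall>i<n. fls_X * A $$ (i, j) = fps_to_fls (b i)" if j: "j < n" for j
  proof -
    have "\<exists>x. \<forall>i<n. ?cd ?\<theta> (u j l) $ i = fps_to_fls (x i)" if "l < n" for l
      using line_lattice[OF that cd_line[OF that, of j]] by (force simp: formal_lattice_def)
    then obtain x where x: "\<And>l i. l < n \<Longrightarrow> i < n \<Longrightarrow> ?cd ?\<theta> (u j l) $ i = fps_to_fls (x l i)"
      by metis
    have "fls_X * A $$ (i, j) = fps_to_fls (\<Sum>l<n. x l i)" if i: "i < n" for i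
    proof -
      have "?cd ?\<theta> (e j) $ i = fls_X * (\<Sum>l<n. A $$ (i, l) * fps_to_fls (std_basis j l))"
        unfolding e_def formal_covariant_derivative_vec[OF A] using i by (simp add: std_basis_def)
      also have "(\<Sum>l<n. A $$ (i, l) * fps_to_fls (std_basis j l)) = (\<Sum>l<n. if l = j then A $$ (i, j) else 0)"
        by (intro sum.cong) (auto simp: std_basis_def)
      finally have "?cd ?\<theta> (e j) $ i = fls_X * A $$ (i, j)" using j by simp
      then show ?thesis using i x unfolding cd_e by (simp add: fps_to_fls_sum)
    qed
    then show ?thesis by (intro exI[of _ "\<lambda>i. \<Sum>l<n. x l i"] allI impI)
  qed
  then have "\<forall>j\<in>{..<n}. \<exists>b. \<forall>i<n. fls_X * A $$ (i, j) = fps_to_fls (b i)" by blast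
  from bchoice[OF this] obtain b where
    b: "\<And>i j. i < n \<Longrightarrow> j < n \<Longrightarrow> fls_X * A $$ (i, j) = fps_to_fls (b j i)"
    by blast
  define B where "B i j = b j i" for i j
  have AB: "A = log_matrix n B"
    using A b[symmetric] by (intro eq_matI) (auto simp: log_matrix_def B_def)
  have "(?cd ?\<theta> ^^ CHAR('k)) (u j l) = ?cd ?\<theta> (u j l)" if "l < n" for j l
    using m(2)[OF that] line_generic[OF u(1)[OF that]] \<theta> unfolding formal_log_line_connection_def
    by metis
  then have pcurv: "(?cd ?\<theta> ^^ CHAR('k)) (e j) = ?cd ?\<theta> (e j)" for j
    using cd_sum[of "CHAR('k)" j] unfolding cd_e by (auto intro!: eq_vecI)
  have "log_p_curvature_zero n B"
    unfolding log_p_curvature_zero_def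
  proof (intro allI impI)
    fix j i assume "i < n"
    then show "(log_connection n B ^^ CHAR('k)) (std_basis j) i = log_connection n B (std_basis j) i"
      using arg_cong[OF pcurv[of j], of "\<lambda>v. vec_index v i"]
        formal_covariant_derivative_log_matrix[of "CHAR('k)" n B "std_basis j"]
        formal_covariant_derivative_log_matrix[of 1 n B "std_basis j"]
      by (simp add: e_def AB)
  qed
  with AB show thesis by (rule that)
qed

section \<open>Regular functions on a smooth curve\<close>

locale curve =
  fixes C :: "('x, 'k::alg_closed_field) fun_space"
  assumes smooth: "smooth_curve C"
begin

abbreviation zopen :: "'x set \<Rightarrow> bool" where "zopen U \<equiv> openin (zariski C) U"
abbreviation points :: "'x set" where "points \<equiv> topspace (zariski C)"
abbreviation near :: "'x \<Rightarrow> 'x filter" where "near x \<equiv> nhdsin (zariski C) x"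

lemma zopen_subset_points: "zopen U \<Longrightarrow> x \<in> U \<Longrightarrow> x \<in> points"
  using openin_subset by blast

lemma zopens_meet: "zopen U \<Longrightarrow> zopen V \<Longrightarrow> U \<noteq> {} \<Longrightarrow> V \<noteq> {} \<Longrightarrow> U \<inter> V \<noteq> {}"
  using smooth unfolding smooth_curve_def irreducible_space_def by blast

lemma sheaf: "function_sheaf (zariski C) (regular C)"
  using smooth by (simp add: smooth_curve_def variety_def space_with_functions_def)

lemma regular_cong:
  assumes "zopen U" "f \<in> regular C U" "\<And>x. x \<in> U \<Longrightarrow> g x = f x"
  shows "g \<in> regular C U"
  using sheaf[unfolded function_sheaf_def, THEN conjunct1, rule_format, of U f g] assms by simp

lemma regular_subset: "f \<in> regular C U \<Longrightarrow> zopen U \<Longrightarrow> zopen V \<Longrightarrow> V \<subseteq> U \<Longrightarrow> f \<in> regular C V"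
  using sheaf[unfolded function_sheaf_def, THEN conjunct2, THEN conjunct1, rule_format, of U V f] by simp

lemma regular_local:
  assumes "zopen U" "\<And>x. x \<in> U \<Longrightarrow> \<exists>V. zopen V \<and> x \<in> V \<and> V \<subseteq> U \<and> f \<in> regular C V"
  shows "f \<in> regular C U"
  using sheaf[unfolded function_sheaf_def, THEN conjunct2, THEN conjunct2, rule_format, of U f] assms
  by simp

lemma regular_const: "zopen U \<Longrightarrow> (\<lambda>_. c) \<in> regular C U"
  using smooth by (simp add: smooth_curve_def variety_def space_with_functions_def)

lemma regular_add: "zopen U \<Longrightarrow> f \<in> regular C U \<Longrightarrow> g \<in> regular C U \<Longrightarrow> (\<lambda>x. f x + g x) \<in> regular C U"
  using smooth by (simp add: smooth_curve_def variety_def space_with_functions_def)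

lemma regular_mult: "zopen U \<Longrightarrow> f \<in> regular C U \<Longrightarrow> g \<in> regular C U \<Longrightarrow> (\<lambda>x. f x * g x) \<in> regular C U"
  using smooth by (simp add: smooth_curve_def variety_def space_with_functions_def)

lemma regular_uminus: "zopen U \<Longrightarrow> f \<in> regular C U \<Longrightarrow> (\<lambda>x. - f x) \<in> regular C U"
  using regular_mult[OF _ regular_const[of U "-1"], of f] by simp

lemma regular_diff: "zopen U \<Longrightarrow> f \<in> regular C U \<Longrightarrow> g \<in> regular C U \<Longrightarrow> (\<lambda>x. f x - g x) \<in> regular C U"
  using regular_add[OF _ _ regular_uminus, of U f g] by simp

lemma regular_power: "zopen U \<Longrightarrow> f \<in> regular C U \<Longrightarrow> (\<lambda>x. f x ^ m) \<in> regular C U"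
  by (induction m) (auto intro: regular_mult regular_const)

lemma regular_sum:
  "zopen U \<Longrightarrow> (\<And>i. i \<in> I \<Longrightarrow> f i \<in> regular C U) \<Longrightarrow> (\<lambda>x. \<Sum>i\<in>I. f i x) \<in> regular C U"
  by (induction I rule: infinite_finite_induct) (auto intro: regular_add regular_const)

lemmas regular_intros = regular_const regular_add regular_mult regular_uminus regular_diff
  regular_power regular_sum

lemma affine_neighbourhood:
  assumes "x \<in> points"
  obtains A where "affine_open C A" "x \<in> A"
  using smooth assms unfolding smooth_curve_def variety_def by blast

lemma affine_open_zopen: "affine_open C A \<Longrightarrow> zopen A"
  by (simp add: affine_open_def)

lemma affine_open_nonvanishing: "affine_open C A \<Longrightarrow> h \<in> regular C A \<Longrightarrow> zopen {y\<in>A. h y \<noteq> 0}"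
  by (simp add: affine_open_def)

lemma affine_open_fractions:
  "affine_open C A \<Longrightarrow> h \<in> regular C A \<Longrightarrow> f \<in> regular C {y\<in>A. h y \<noteq> 0} \<longleftrightarrow>
    (\<exists>g\<in>regular C A. \<exists>n::nat. \<forall>y\<in>A. h y \<noteq> 0 \<longrightarrow> f y = g y / h y ^ n)"
  unfolding affine_open_def by (elim conjE) (drule bspec, assumption, erule spec)

text \<open>The principal open sets form a base, and the functions on them are fractions. Replacing \<open>h\<close> by a
  power removes the exponent of the denominator.\<close>

lemma regular_fraction:
  assumes U: "zopen U" and f: "f \<in> regular C U" and A: "affine_open C A" and x: "x \<in> U" "x \<in> A"
  obtains g h where "g \<in> regular C A" "h \<in> regular C A" "h x \<noteq> 0" "{y\<in>A. h y \<noteq> 0} \<subseteq> U"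
    "\<And>y. y \<in> A \<Longrightarrow> h y \<noteq> 0 \<Longrightarrow> f y = g y / h y"
proof -
  have UA: "zopen (U \<inter> A)" using U affine_open_zopen[OF A] by blast
  then obtain h where h: "h \<in> regular C A" "h x \<noteq> 0" "{y\<in>A. h y \<noteq> 0} \<subseteq> U \<inter> A"
    using A x unfolding affine_open_def by (meson IntI inf_le2)
  have "f \<in> regular C {y\<in>A. h y \<noteq> 0}"
    using regular_subset[OF f U affine_open_nonvanishing[OF A h(1)]] h(3) by blast
  then obtain g n where g: "g \<in> regular C A" "\<And>y. y \<in> A \<Longrightarrow> h y \<noteq> 0 \<Longrightarrow> f y = g y / h y ^ n"
    using affine_open_fractions[OF A h(1)] by blast
  show thesis
  proof (rule that[of "\<lambda>y. g y * h y" "\<lambda>y. h y ^ Suc n"])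
    show "(\<lambda>y. g y * h y) \<in> regular C A" "(\<lambda>y. h y ^ Suc n) \<in> regular C A"
      using affine_open_zopen[OF A] g h by (blast intro: regular_intros)+
  qed (use g h in auto)
qed

lemma regular_nonvanishing_zopen:
  assumes U: "zopen U" and f: "f \<in> regular C U"
  shows "zopen {y\<in>U. f y \<noteq> 0}"
proof (subst openin_subopen, safe)
  fix x assume x: "x \<in> U" "f x \<noteq> 0"
  obtain A where A: "affine_open C A" "x \<in> A" using zopen_subset_points[OF U x(1)] affine_neighbourhood by blast
  obtain g h where gh: "g \<in> regular C A" "h \<in> regular C A" "h x \<noteq> 0" "{y\<in>A. h y \<noteq> 0} \<subseteq> U"
    "\<And>y. y \<in> A \<Longrightarrow> h y \<noteq> 0 \<Longrightarrow> f y = g y / h y"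
    using regular_fraction[OF U f A(1) x(1) A(2)] by blast
  have "(\<lambda>y. g y * h y) \<in> regular C A" using affine_open_zopen[OF A(1)] gh by (blast intro: regular_intros)
  then have "zopen {y\<in>A. g y * h y \<noteq> 0}" by (rule affine_open_nonvanishing[OF A(1)])
  then show "\<exists>T. zopen T \<and> x \<in> T \<and> T \<subseteq> {y \<in> U. f y \<noteq> 0}"
    using gh x A by (intro exI[of _ "{y\<in>A. g y * h y \<noteq> 0}"]) auto
qed

lemma regular_inverse:
  assumes U: "zopen U" and f: "f \<in> regular C U" and nz: "\<And>y. y \<in> U \<Longrightarrow> f y \<noteq> 0"
  shows "(\<lambda>y. inverse (f y)) \<in> regular C U"
proof (rule regular_local[OF U])
  fix x assume x: "x \<in> U"
  obtain A where A: "affine_open C A" "x \<in> A" using zopen_subset_points[OF U x] affine_neighbourhood by blast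
  obtain g h where gh: "g \<in> regular C A" "h \<in> regular C A" "h x \<noteq> 0" "{y\<in>A. h y \<noteq> 0} \<subseteq> U"
    "\<And>y. y \<in> A \<Longrightarrow> h y \<noteq> 0 \<Longrightarrow> f y = g y / h y"
    using regular_fraction[OF U f A(1) x A(2)] by blast
  have reg: "(\<lambda>y. g y * h y) \<in> regular C A" "(\<lambda>y. h y * h y) \<in> regular C A"
    using affine_open_zopen[OF A(1)] gh by (blast intro: regular_intros)+
  let ?T = "{y\<in>A. g y * h y \<noteq> 0}"
  have "\<forall>y\<in>A. g y * h y \<noteq> 0 \<longrightarrow> inverse (f y) = (h y * h y) / (g y * h y) ^ 1"
    by (auto simp: gh(5) divide_simps)
  then have "(\<lambda>y. inverse (f y)) \<in> regular C ?T"
    unfolding affine_open_fractions[OF A(1) reg(1)] using reg(2)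
    by (intro bexI[of _ "\<lambda>y. h y * h y"] exI[of _ "1::nat"])
  moreover have "zopen ?T" using affine_open_nonvanishing[OF A(1) reg(1)] .
  moreover have "x \<in> ?T" using nz[OF x] gh A by auto
  moreover have "?T \<subseteq> U" using gh(4) by auto
  ultimately show "\<exists>V. zopen V \<and> x \<in> V \<and> V \<subseteq> U \<and> (\<lambda>y. inverse (f y)) \<in> regular C V" by blast
qed

lemma regular_divide:
  assumes "zopen U" "f \<in> regular C U" "g \<in> regular C U" "\<And>y. y \<in> U \<Longrightarrow> g y \<noteq> 0"
  shows "(\<lambda>y. f y / g y) \<in> regular C U"
  unfolding divide_inverse by (intro regular_mult regular_inverse assms)

text \<open>The open set on which \<open>f\<close> does not vanish would meet \<open>V\<close> by irreducibility.\<close>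

lemma regular_zero_on_dense:
  assumes "zopen U" "f \<in> regular C U" "zopen V" "V \<noteq> {}" "\<And>y. y \<in> V \<inter> U \<Longrightarrow> f y = 0" "x \<in> U"
  shows "f x = 0"
  using zopens_meet[OF assms(3) regular_nonvanishing_zopen[OF assms(1,2)]] assms by auto

lemma regular_eq_on_dense:
  assumes "zopen U" "f \<in> regular C U" "g \<in> regular C U" "zopen V" "V \<noteq> {}"
    "\<And>y. y \<in> V \<inter> U \<Longrightarrow> f y = g y" "x \<in> U"
  shows "f x = g x"
  using regular_zero_on_dense[OF assms(1) regular_diff[OF assms(1-3)] assms(4,5) _ assms(7)] assms(6)
  by simp


lemma regular_at_cong:
  assumes f: "regular_at C x f" and fg: "eventually (\<lambda>y. g y = f y) (near x)"
  shows "regular_at C x g"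
proof -
  obtain U where U: "zopen U" "x \<in> U" "f \<in> regular C U" using f unfolding regular_at_def by blast
  obtain V where V: "zopen V" "x \<in> V" "\<forall>y\<in>V. g y = f y"
    using fg zopen_subset_points[OF U(1,2)] by (auto simp: eventually_nhdsin)
  have UV: "zopen (U \<inter> V)" using U V by blast
  have "f \<in> regular C (U \<inter> V)" using regular_subset[OF U(3,1) UV] by blast
  then have "g \<in> regular C (U \<inter> V)" by (rule regular_cong[OF UV]) (use V in auto)
  then show ?thesis unfolding regular_at_def using UV U V by blast
qed

lemma regular_at_point: "regular_at C x f \<Longrightarrow> x \<in> points"
  unfolding regular_at_def using zopen_subset_points by blast

lemma regular_at_common:
  assumes "regular_at C x f" "regular_at C x g"
  obtains U where "zopen U" "x \<in> U" "f \<in> regular C U" "g \<in> regular C U"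
proof -
  obtain U V where U: "zopen U" "x \<in> U" "f \<in> regular C U" and V: "zopen V" "x \<in> V" "g \<in> regular C V"
    using assms unfolding regular_at_def by blast
  have UV: "zopen (U \<inter> V)" using U V by blast
  show thesis
    by (rule that[OF UV]) (use U V regular_subset[OF _ _ UV] in auto)
qed

lemma regular_atI: "zopen U \<Longrightarrow> x \<in> U \<Longrightarrow> f \<in> regular C U \<Longrightarrow> regular_at C x f"
  unfolding regular_at_def by blast

lemma regular_at_const: "x \<in> points \<Longrightarrow> regular_at C x (\<lambda>_. c)"
  by (rule regular_atI[OF openin_topspace]) (auto intro: regular_const)

lemma regular_at_add: "regular_at C x f \<Longrightarrow> regular_at C x g \<Longrightarrow> regular_at C x (\<lambda>y. f y + g y)"
  by (erule (1) regular_at_common) (blast intro: regular_atI regular_add)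

lemma regular_at_mult: "regular_at C x f \<Longrightarrow> regular_at C x g \<Longrightarrow> regular_at C x (\<lambda>y. f y * g y)"
  by (erule (1) regular_at_common) (blast intro: regular_atI regular_mult)

lemma regular_at_diff: "regular_at C x f \<Longrightarrow> regular_at C x g \<Longrightarrow> regular_at C x (\<lambda>y. f y - g y)"
  by (erule (1) regular_at_common) (blast intro: regular_atI regular_diff)

lemma regular_at_uminus: "regular_at C x f \<Longrightarrow> regular_at C x (\<lambda>y. - f y)"
  unfolding regular_at_def by (blast intro: regular_uminus)

lemma regular_at_power: "regular_at C x f \<Longrightarrow> regular_at C x (\<lambda>y. f y ^ m)"
  unfolding regular_at_def by (blast intro: regular_power)

lemma regular_at_sum:
  "x \<in> points \<Longrightarrow> (\<And>i. i \<in> I \<Longrightarrow> regular_at C x (f i)) \<Longrightarrow> regular_at C x (\<lambda>y. \<Sum>i\<in>I. f i y)"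
  by (induction I rule: infinite_finite_induct) (auto intro: regular_at_add regular_at_const)

lemmas regular_at_intros = regular_at_const regular_at_add regular_at_mult regular_at_diff
  regular_at_uminus regular_at_power regular_at_sum

lemma eventually_near:
  "x \<in> points \<Longrightarrow> eventually P (near x) \<longleftrightarrow> (\<exists>U. zopen U \<and> x \<in> U \<and> (\<forall>y\<in>U. P y))"
  by (auto simp: eventually_nhdsin)

lemma same_germ_iff: "x \<in> points \<Longrightarrow> same_germ C x f g \<longleftrightarrow> eventually (\<lambda>y. f y = g y) (near x)"
  by (simp add: eventually_near same_germ_def)

lemma near_at: "eventually P (near x) \<Longrightarrow> x \<in> points \<Longrightarrow> P x"
  by (auto simp: eventually_near)

lemma regular_at_nonzero_near:
  assumes "regular_at C x f" "f x \<noteq> 0"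
  shows "eventually (\<lambda>y. f y \<noteq> 0) (near x)"
proof -
  obtain U where U: "zopen U" "x \<in> U" "f \<in> regular C U" using assms unfolding regular_at_def by blast
  then show ?thesis
    unfolding eventually_near[OF regular_at_point[OF assms(1)]]
    using regular_nonvanishing_zopen[OF U(1,3)] assms(2)
    by (intro exI[of _ "{y\<in>U. f y \<noteq> 0}"]) auto
qed

lemma regular_at_inverse:
  assumes "regular_at C x f" "f x \<noteq> 0"
  shows "regular_at C x (\<lambda>y. inverse (f y))"
proof -
  obtain U where U: "zopen U" "x \<in> U" "f \<in> regular C U" using assms unfolding regular_at_def by blast
  let ?V = "{y\<in>U. f y \<noteq> 0}"
  have "zopen ?V" using regular_nonvanishing_zopen[OF U(1,3)] .
  then show ?thesis
    using U assms(2) by (intro regular_atI[of ?V] regular_inverse) (auto intro: regular_subset[OF U(3,1)])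
qed

lemma germ_domain:
  assumes f: "regular_at C x f" and g: "regular_at C x g"
    and 0: "eventually (\<lambda>y. f y * g y = 0) (near x)"
  shows "eventually (\<lambda>y. f y = 0) (near x) \<or> eventually (\<lambda>y. g y = 0) (near x)"
proof -
  have x: "x \<in> points" using f by (rule regular_at_point)
  obtain U where U: "zopen U" "x \<in> U" "f \<in> regular C U" "g \<in> regular C U"
    using regular_at_common[OF f g] .
  obtain V where V: "zopen V" "x \<in> V" "\<forall>y\<in>V. f y * g y = 0" using 0 x by (auto simp: eventually_near)
  show ?thesis
  proof (cases "\<forall>y\<in>U. f y = 0")
    case True then show ?thesis using U x by (auto simp: eventually_near)
  next
    case False
    let ?W = "{y\<in>U. f y \<noteq> 0}"
    have W: "zopen ?W" "?W \<noteq> {}" using regular_nonvanishing_zopen[OF U(1,3)] False by auto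
    have WV: "zopen (?W \<inter> V)" "?W \<inter> V \<noteq> {}" using W V zopens_meet[OF W(1) V(1)] by auto
    have "g y = 0" if "y \<in> U" for y
      by (rule regular_zero_on_dense[OF U(1,4) WV]) (use V that in auto)
    then show ?thesis using U x by (auto simp: eventually_near)
  qed
qed

end

section \<open>The local rings\<close>

context curve
begin

lemma mem_germ_iff: "x \<in> points \<Longrightarrow>
    g \<in> germ C x f \<longleftrightarrow> regular_at C x g \<and> eventually (\<lambda>y. f y = g y) (near x)"
  by (simp add: germ_def same_germ_iff)

lemma germ_cong:
  assumes "x \<in> points" "eventually (\<lambda>y. f y = g y) (near x)"
  shows "germ C x f = germ C x g"
proof -
  have "eventually (\<lambda>y. f y = h y) (near x) \<longleftrightarrow> eventually (\<lambda>y. g y = h y) (near x)" for h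
    using assms(2) by (auto elim: eventually_elim2)
  then show ?thesis by (auto simp: mem_germ_iff[OF assms(1)])
qed

lemma germ_eq_iff:
  assumes "regular_at C x g"
  shows "germ C x f = germ C x g \<longleftrightarrow> eventually (\<lambda>y. f y = g y) (near x)"
  using germ_cong mem_germ_iff[of x g g] mem_germ_iff[of x g f] assms regular_at_point[OF assms]
  by auto

lemma local_ring_carrier: "carrier (local_ring C x) = germ C x ` {f. regular_at C x f}"
  and local_ring_one: "\<one>\<^bsub>local_ring C x\<^esub> = germ C x (\<lambda>_. 1)"
  and local_ring_zero: "\<zero>\<^bsub>local_ring C x\<^esub> = germ C x (\<lambda>_. 0)"
  by (simp_all add: local_ring_def)

lemma germ_combine:
  assumes f: "regular_at C x f" and g: "regular_at C x g"
  shows "(\<Union>f'\<in>germ C x f. \<Union>g'\<in>germ C x g. germ C x (\<lambda>y. op (f' y) (g' y))) = germ C x (\<lambda>y. op (f y) (g y))"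
proof -
  have x: "x \<in> points" using f by (rule regular_at_point)
  have "germ C x (\<lambda>y. op (f' y) (g' y)) = germ C x (\<lambda>y. op (f y) (g y))"
    if "f' \<in> germ C x f" "g' \<in> germ C x g" for f' g'
  proof -
    have "eventually (\<lambda>y. f y = f' y) (near x)" "eventually (\<lambda>y. g y = g' y) (near x)"
      using that by (auto simp: mem_germ_iff[OF x])
    then have "eventually (\<lambda>y. op (f' y) (g' y) = op (f y) (g y)) (near x)"
      by eventually_elim simp
    then show ?thesis by (rule germ_cong[OF x])
  qed
  moreover have "f \<in> germ C x f" "g \<in> germ C x g" using f g x by (auto simp: mem_germ_iff)
  ultimately show ?thesis by blast
qed

lemma local_ring_mult:
  "regular_at C x f \<Longrightarrow> regular_at C x g \<Longrightarrow>
    germ C x f \<otimes>\<^bsub>local_ring C x\<^esub> germ C x g = germ C x (\<lambda>y. f y * g y)"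
  using germ_combine[of x f g "(*)"] by (simp add: local_ring_def)

lemma local_ring_add:
  "regular_at C x f \<Longrightarrow> regular_at C x g \<Longrightarrow>
    germ C x f \<oplus>\<^bsub>local_ring C x\<^esub> germ C x g = germ C x (\<lambda>y. f y + g y)"
  using germ_combine[of x f g "(+)"] by (simp add: local_ring_def)

lemma local_ring_dimension: "x \<in> points \<Longrightarrow> krull_dimension (local_ring C x) 1"
  using smooth by (simp add: smooth_curve_def)

lemma local_coordinate_exists: "x \<in> points \<Longrightarrow> \<exists>t. local_coordinate C x t"
  using smooth by (simp add: smooth_curve_def)

text \<open>The dimension hypothesis provides prime ideals, and a prime ideal is by definition one of a
  commutative ring.\<close>

lemma local_ring_cring:
  assumes "x \<in> points"
  shows "cring (local_ring C x)"
proof -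
  obtain Ps where "prime_chain (local_ring C x) Ps" "length Ps = 1 + 1"
    using local_ring_dimension[OF assms] unfolding krull_dimension_def by blast
  then have "primeideal (hd Ps) (local_ring C x)" unfolding prime_chain_def by (cases Ps) auto
  then show ?thesis by (simp add: primeideal_def)
qed

lemma primeideal_of_germs:
  assumes x: "x \<in> points"
    and cong: "\<And>f g. Q f \<Longrightarrow> eventually (\<lambda>y. f y = g y) (near x) \<Longrightarrow> Q g"
    and zero: "Q (\<lambda>_. 0)"
    and add: "\<And>f g. regular_at C x f \<Longrightarrow> regular_at C x g \<Longrightarrow> Q f \<Longrightarrow> Q g \<Longrightarrow> Q (\<lambda>y. f y + g y)"
    and mult: "\<And>f g. regular_at C x f \<Longrightarrow> regular_at C x g \<Longrightarrow> Q f \<Longrightarrow> Q (\<lambda>y. f y * g y)"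
    and one: "\<not> Q (\<lambda>_. 1)"
    and prime: "\<And>f g. regular_at C x f \<Longrightarrow> regular_at C x g \<Longrightarrow> Q (\<lambda>y. f y * g y) \<Longrightarrow> Q f \<or> Q g"
  shows "primeideal (germ C x ` {f. regular_at C x f \<and> Q f}) (local_ring C x)" (is "primeideal ?I ?R")
proof -
  interpret R: cring ?R using x by (rule local_ring_cring)
  have mem: "germ C x f \<in> ?I \<longleftrightarrow> Q f" if "regular_at C x f" for f
    using that cong germ_eq_iff[OF that] by (auto elim!: eventually_mono simp: eq_commute)
  have R: "germ C x f \<in> carrier ?R" if "regular_at C x f" for f using that by (simp add: local_ring_carrier)
  have neg: "\<ominus>\<^bsub>?R\<^esub> germ C x f = germ C x (\<lambda>y. (-1) * f y)" if "regular_at C x f" for f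
  proof (rule R.minus_equality)
    show "germ C x (\<lambda>y. - 1 * f y) \<oplus>\<^bsub>?R\<^esub> germ C x f = \<zero>\<^bsub>?R\<^esub>"
      using that x by (subst local_ring_add) (auto intro!: regular_at_intros simp: local_ring_zero)
  qed (use that x in \<open>auto intro!: R regular_at_mult regular_at_const regular_at_uminus simp del: mult_minus1\<close>)
  show ?thesis
  proof (rule primeidealI)
    show "ideal ?I ?R"
    proof (rule idealI[OF R.ring_axioms])
      show "subgroup ?I (add_monoid ?R)"
      proof (rule subgroup.intro)
        show "?I \<subseteq> carrier (add_monoid ?R)" by (auto simp: local_ring_carrier)
        show "a \<otimes>\<^bsub>add_monoid ?R\<^esub> b \<in> ?I" if "a \<in> ?I" "b \<in> ?I" for a b
          using that by (auto simp: local_ring_add mem intro: regular_at_add add)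
        show "\<one>\<^bsub>add_monoid ?R\<^esub> \<in> ?I"
          using zero x by (simp add: local_ring_zero mem regular_at_const)
        show "inv\<^bsub>add_monoid ?R\<^esub> a \<in> ?I" if "a \<in> ?I" for a
        proof -
          obtain f where f: "a = germ C x f" "regular_at C x f" "Q f" using \<open>a \<in> ?I\<close> by blast
          have "regular_at C x (\<lambda>y. (-1) * f y)" using f x by (intro regular_at_mult regular_at_const)
          moreover have "Q (\<lambda>y. f y * (-1))" using f x by (intro mult regular_at_const)
          moreover have "inv\<^bsub>add_monoid ?R\<^esub> a = germ C x (\<lambda>y. (-1) * f y)"
            using neg[OF f(2)] unfolding a_inv_def f(1) .
          ultimately show ?thesis by (simp only: mem mult.commute)
        qed
      qed
    next
      fix a b assume ab: "a \<in> ?I" "b \<in> carrier ?R"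
      then have "a \<otimes>\<^bsub>?R\<^esub> b \<in> ?I"
        by (auto simp: local_ring_carrier local_ring_mult mem intro: mult regular_at_mult)
      moreover have "a \<in> carrier ?R" using ab by (auto simp: local_ring_carrier)
      ultimately show "b \<otimes>\<^bsub>?R\<^esub> a \<in> ?I" "a \<otimes>\<^bsub>?R\<^esub> b \<in> ?I" using ab R.m_comm by auto
    qed
    show "cring ?R" by (rule R.is_cring)
    show "carrier ?R \<noteq> ?I" using one mem[OF regular_at_const[OF x, of 1]] R[OF regular_at_const[OF x, of 1]] by blast
    fix a b assume ab: "a \<in> carrier ?R" "b \<in> carrier ?R" "a \<otimes>\<^bsub>?R\<^esub> b \<in> ?I"
    then obtain f g where f: "a = germ C x f" "regular_at C x f" and g: "b = germ C x g" "regular_at C x g"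
      by (auto simp: local_ring_carrier)
    then have "Q (\<lambda>y. f y * g y)"
      using ab(3) mem[OF regular_at_mult[OF f(2) g(2)]] by (simp add: local_ring_mult)
    then have "Q f \<or> Q g" by (rule prime[OF f(2) g(2)])
    then show "a \<in> ?I \<or> b \<in> ?I" using mem f g by blast
  qed
qed

lemma local_coordinate_regular: "local_coordinate C x t \<Longrightarrow> regular_at C x t"
  by (simp add: local_coordinate_def)

lemma local_coordinate_zero:
  assumes "local_coordinate C x t"
  shows "t x = 0"
proof -
  have t: "regular_at C x t" "local_max_ideal C x = PIdl\<^bsub>local_ring C x\<^esub> (germ C x t)"
    using assms by (auto simp: local_coordinate_def)
  then have x: "x \<in> points" using regular_at_point by blast
  have "germ C x t = germ C x (\<lambda>_. 1) \<otimes>\<^bsub>local_ring C x\<^esub> germ C x t"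
    using t x by (simp add: local_ring_mult regular_at_const)
  then have "germ C x t \<in> local_max_ideal C x"
    unfolding t cgenideal_def using x by (auto simp: local_ring_carrier intro: regular_at_const)
  then obtain f where "germ C x t = germ C x f" "regular_at C x f" "f x = 0"
    by (auto simp: local_max_ideal_def)
  then have "eventually (\<lambda>y. t y = f y) (near x)" using germ_eq_iff by blast
  then have "t x = f x" by (rule near_at[OF _ x])
  then show ?thesis using \<open>f x = 0\<close> by simp
qed

lemma local_coordinate_divides:
  assumes "local_coordinate C x t" "regular_at C x f" "f x = 0"
  obtains g where "regular_at C x g" "eventually (\<lambda>y. f y = t y * g y) (near x)"
proof -
  have t: "regular_at C x t" "local_max_ideal C x = PIdl\<^bsub>local_ring C x\<^esub> (germ C x t)"
    using assms by (auto simp: local_coordinate_def)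
  have "germ C x f \<in> PIdl\<^bsub>local_ring C x\<^esub> (germ C x t)"
    using assms t by (auto simp: local_max_ideal_def)
  then obtain g where g: "regular_at C x g" "germ C x f = germ C x (\<lambda>y. g y * t y)"
    using t by (auto simp: cgenideal_def local_ring_carrier local_ring_mult)
  then have "eventually (\<lambda>y. f y = g y * t y) (near x)"
    using germ_eq_iff[of x "\<lambda>y. g y * t y" f] regular_at_mult[OF g(1) t(1)] by blast
  then show thesis using that[OF g(1)] by (simp add: mult.commute)
qed

text \<open>If \<open>t\<close> were zero, then all nonzero germs would be units, and the zero ideal would be the only
  prime ideal, contrary to the dimension being one.\<close>

lemma local_coordinate_nonzero:
  assumes t: "local_coordinate C x t"
  shows "\<not> eventually (\<lambda>y. t y = 0) (near x)"
proof
  assume 0: "eventually (\<lambda>y. t y = 0) (near x)"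
  let ?R = "local_ring C x"
  have x: "x \<in> points" using t local_coordinate_regular regular_at_point by blast
  interpret R: cring ?R using x by (rule local_ring_cring)
  have eq: "P = {germ C x (\<lambda>_. 0)}" if P: "primeideal P ?R" for P
  proof -
    interpret P: primeideal P ?R by fact
    have "a = germ C x (\<lambda>_. 0)" if a: "a \<in> P" for a
    proof -
      obtain f where f: "a = germ C x f" "regular_at C x f" using P.a_subset a by (auto simp: local_ring_carrier)
      have "f x = 0"
      proof (rule ccontr)
        assume fx: "f x \<noteq> 0"
        have inv: "regular_at C x (\<lambda>y. inverse (f y))" using f fx by (rule_tac regular_at_inverse)
        have "germ C x f \<otimes>\<^bsub>?R\<^esub> germ C x (\<lambda>y. inverse (f y)) \<in> P"
          using a f inv by (intro P.I_r_closed) (auto simp: local_ring_carrier)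
        also have "germ C x f \<otimes>\<^bsub>?R\<^esub> germ C x (\<lambda>y. inverse (f y)) = \<one>\<^bsub>?R\<^esub>"
          unfolding local_ring_mult[OF f(2) inv] local_ring_one
          by (rule germ_cong[OF x]) (use regular_at_nonzero_near[OF f(2) fx] in eventually_elim, simp)
        finally show False using P.one_imp_carrier P.I_notcarr by blast
      qed
      then obtain g where "regular_at C x g" "eventually (\<lambda>y. f y = t y * g y) (near x)"
        using local_coordinate_divides[OF t f(2)] by blast
      then have "eventually (\<lambda>y. f y = 0) (near x)" using 0 by (auto elim: eventually_elim2)
      then show ?thesis unfolding f(1) by (rule germ_cong[OF x])
    qed
    moreover have "germ C x (\<lambda>_. 0) \<in> P" using P.zero_closed by (simp add: local_ring_zero)
    ultimately show ?thesis by blast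
  qed
  obtain Ps where Ps: "prime_chain ?R Ps" "length Ps = 1 + 1"
    using local_ring_dimension[OF x] unfolding krull_dimension_def by blast
  then obtain P Q where "Ps = [P, Q]" by (auto simp: length_Suc_conv numeral_2_eq_2)
  then show False using Ps(1) eq by (auto simp: prime_chain_def)
qed

lemma local_coordinate_cancel:
  assumes t: "local_coordinate C x t" and f: "regular_at C x f"
    and 0: "eventually (\<lambda>y. t y ^ m * f y = 0) (near x)"
  shows "eventually (\<lambda>y. f y = 0) (near x)"
  using 0
proof (induction m)
  case (Suc m)
  note tr = local_coordinate_regular[OF t]
  have "eventually (\<lambda>y. t y * (t y ^ m * f y) = 0) (near x)"
    using Suc.prems by (simp only: power_Suc mult.assoc)
  then have "eventually (\<lambda>y. t y ^ m * f y = 0) (near x)"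
    using germ_domain[OF tr regular_at_mult[OF regular_at_power[OF tr] f], of m]
      local_coordinate_nonzero[OF t] by blast
  then show ?case by (rule Suc.IH)
qed simp

definition infinitely_divisible :: "'x \<Rightarrow> ('x \<Rightarrow> 'k) \<Rightarrow> ('x \<Rightarrow> 'k) \<Rightarrow> bool" where
  "infinitely_divisible x t f \<longleftrightarrow>
    (\<forall>m. \<exists>g. regular_at C x g \<and> eventually (\<lambda>y. f y = t y ^ m * g y) (near x))"

lemma uniformizer_factorization:
  assumes t: "local_coordinate C x t" and f: "regular_at C x f" "\<not> infinitely_divisible x t f"
  obtains m u where "regular_at C x u" "u x \<noteq> 0" "eventually (\<lambda>y. f y = t y ^ m * u y) (near x)"
proof -
  let ?P = "\<lambda>m. \<exists>g. regular_at C x g \<and> eventually (\<lambda>y. f y = t y ^ m * g y) (near x)"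
  have "?P 0" using f by auto
  obtain k where "\<not> ?P k" using f(2) unfolding infinitely_divisible_def by blast
  then obtain m where m: "?P m" "\<not> ?P (Suc m)" using \<open>?P 0\<close> by (induction k) auto
  then obtain u where u: "regular_at C x u" "eventually (\<lambda>y. f y = t y ^ m * u y) (near x)" by blast
  have "u x \<noteq> 0"
  proof
    assume "u x = 0"
    then obtain g where g: "regular_at C x g" "eventually (\<lambda>y. u y = t y * g y) (near x)"
      using local_coordinate_divides[OF t u(1)] by blast
    have "eventually (\<lambda>y. f y = t y ^ Suc m * g y) (near x)"
      using u(2) g(2) by eventually_elim (simp add: mult_ac)
    with g(1) m(2) show False by blast
  qed
  with u show thesis using that by blast
qed

lemma not_infinitely_divisible:
  assumes t: "local_coordinate C x t" and u: "regular_at C x u" "u x \<noteq> 0"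
    and f: "eventually (\<lambda>y. f y = t y ^ m * u y) (near x)"
  shows "\<not> infinitely_divisible x t f"
proof
  assume "infinitely_divisible x t f"
  then obtain g where g: "regular_at C x g" "eventually (\<lambda>y. f y = t y ^ Suc m * g y) (near x)"
    unfolding infinitely_divisible_def by blast
  have x: "x \<in> points" using u regular_at_point by blast
  have "eventually (\<lambda>y. t y ^ m * (u y - t y * g y) = 0) (near x)"
    using f g(2)
  proof eventually_elim
    case (elim y)
    then have "t y ^ m * u y = t y ^ Suc m * g y" by (rule trans[OF sym])
    then show ?case by (simp only: right_diff_distrib power_Suc mult_ac diff_self)
  qed
  then have "eventually (\<lambda>y. u y - t y * g y = 0) (near x)"
    by (rule local_coordinate_cancel[OF t, rotated])
      (intro regular_at_diff regular_at_mult u g local_coordinate_regular[OF t])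
  then have "u x - t x * g x = 0" using near_at x by blast
  then show False using u local_coordinate_zero[OF t] by simp
qed

text \<open>
  By \<open>uniformizer_factorization\<close> the germs that are not infinitely divisible are products of a power of
  \<open>t\<close> and a unit, so they are closed under multiplication, and the infinitely divisible germs form a
  prime ideal. It lies strictly below the maximal ideal, because it does not contain \<open>t\<close>, and a
  nonzero element would put it strictly above the zero ideal. That would be a chain of three prime
  ideals in a ring of dimension one.
\<close>

theorem infinitely_divisible_zero:
  assumes t: "local_coordinate C x t" and f: "regular_at C x f" and div: "infinitely_divisible x t f"
  shows "eventually (\<lambda>y. f y = 0) (near x)"
proof (rule ccontr)
  assume nz: "\<not> eventually (\<lambda>y. f y = 0) (near x)"
  have x: "x \<in> points" using f regular_at_point by blast
  have tr: "regular_at C x t" by (rule local_coordinate_regular[OF t])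
  let ?R = "local_ring C x"
  let ?I = "\<lambda>Q. germ C x ` {f. regular_at C x f \<and> Q f}"
  let ?Z = "\<lambda>f :: 'x \<Rightarrow> 'k. eventually (\<lambda>y. f y = 0) (near x)" and ?D = "infinitely_divisible x t"
    and ?M = "\<lambda>f :: 'x \<Rightarrow> 'k. f x = 0"
  have Z: "primeideal (?I ?Z) ?R"
  proof (rule primeideal_of_germs[OF x])
    show "\<not> ?Z (\<lambda>_. 1)" by (rule notI, drule near_at[OF _ x], simp)
    show "?Z f \<or> ?Z g" if "regular_at C x f" "regular_at C x g" "?Z (\<lambda>y. f y * g y)" for f g
      using germ_domain that by blast
  qed (auto elim: eventually_elim2 eventually_mono)
  have M: "primeideal (?I ?M) ?R"
    by (rule primeideal_of_germs[OF x]) (auto dest: near_at[OF _ x])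
  have D: "primeideal (?I ?D) ?R"
  proof (rule primeideal_of_germs[OF x])
    fix f g assume f: "?D f" and fg: "eventually (\<lambda>y. f y = g y) (near x)"
    show "?D g" unfolding infinitely_divisible_def
    proof
      fix m
      obtain h where h: "regular_at C x h" "eventually (\<lambda>y. f y = t y ^ m * h y) (near x)"
        using f unfolding infinitely_divisible_def by blast
      have "eventually (\<lambda>y. g y = t y ^ m * h y) (near x)" using h(2) fg by eventually_elim simp
      with h(1) show "\<exists>h. regular_at C x h \<and> eventually (\<lambda>y. g y = t y ^ m * h y) (near x)" by blast
    qed
  next
    show "?D (\<lambda>_. 0)" unfolding infinitely_divisible_def
      by (auto intro!: exI[of _ "\<lambda>_. 0"] regular_at_const x)
  next
    fix f g assume f: "?D f" and g: "?D g"
    show "?D (\<lambda>y. f y + g y)" unfolding infinitely_divisible_def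
    proof
      fix m
      obtain h k where h: "regular_at C x h" "eventually (\<lambda>y. f y = t y ^ m * h y) (near x)"
        and k: "regular_at C x k" "eventually (\<lambda>y. g y = t y ^ m * k y) (near x)"
        using f g unfolding infinitely_divisible_def by meson
      have "eventually (\<lambda>y. f y + g y = t y ^ m * (h y + k y)) (near x)"
        using h(2) k(2) by eventually_elim (simp add: algebra_simps)
      then show "\<exists>h. regular_at C x h \<and> eventually (\<lambda>y. f y + g y = t y ^ m * h y) (near x)"
        using regular_at_add[OF h(1) k(1)] by blast
    qed
  next
    fix f g assume g: "regular_at C x g" and f: "?D f"
    show "?D (\<lambda>y. f y * g y)" unfolding infinitely_divisible_def
    proof
      fix m
      obtain h where h: "regular_at C x h" "eventually (\<lambda>y. f y = t y ^ m * h y) (near x)"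
        using f unfolding infinitely_divisible_def by meson
      have "eventually (\<lambda>y. f y * g y = t y ^ m * (h y * g y)) (near x)"
        using h(2) by eventually_elim (simp add: algebra_simps)
      then show "\<exists>h. regular_at C x h \<and> eventually (\<lambda>y. f y * g y = t y ^ m * h y) (near x)"
        using regular_at_mult[OF h(1) g] by blast
    qed
  next
    show "\<not> ?D (\<lambda>_. 1)"
      by (rule not_infinitely_divisible[OF t regular_at_const[OF x, of 1], of _ 0]) auto
  next
    fix f g assume f: "regular_at C x f" and g: "regular_at C x g" and fg: "?D (\<lambda>y. f y * g y)"
    show "?D f \<or> ?D g"
    proof (rule ccontr)
      assume "\<not> (?D f \<or> ?D g)"
      then have nf: "\<not> ?D f" and ng: "\<not> ?D g" by auto
      obtain a u where u: "regular_at C x u" "u x \<noteq> 0" "eventually (\<lambda>y. f y = t y ^ a * u y) (near x)"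
        using uniformizer_factorization[OF t f nf] .
      obtain b v where v: "regular_at C x v" "v x \<noteq> 0" "eventually (\<lambda>y. g y = t y ^ b * v y) (near x)"
        using uniformizer_factorization[OF t g ng] .
      have "eventually (\<lambda>y. f y * g y = t y ^ (a + b) * (u y * v y)) (near x)"
        using u(3) v(3) by eventually_elim (simp add: power_add mult_ac)
      then have "\<not> ?D (\<lambda>y. f y * g y)"
        by (rule not_infinitely_divisible[OF t regular_at_mult[OF u(1) v(1)], rotated]) (use u v in simp)
      then show False using fg by simp
    qed
  qed
  have germ_zero_iff: "?Z h" if "germ C x f = germ C x h" "?Z f" "regular_at C x h" for f h
    using that germ_eq_iff[of x h f] by (auto elim: eventually_elim2)
  have DM: "f x = 0" if "regular_at C x f" "?D f" for f
    using that(2) not_infinitely_divisible[OF t that(1), of f 0] by auto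
  have "germ C x f \<in> ?I ?D" "germ C x f \<notin> ?I ?Z"
    using f div nz germ_eq_iff[OF f] by (auto dest!: germ_zero_iff[OF sym])
  moreover have "?I ?Z \<subseteq> ?I ?D"
  proof -
    have "?D f" if "?Z f" for f
      unfolding infinitely_divisible_def
      using that x by (auto intro!: exI[of _ "\<lambda>_. 0"] regular_at_const)
    then show ?thesis by blast
  qed
  moreover have "germ C x t \<in> ?I ?M" using tr local_coordinate_zero[OF t] by blast
  moreover have "germ C x t \<notin> ?I ?D"
  proof
    assume "germ C x t \<in> ?I ?D"
    then obtain g where g: "germ C x t = germ C x g" "regular_at C x g" "?D g" by blast
    then have "eventually (\<lambda>y. t y = g y) (near x)" using germ_eq_iff by blast
    then have "eventually (\<lambda>y. g y = t y ^ 1 * 1) (near x)" by eventually_elim simp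
    then have "\<not> ?D g" by (rule not_infinitely_divisible[OF t regular_at_const[OF x, of 1], rotated]) simp
    then show False using g by simp
  qed
  moreover have "?I ?D \<subseteq> ?I ?M" using DM by blast
  ultimately have "?I ?Z \<subset> ?I ?D" "?I ?D \<subset> ?I ?M" by blast+
  then have "prime_chain ?R [?I ?Z, ?I ?D, ?I ?M]"
    using Z D M unfolding prime_chain_def by auto
  then have "length [?I ?Z, ?I ?D, ?I ?M] \<le> 1 + 1"
    using local_ring_dimension[OF x] unfolding krull_dimension_def by blast
  then show False by simp
qed

end

section \<open>Taylor expansions\<close>

context curve
begin

lemma near_near: "eventually P (near x) \<Longrightarrow> eventually (\<lambda>y. eventually P (near y)) (near x)"
  unfolding eventually_nhdsin by blast

lemma regular_at_near: "regular_at C x f \<Longrightarrow> eventually (\<lambda>y. regular_at C y f) (near x)"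
  unfolding regular_at_def eventually_nhdsin by blast

lemma regular_iff_regular_at: "zopen U \<Longrightarrow> f \<in> regular C U \<longleftrightarrow> (\<forall>x\<in>U. regular_at C x f)"
proof
  assume U: "zopen U" and f: "\<forall>x\<in>U. regular_at C x f"
  show "f \<in> regular C U"
  proof (rule regular_local[OF U])
    fix x assume x: "x \<in> U"
    then obtain V where V: "zopen V" "x \<in> V" "f \<in> regular C V" using f unfolding regular_at_def by blast
    have UV: "zopen (U \<inter> V)" using U V by blast
    show "\<exists>V. zopen V \<and> x \<in> V \<and> V \<subseteq> U \<and> f \<in> regular C V"
      by (rule exI[of _ "U \<inter> V"]) (use x V UV regular_subset[OF V(3,1) UV] in auto)
  qed
qed (auto intro: regular_atI)

lemma regular_at_poly:
  assumes "regular_at C x t"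
  shows "regular_at C x (\<lambda>y. poly q (t y))"
proof (induction q)
  case 0 then show ?case using assms regular_at_point regular_at_const by simp
next
  case (pCons a q)
  have "regular_at C x (\<lambda>y. a + t y * poly q (t y))"
    using assms regular_at_point[OF assms] pCons by (intro regular_at_add regular_at_mult regular_at_const)
  then show ?case by simp
qed

lemma taylor_expansion_iff: "x \<in> points \<Longrightarrow> taylor_expansion C x t f F \<longleftrightarrow> regular_at C x f \<and>
    (\<forall>m. \<exists>g. regular_at C x g \<and>
      eventually (\<lambda>y. f y = (\<Sum>i<m. fps_nth F i * t y ^ i) + t y ^ m * g y) (near x))"
  by (simp add: taylor_expansion_def same_germ_iff)

lemma taylor_expansion_regular: "taylor_expansion C x t f F \<Longrightarrow> regular_at C x f"
  by (simp add: taylor_expansion_def)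

lemma taylor_expansionE:
  assumes "taylor_expansion C x t f F"
  obtains g where "regular_at C x g"
    "eventually (\<lambda>y. f y = (\<Sum>i<m. fps_nth F i * t y ^ i) + t y ^ m * g y) (near x)"
  using assms taylor_expansion_iff[OF regular_at_point[OF taylor_expansion_regular[OF assms]]] by blast

text \<open>Repeated division by \<open>t\<close>: the residue field is the ground field, so \<open>g - g(x)\<close> is divisible by \<open>t\<close>
  for every \<open>g\<close>, and the values of the successive quotients are the coefficients.\<close>

lemma taylor_expansion_exists:
  assumes t: "local_coordinate C x t" and f: "regular_at C x f"
  obtains F where "taylor_expansion C x t f F"
proof -
  have x: "x \<in> points" using f by (rule regular_at_point)
  have "\<exists>q. regular_at C x q \<and> eventually (\<lambda>y. g y = g x + t y * q y) (near x)" if g: "regular_at C x g" for g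
  proof -
    have "regular_at C x (\<lambda>y. g y - g x)" using g x by (intro regular_at_diff regular_at_const)
    then obtain q where q: "regular_at C x q" "eventually (\<lambda>y. g y - g x = t y * q y) (near x)"
      by (rule local_coordinate_divides[OF t]) auto
    from q(2) have "eventually (\<lambda>y. g y = g x + t y * q y) (near x)"
      by eventually_elim (simp add: algebra_simps)
    with q(1) show ?thesis by blast
  qed
  then obtain q where q: "\<And>g. regular_at C x g \<Longrightarrow> regular_at C x (q g)"
    "\<And>g. regular_at C x g \<Longrightarrow> eventually (\<lambda>y. g y = g x + t y * q g y) (near x)" by metis
  define F where "F = Abs_fps (\<lambda>i. (q ^^ i) f x)"
  have reg: "regular_at C x ((q ^^ i) f)" for i by (induction i) (auto simp: f q)
  have "eventually (\<lambda>y. f y = (\<Sum>i<m. fps_nth F i * t y ^ i) + t y ^ m * (q ^^ m) f y) (near x)" for m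
  proof (induction m)
    case (Suc m)
    with q(2)[OF reg[of m]] show ?case
      by eventually_elim (simp add: F_def algebra_simps)
  qed simp
  then have "taylor_expansion C x t f F" using reg f by (auto simp: taylor_expansion_iff[OF x])
  then show thesis by (rule that)
qed

lemma taylor_expansion_cong:
  assumes F: "taylor_expansion C x t f F" and fg: "eventually (\<lambda>y. g y = f y) (near x)"
  shows "taylor_expansion C x t g F"
proof -
  have f: "regular_at C x f" using F by (rule taylor_expansion_regular)
  have x: "x \<in> points" using f by (rule regular_at_point)
  have "\<exists>h. regular_at C x h \<and>
      eventually (\<lambda>y. g y = (\<Sum>i<m. fps_nth F i * t y ^ i) + t y ^ m * h y) (near x)" for m
  proof -
    obtain h where h: "regular_at C x h"
      "eventually (\<lambda>y. f y = (\<Sum>i<m. fps_nth F i * t y ^ i) + t y ^ m * h y) (near x)"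
      using taylor_expansionE[OF F] .
    from fg h(2) have "eventually (\<lambda>y. g y = (\<Sum>i<m. fps_nth F i * t y ^ i) + t y ^ m * h y) (near x)"
      by eventually_elim simp
    with h(1) show ?thesis by blast
  qed
  then show ?thesis using regular_at_cong[OF f fg] by (simp add: taylor_expansion_iff[OF x])
qed

lemma taylor_expansion_unique:
  assumes t: "local_coordinate C x t" and F: "taylor_expansion C x t f F" and G: "taylor_expansion C x t f G"
  shows "F = G"
proof (rule fps_ext)
  fix n
  have x: "x \<in> points" using taylor_expansion_regular[OF F] by (rule regular_at_point)
  show "fps_nth F n = fps_nth G n"
  proof (induction n rule: less_induct)
    case (less n)
    obtain g where g: "regular_at C x g"
      "eventually (\<lambda>y. f y = (\<Sum>i<Suc n. fps_nth F i * t y ^ i) + t y ^ Suc n * g y) (near x)"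
      using taylor_expansionE[OF F] .
    obtain h where h: "regular_at C x h"
      "eventually (\<lambda>y. f y = (\<Sum>i<Suc n. fps_nth G i * t y ^ i) + t y ^ Suc n * h y) (near x)"
      using taylor_expansionE[OF G] .
    have eq: "(\<Sum>i<n. fps_nth F i * s ^ i) = (\<Sum>i<n. fps_nth G i * s ^ i)" for s
      using less by (intro sum.cong) auto
    let ?u = "\<lambda>y. (fps_nth F n - fps_nth G n) + t y * (g y - h y)"
    have "eventually (\<lambda>y. t y ^ n * ?u y = 0) (near x)"
      using g(2) h(2)
    proof eventually_elim
      case (elim y)
      then have "(\<Sum>i<Suc n. fps_nth F i * t y ^ i) + t y ^ Suc n * g y
        = (\<Sum>i<Suc n. fps_nth G i * t y ^ i) + t y ^ Suc n * h y" by simp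
      then have "fps_nth F n * t y ^ n + t y ^ Suc n * g y = fps_nth G n * t y ^ n + t y ^ Suc n * h y"
        by (simp add: eq)
      then show ?case by (simp add: algebra_simps del: mult_eq_0_iff)
    qed
    then have "eventually (\<lambda>y. ?u y = 0) (near x)"
      by (rule local_coordinate_cancel[OF t, rotated])
        (intro regular_at_add regular_at_mult regular_at_diff regular_at_const x g h local_coordinate_regular[OF t])
    then have "?u x = 0" by (rule near_at[OF _ x])
    then show ?case using local_coordinate_zero[OF t] by simp
  qed
qed

lemma taylor_expansion_const:
  assumes x: "x \<in> points"
  shows "taylor_expansion C x t (\<lambda>_. c) (fps_const c)"
  unfolding taylor_expansion_iff[OF x]
proof (intro conjI allI regular_at_const x)
  fix m
  have "c = (\<Sum>i<m. fps_nth (fps_const c) i * s ^ i) + s ^ m * (if m = 0 then c else 0)" for s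
  proof (cases m)
    case (Suc k)
    then show ?thesis by (simp only: sum.lessThan_Suc_shift) simp
  qed simp
  then show "\<exists>g. regular_at C x g \<and>
      eventually (\<lambda>y. c = (\<Sum>i<m. fps_nth (fps_const c) i * t y ^ i) + t y ^ m * g y) (near x)"
    by (intro exI[of _ "\<lambda>_. if m = 0 then c else 0"] conjI regular_at_const x) auto
qed

lemma taylor_expansion_add:
  assumes F: "taylor_expansion C x t f F" and G: "taylor_expansion C x t g G"
  shows "taylor_expansion C x t (\<lambda>y. f y + g y) (F + G)"
proof -
  have reg: "regular_at C x f" "regular_at C x g" using F G taylor_expansion_regular by auto
  have x: "x \<in> points" using reg regular_at_point by auto
  show ?thesis
    unfolding taylor_expansion_iff[OF x]
  proof (intro conjI allI regular_at_add reg)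
    fix m
    obtain g' where g: "regular_at C x g'"
      "eventually (\<lambda>y. f y = (\<Sum>i<m. fps_nth F i * t y ^ i) + t y ^ m * g' y) (near x)"
      using taylor_expansionE[OF F] .
    obtain h where h: "regular_at C x h"
      "eventually (\<lambda>y. g y = (\<Sum>i<m. fps_nth G i * t y ^ i) + t y ^ m * h y) (near x)"
      using taylor_expansionE[OF G] .
    have "eventually (\<lambda>y. f y + g y = (\<Sum>i<m. fps_nth (F + G) i * t y ^ i) + t y ^ m * (g' y + h y)) (near x)"
      using g(2) h(2) by eventually_elim (simp add: algebra_simps sum.distrib)
    then show "\<exists>k. regular_at C x k \<and>
      eventually (\<lambda>y. f y + g y = (\<Sum>i<m. fps_nth (F + G) i * t y ^ i) + t y ^ m * k y) (near x)"
      using regular_at_add[OF g(1) h(1)] by blast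
  qed
qed

text \<open>The remainder is a polynomial in \<open>s\<close>, so that it becomes a regular function when the coordinate is
  substituted for \<open>s\<close>.\<close>

lemma truncated_fps_mult:
  fixes F G :: "'a::idom fps"
  obtains R :: "'a poly" where "\<And>s. (\<Sum>i<m. fps_nth F i * s ^ i) * (\<Sum>i<m. fps_nth G i * s ^ i) =
    (\<Sum>i<m. fps_nth (F * G) i * s ^ i) + s ^ m * poly R s"
proof -
  define T where "T H = (\<Sum>i<m. monom (fps_nth H i) i)" for H :: "'a fps"
  have T: "poly (T H) s = (\<Sum>i<m. fps_nth H i * s ^ i)" for H s
    by (simp add: T_def poly_sum poly_monom)
  have coeff: "coeff (T H) k = fps_nth H k" if "k < m" for H k
    using that by (simp add: T_def coeff_sum)
  have "monom 1 m dvd T F * T G - T (F * G)"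
    unfolding monom_1_dvd_iff'
  proof (intro allI impI)
    fix k assume k: "k < m"
    have "coeff (T F * T G) k = (\<Sum>i\<le>k. fps_nth F i * fps_nth G (k - i))"
      unfolding coeff_mult using k by (intro sum.cong) (auto simp: coeff)
    then show "coeff (T F * T G - T (F * G)) k = 0"
      using k by (simp add: coeff fps_mult_nth atLeast0AtMost)
  qed
  then obtain R where "T F * T G - T (F * G) = monom 1 m * R" by (elim dvdE)
  then have "T F * T G = T (F * G) + monom 1 m * R" by (simp add: algebra_simps)
  then have "poly (T F * T G) s = poly (T (F * G) + monom 1 m * R) s" for s by simp
  then show thesis using that[of R] by (simp add: T poly_monom)
qed

lemma taylor_expansion_mult:
  assumes t: "regular_at C x t"
    and F: "taylor_expansion C x t f F" and G: "taylor_expansion C x t g G"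
  shows "taylor_expansion C x t (\<lambda>y. f y * g y) (F * G)"
proof -
  have reg: "regular_at C x f" "regular_at C x g" using F G taylor_expansion_regular by auto
  have x: "x \<in> points" using reg regular_at_point by auto
  show ?thesis
    unfolding taylor_expansion_iff[OF x]
  proof (intro conjI allI regular_at_mult reg)
    fix m
    let ?S = "\<lambda>H s. (\<Sum>i<m. fps_nth H i * s ^ i)"
    obtain h where h: "regular_at C x h" "eventually (\<lambda>y. f y = ?S F (t y) + t y ^ m * h y) (near x)"
      using taylor_expansionE[OF F] .
    obtain k where k: "regular_at C x k" "eventually (\<lambda>y. g y = ?S G (t y) + t y ^ m * k y) (near x)"
      using taylor_expansionE[OF G] .
    obtain R where R: "\<And>s. ?S F s * ?S G s = ?S (F * G) s + s ^ m * poly R s"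
      using truncated_fps_mult[where m = m and F = F and G = G] by blast
    let ?r = "\<lambda>y. poly R (t y) + (h y * g y + ?S F (t y) * k y)"
    have "eventually (\<lambda>y. f y * g y = ?S (F * G) (t y) + t y ^ m * ?r y) (near x)"
      using h(2) k(2)
    proof eventually_elim
      case (elim y)
      have "f y * g y = ?S F (t y) * g y + t y ^ m * h y * g y"
        unfolding elim(1) by (rule distrib_right)
      also have "?S F (t y) * g y = ?S F (t y) * ?S G (t y) + t y ^ m * (?S F (t y) * k y)"
        unfolding elim(2) by (simp only: distrib_left mult_ac)
      finally show ?case unfolding R by (simp only: distrib_left mult_ac add_ac)
    qed
    moreover have "regular_at C x ?r"
      by (intro regular_at_add regular_at_mult regular_at_sum regular_at_power regular_at_const
          regular_at_poly t h k reg x)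
    ultimately show "\<exists>k. regular_at C x k \<and>
      eventually (\<lambda>y. f y * g y = ?S (F * G) (t y) + t y ^ m * k y) (near x)" by blast
  qed
qed

lemma taylor_expansion_sum:
  assumes "x \<in> points" "\<And>i. i \<in> I \<Longrightarrow> taylor_expansion C x t (f i) (F i)"
  shows "taylor_expansion C x t (\<lambda>y. \<Sum>i\<in>I. f i y) (\<Sum>i\<in>I. F i)"
  using assms(2)
proof (induction I rule: infinite_finite_induct)
  case (insert i I)
  then show ?case by (simp add: taylor_expansion_add)
qed (use taylor_expansion_const[OF assms(1), of t 0] in auto)

lemma taylor_expansion_coordinate:
  assumes t: "regular_at C x t"
  shows "taylor_expansion C x t t fps_X"
proof -
  have x: "x \<in> points" using t by (rule regular_at_point)
  have "\<exists>g. regular_at C x g \<and>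
      eventually (\<lambda>y. t y = (\<Sum>i<m. fps_nth fps_X i * t y ^ i) + t y ^ m * g y) (near x)" for m
  proof -
    consider "m = 0" | "m = 1" | k where "m = Suc (Suc k)" by (cases m; cases "m - 1") auto
    then show ?thesis
    proof cases
      case 1 then show ?thesis using t by (intro exI[of _ t]) auto
    next
      case 2 then show ?thesis by (intro exI[of _ "\<lambda>_. 1"]) (auto simp: x regular_at_const)
    next
      case 3
      have "(\<Sum>i<m. fps_nth fps_X i * s ^ i) = s" for s :: 'k
        unfolding 3 by (simp only: sum.lessThan_Suc_shift) simp
      then show ?thesis by (intro exI[of _ "\<lambda>_. 0"]) (auto simp: x regular_at_const)
    qed
  qed
  then show ?thesis using t by (simp add: taylor_expansion_iff[OF x])
qed

lemma taylor_expansion_zero_germ: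
  assumes t: "local_coordinate C x t" and F: "taylor_expansion C x t f 0"
  shows "eventually (\<lambda>y. f y = 0) (near x)"
proof (rule infinitely_divisible_zero[OF t taylor_expansion_regular[OF F]])
  show "infinitely_divisible x t f"
    unfolding infinitely_divisible_def
  proof
    fix m
    obtain g where "regular_at C x g"
      "eventually (\<lambda>y. f y = (\<Sum>i<m. fps_nth 0 i * t y ^ i) + t y ^ m * g y) (near x)"
      using taylor_expansionE[OF F] .
    then show "\<exists>g. regular_at C x g \<and> eventually (\<lambda>y. f y = t y ^ m * g y) (near x)" by auto
  qed
qed

end

section \<open>Differentials near a point\<close>

context curve
begin

lemma tangent_vector_add:
  "tangent_vector C x \<delta> \<Longrightarrow> regular_at C x f \<Longrightarrow> regular_at C x g \<Longrightarrow>
    \<delta> (\<lambda>y. f y + g y) = \<delta> f + \<delta> g"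
  and tangent_vector_mult:
  "tangent_vector C x \<delta> \<Longrightarrow> regular_at C x f \<Longrightarrow> regular_at C x g \<Longrightarrow>
    \<delta> (\<lambda>y. f y * g y) = f x * \<delta> g + g x * \<delta> f"
  and tangent_vector_const: "tangent_vector C x \<delta> \<Longrightarrow> \<delta> (\<lambda>_. c) = 0"
  by (simp_all add: tangent_vector_def)

lemma tangent_vector_cong:
  assumes \<delta>: "tangent_vector C x \<delta>" and f: "regular_at C x f" and fg: "eventually (\<lambda>y. g y = f y) (near x)"
  shows "\<delta> g = \<delta> f"
proof -
  have "regular_at C x g" using regular_at_cong[OF f fg] .
  moreover have "same_germ C x g f" using fg by (simp add: same_germ_iff regular_at_point[OF f])
  ultimately show ?thesis using \<delta> f by (simp add: tangent_vector_def)
qed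

lemma tangent_vector_power:
  assumes \<delta>: "tangent_vector C x \<delta>" and f: "regular_at C x f"
  shows "\<delta> (\<lambda>y. f y ^ m) = of_nat m * f x ^ (m - 1) * \<delta> f"
proof (induction m)
  case 0
  then show ?case using tangent_vector_const[OF \<delta>, of 1] by simp
next
  case (Suc m)
  have "\<delta> (\<lambda>y. f y ^ Suc m) = f x * \<delta> (\<lambda>y. f y ^ m) + f x ^ m * \<delta> f"
    using tangent_vector_mult[OF \<delta> f regular_at_power[OF f]] by simp
  then show ?case unfolding Suc by (cases m) (simp_all add: algebra_simps)
qed

lemma tangent_vector_sum:
  assumes \<delta>: "tangent_vector C x \<delta>" and x: "x \<in> points" and f: "\<And>i. i \<in> I \<Longrightarrow> regular_at C x (f i)"
  shows "\<delta> (\<lambda>y. \<Sum>i\<in>I. f i y) = (\<Sum>i\<in>I. \<delta> (f i))"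
  using f
  by (induction I rule: infinite_finite_induct)
    (simp_all add: tangent_vector_const[OF \<delta>] tangent_vector_add[OF \<delta>] regular_at_sum[OF x])

text \<open>
  Near \<open>x\<close>, the differential of \<open>h\<close> is a combination of the differentials of the elements of \<open>J\<close> with
  regular coefficients. Differentials are tested on all tangent vectors at all points near \<open>x\<close>.
\<close>

definition spanned_by :: "'x \<Rightarrow> ('x \<Rightarrow> 'k) set \<Rightarrow> ('x \<Rightarrow> 'k) \<Rightarrow> bool" where
  "spanned_by x J h \<longleftrightarrow> (\<exists>c. (\<forall>j\<in>J. regular_at C x (c j)) \<and>
    eventually (\<lambda>y. \<forall>\<delta>. tangent_vector C y \<delta> \<longrightarrow> \<delta> h = (\<Sum>j\<in>J. c j y * \<delta> j)) (near x))"

lemma spanned_byI: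
  assumes "\<And>j. j \<in> J \<Longrightarrow> regular_at C x (c j)"
    and "eventually (\<lambda>y. \<forall>\<delta>. tangent_vector C y \<delta> \<longrightarrow> \<delta> h = (\<Sum>j\<in>J. c j y * \<delta> j)) (near x)"
  shows "spanned_by x J h"
  using assms unfolding spanned_by_def by blast

lemma spanned_byE:
  assumes "spanned_by x J h"
  obtains c where "\<And>j. j \<in> J \<Longrightarrow> regular_at C x (c j)"
    "eventually (\<lambda>y. \<forall>\<delta>. tangent_vector C y \<delta> \<longrightarrow> \<delta> h = (\<Sum>j\<in>J. c j y * \<delta> j)) (near x)"
  using assms unfolding spanned_by_def by blast

lemma spanned_by_cong:
  assumes "spanned_by x J f" "regular_at C x f" "eventually (\<lambda>y. g y = f y) (near x)"
  shows "spanned_by x J g"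
proof -
  obtain c where c: "\<And>j. j \<in> J \<Longrightarrow> regular_at C x (c j)"
    "eventually (\<lambda>y. \<forall>\<delta>. tangent_vector C y \<delta> \<longrightarrow> \<delta> f = (\<Sum>j\<in>J. c j y * \<delta> j)) (near x)"
    using assms(1)[unfolded spanned_by_def] by blast
  show ?thesis
  proof (rule spanned_byI[OF c(1)])
    show "eventually (\<lambda>y. \<forall>\<delta>. tangent_vector C y \<delta> \<longrightarrow> \<delta> g = (\<Sum>j\<in>J. c j y * \<delta> j)) (near x)"
      using c(2) near_near[OF assms(3)] regular_at_near[OF assms(2)]
    proof eventually_elim
      case (elim y)
      then show ?case using tangent_vector_cong[OF _ elim(3,2)] by simp
    qed
  qed
qed

lemma spanned_by_const: "x \<in> points \<Longrightarrow> spanned_by x J (\<lambda>_. a)"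
  by (rule spanned_byI[where c = "\<lambda>_ _. 0"]) (auto simp: regular_at_const tangent_vector_const)

lemma spanned_by_member:
  assumes "x \<in> points" "finite J" "g \<in> J"
  shows "spanned_by x J g"
proof (rule spanned_byI[where c = "\<lambda>j _. if j = g then 1 else 0"])
  have "(\<Sum>j\<in>J. (if j = g then 1 else 0) * \<delta> j) = \<delta> g" for \<delta> :: "('x \<Rightarrow> 'k) \<Rightarrow> 'k"
    using assms by (simp add: if_distrib[of "\<lambda>u. u * _"] cong: if_cong)
  then show "eventually (\<lambda>y. \<forall>\<delta>. tangent_vector C y \<delta> \<longrightarrow>
      \<delta> g = (\<Sum>j\<in>J. (if j = g then 1 else 0) * \<delta> j)) (near x)" by simp
qed (use assms in \<open>auto simp: regular_at_const\<close>)

lemma spanned_by_add: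
  assumes reg: "regular_at C x f" "regular_at C x g" and sp: "spanned_by x J f" "spanned_by x J g"
  shows "spanned_by x J (\<lambda>y. f y + g y)"
proof -
  obtain c where c: "\<And>j. j \<in> J \<Longrightarrow> regular_at C x (c j)"
    "eventually (\<lambda>y. \<forall>\<delta>. tangent_vector C y \<delta> \<longrightarrow> \<delta> f = (\<Sum>j\<in>J. c j y * \<delta> j)) (near x)"
    using sp(1)[unfolded spanned_by_def] by blast
  obtain d where d: "\<And>j. j \<in> J \<Longrightarrow> regular_at C x (d j)"
    "eventually (\<lambda>y. \<forall>\<delta>. tangent_vector C y \<delta> \<longrightarrow> \<delta> g = (\<Sum>j\<in>J. d j y * \<delta> j)) (near x)"
    using sp(2)[unfolded spanned_by_def] by blast
  show ?thesis
  proof (rule spanned_byI[where c = "\<lambda>j y. c j y + d j y"])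
    show "eventually (\<lambda>y. \<forall>\<delta>. tangent_vector C y \<delta> \<longrightarrow>
        \<delta> (\<lambda>y. f y + g y) = (\<Sum>j\<in>J. (c j y + d j y) * \<delta> j)) (near x)"
      using c(2) d(2) regular_at_near[OF reg(1)] regular_at_near[OF reg(2)]
    proof eventually_elim
      case (elim y)
      show ?case
      proof (intro allI impI)
        fix \<delta> assume \<delta>: "tangent_vector C y \<delta>"
        show "\<delta> (\<lambda>y. f y + g y) = (\<Sum>j\<in>J. (c j y + d j y) * \<delta> j)"
          using elim(1)[rule_format, OF \<delta>] elim(2)[rule_format, OF \<delta>] tangent_vector_add[OF \<delta> elim(3,4)]
          by (simp add: sum.distrib distrib_right)
      qed
    qed
  qed (intro regular_at_add c d)
qed

lemma spanned_by_mult: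
  assumes reg: "regular_at C x f" "regular_at C x g" and sp: "spanned_by x J f" "spanned_by x J g"
  shows "spanned_by x J (\<lambda>y. f y * g y)"
proof -
  obtain c where c: "\<And>j. j \<in> J \<Longrightarrow> regular_at C x (c j)"
    "eventually (\<lambda>y. \<forall>\<delta>. tangent_vector C y \<delta> \<longrightarrow> \<delta> f = (\<Sum>j\<in>J. c j y * \<delta> j)) (near x)"
    using sp(1)[unfolded spanned_by_def] by blast
  obtain d where d: "\<And>j. j \<in> J \<Longrightarrow> regular_at C x (d j)"
    "eventually (\<lambda>y. \<forall>\<delta>. tangent_vector C y \<delta> \<longrightarrow> \<delta> g = (\<Sum>j\<in>J. d j y * \<delta> j)) (near x)"
    using sp(2)[unfolded spanned_by_def] by blast
  show ?thesis
  proof (rule spanned_byI[where c = "\<lambda>j y. f y * d j y + g y * c j y"])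
    show "eventually (\<lambda>y. \<forall>\<delta>. tangent_vector C y \<delta> \<longrightarrow>
        \<delta> (\<lambda>y. f y * g y) = (\<Sum>j\<in>J. (f y * d j y + g y * c j y) * \<delta> j)) (near x)"
      using c(2) d(2) regular_at_near[OF reg(1)] regular_at_near[OF reg(2)]
    proof eventually_elim
      case (elim y)
      show ?case
      proof (intro allI impI)
        fix \<delta> assume \<delta>: "tangent_vector C y \<delta>"
        show "\<delta> (\<lambda>y. f y * g y) = (\<Sum>j\<in>J. (f y * d j y + g y * c j y) * \<delta> j)"
          using elim(1)[rule_format, OF \<delta>] elim(2)[rule_format, OF \<delta>] tangent_vector_mult[OF \<delta> elim(3,4)]
          by (simp add: sum.distrib distrib_right sum_distrib_left mult.assoc)
      qed
    qed
  qed (intro regular_at_add regular_at_mult reg c d)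
qed

lemma spanned_by_inverse:
  assumes f: "regular_at C x f" "f x \<noteq> 0" and sp: "spanned_by x J f"
  shows "spanned_by x J (\<lambda>y. inverse (f y))"
proof -
  let ?g = "\<lambda>y. inverse (f y)"
  have g: "regular_at C x ?g" using f by (rule regular_at_inverse)
  obtain c where c: "\<And>j. j \<in> J \<Longrightarrow> regular_at C x (c j)"
    "eventually (\<lambda>y. \<forall>\<delta>. tangent_vector C y \<delta> \<longrightarrow> \<delta> f = (\<Sum>j\<in>J. c j y * \<delta> j)) (near x)"
    using sp[unfolded spanned_by_def] by blast
  show ?thesis
  proof (rule spanned_byI[where c = "\<lambda>j y. - (?g y * ?g y * c j y)"])
    show "eventually (\<lambda>y. \<forall>\<delta>. tangent_vector C y \<delta> \<longrightarrow>
        \<delta> ?g = (\<Sum>j\<in>J. - (?g y * ?g y * c j y) * \<delta> j)) (near x)"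
      using c(2) regular_at_near[OF f(1)] regular_at_near[OF g]
        near_near[OF regular_at_nonzero_near[OF f]] regular_at_nonzero_near[OF f]
    proof eventually_elim
      case (elim y)
      show ?case
      proof (intro allI impI)
        fix \<delta> assume \<delta>: "tangent_vector C y \<delta>"
        have y: "y \<in> points" using elim(2) regular_at_point by blast
        have "eventually (\<lambda>z. f z * ?g z = 1) (near y)" using elim(4) by eventually_elim simp
        then have "\<delta> (\<lambda>z. f z * ?g z) = \<delta> (\<lambda>_. 1)"
          by (rule tangent_vector_cong[OF \<delta> regular_at_const[OF y]])
        then have "f y * \<delta> ?g + ?g y * \<delta> f = 0"
          using tangent_vector_mult[OF \<delta> elim(2,3)] tangent_vector_const[OF \<delta>] by simp
        then have "\<delta> ?g = - (?g y * ?g y) * \<delta> f"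
          using elim(5) by (simp add: field_simps eq_neg_iff_add_eq_0)
        then show "\<delta> ?g = (\<Sum>j\<in>J. - (?g y * ?g y * c j y) * \<delta> j)"
          unfolding elim(1)[rule_format, OF \<delta>] by (simp add: sum_distrib_left sum_negf mult.assoc)
      qed
    qed
  qed (intro regular_at_uminus regular_at_mult g c)
qed

lemma affine_open_finitely_generated:
  assumes "affine_open C A"
  obtains G where "finite G" "G \<subseteq> regular C A"
    "\<And>f. f \<in> regular C A \<Longrightarrow> \<exists>g\<in>generated_algebra G. \<forall>y\<in>A. f y = g y"
proof -
  have "\<exists>G. finite G \<and> G \<subseteq> regular C A \<and>
      (\<forall>f\<in>regular C A. \<exists>g\<in>generated_algebra G. \<forall>y\<in>A. f y = g y)"
    using assms unfolding affine_open_def by (elim conjE)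
  then show thesis using that by auto
qed

text \<open>The functions with this property form an algebra closed under inverses, and the regular functions
  near \<open>x\<close> are fractions of polynomials in the generators.\<close>

lemma spanned_by_generators:
  assumes A: "affine_open C A" "x \<in> A" and G: "finite G" "G \<subseteq> regular C A"
    and gen: "\<And>f. f \<in> regular C A \<Longrightarrow> \<exists>g\<in>generated_algebra G. \<forall>y\<in>A. f y = g y"
    and h: "regular_at C x h"
  shows "spanned_by x G h"
proof -
  have zA: "zopen A" using A affine_open_zopen by blast
  have x: "x \<in> points" using zopen_subset_points[OF zA A(2)] .
  have alg: "regular_at C x g \<and> spanned_by x G g" if "g \<in> generated_algebra G" for g
    using that
  proof induction
    case (const c)
    show ?case by (simp add: regular_at_const x spanned_by_const)
  next
    case (gen g)
    then have "regular_at C x g" using G(2) zA A(2) by (blast intro: regular_atI)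
    then show ?case using gen G(1) x by (simp add: spanned_by_member)
  qed (auto intro: regular_at_add regular_at_mult spanned_by_add spanned_by_mult)
  have affine: "spanned_by x G f" if f: "f \<in> regular C A" for f
  proof -
    obtain g where g: "g \<in> generated_algebra G" "\<forall>y\<in>A. f y = g y" using gen[OF f] by blast
    have "eventually (\<lambda>y. f y = g y) (near x)" using g(2) zA A(2) x by (auto simp: eventually_near)
    then show ?thesis using alg[OF g(1)] spanned_by_cong by blast
  qed
  obtain U where U: "zopen U" "x \<in> U" "h \<in> regular C U" using h unfolding regular_at_def by blast
  obtain g d where gd: "g \<in> regular C A" "d \<in> regular C A" "d x \<noteq> 0" "{y\<in>A. d y \<noteq> 0} \<subseteq> U"
    "\<And>y. y \<in> A \<Longrightarrow> d y \<noteq> 0 \<Longrightarrow> h y = g y / d y"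
    using regular_fraction[OF U(1,3) A(1) U(2) A(2)] by blast
  have reg: "regular_at C x g" "regular_at C x d" using gd zA A(2) by (auto intro: regular_atI)
  have "spanned_by x G (\<lambda>y. g y * inverse (d y))"
    by (intro spanned_by_mult spanned_by_inverse affine gd reg regular_at_inverse)
  moreover have "eventually (\<lambda>y. h y = g y * inverse (d y)) (near x)"
    unfolding eventually_near[OF x]
    using affine_open_nonvanishing[OF A(1) gd(2)] gd A(2)
    by (intro exI[of _ "{y\<in>A. d y \<noteq> 0}"]) (auto simp: divide_inverse)
  ultimately show ?thesis
    using spanned_by_cong regular_at_mult[OF reg(1) regular_at_inverse[OF reg(2) gd(3)]] by blast
qed

text \<open>
  Nakayama's lemma for the differentials, removing one generator at a time: \<open>i - i(x) = t u\<close> gives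
  \<open>di = u dt + t du\<close>, and in \<open>t du\<close> the differential \<open>di\<close> occurs with a coefficient \<open>t c\<close> that vanishes at
  \<open>x\<close>. Thus \<open>1 - t c\<close> is invertible, and \<open>di\<close> is a combination of the others.
\<close>

lemma spanned_by_eliminate:
  assumes t: "local_coordinate C x t" and J: "finite J" "t \<in> J"
    and i: "regular_at C x i" "i \<notin> J"
    and all: "\<And>h. regular_at C x h \<Longrightarrow> spanned_by x (insert i J) h"
    and h: "regular_at C x h"
  shows "spanned_by x J h"
proof -
  have x: "x \<in> points" using i(1) by (rule regular_at_point)
  have tr: "regular_at C x t" using t by (rule local_coordinate_regular)
  have "regular_at C x (\<lambda>y. i y - i x)" using i x by (intro regular_at_diff regular_at_const)
  then obtain u where u: "regular_at C x u" "eventually (\<lambda>y. i y - i x = t y * u y) (near x)"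
    by (rule local_coordinate_divides[OF t]) auto
  obtain c where c: "\<And>j. j \<in> insert i J \<Longrightarrow> regular_at C x (c j)"
    "eventually (\<lambda>y. \<forall>\<delta>. tangent_vector C y \<delta> \<longrightarrow> \<delta> u = (\<Sum>j\<in>insert i J. c j y * \<delta> j)) (near x)"
    using spanned_byE[OF all[OF u(1)]] by blast
  obtain d where d: "\<And>j. j \<in> insert i J \<Longrightarrow> regular_at C x (d j)"
    "eventually (\<lambda>y. \<forall>\<delta>. tangent_vector C y \<delta> \<longrightarrow> \<delta> h = (\<Sum>j\<in>insert i J. d j y * \<delta> j)) (near x)"
    using spanned_byE[OF all[OF h]] by blast
  let ?w = "\<lambda>y. 1 - t y * c i y"
  have w: "regular_at C x ?w" using x tr c by (intro regular_at_diff regular_at_mult regular_at_const) auto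
  have wx: "?w x \<noteq> 0" using local_coordinate_zero[OF t] by simp
  let ?e = "\<lambda>j y. (if j = t then u y else 0) + t y * c j y"
  have e: "regular_at C x (?e j)" if "j \<in> J" for j
    using that u tr c x by (cases "j = t") (auto intro!: regular_at_add regular_at_mult regular_at_const)
  show ?thesis
  proof (rule spanned_byI[where c = "\<lambda>j y. d j y + d i y * inverse (?w y) * ?e j y"])
    show "eventually (\<lambda>y. \<forall>\<delta>. tangent_vector C y \<delta> \<longrightarrow>
        \<delta> h = (\<Sum>j\<in>J. (d j y + d i y * inverse (?w y) * ?e j y) * \<delta> j)) (near x)"
      using c(2) d(2) near_near[OF u(2)] regular_at_near[OF u(1)] regular_at_near[OF tr]
        regular_at_near[OF i(1)] regular_at_nonzero_near[OF w wx]
    proof eventually_elim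
      case (elim y)
      show ?case
      proof (intro allI impI)
        fix \<delta> assume \<delta>: "tangent_vector C y \<delta>"
        have y: "y \<in> points" using elim(4) regular_at_point by blast
        have "eventually (\<lambda>z. i z = i x + t z * u z) (near y)"
          using elim(3) by eventually_elim (simp add: algebra_simps)
        then have "\<delta> i = \<delta> (\<lambda>z. i x + t z * u z)"
          by (rule tangent_vector_cong[OF \<delta>, rotated])
            (intro regular_at_add regular_at_mult regular_at_const y elim)
        also have "\<dots> = t y * \<delta> u + u y * \<delta> t"
          using elim y by (simp add: tangent_vector_add[OF \<delta>] tangent_vector_mult[OF \<delta>]
              tangent_vector_const[OF \<delta>] regular_at_const regular_at_mult)
        also have "\<delta> u = c i y * \<delta> i + (\<Sum>j\<in>J. c j y * \<delta> j)"
          using elim(1)[rule_format, OF \<delta>] J i by simp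
        finally have \<delta>i: "\<delta> i = t y * (c i y * \<delta> i + (\<Sum>j\<in>J. c j y * \<delta> j)) + u y * \<delta> t" .
        have "?w y * \<delta> i = \<delta> i - t y * c i y * \<delta> i" by (simp add: algebra_simps)
        also have "\<dots> = u y * \<delta> t + t y * (\<Sum>j\<in>J. c j y * \<delta> j)"
          by (subst (1) \<delta>i) (simp add: algebra_simps)
        also have "u y * \<delta> t = (\<Sum>j\<in>J. (if j = t then u y else 0) * \<delta> j)"
          using J by (simp add: if_distrib[of "\<lambda>u. u * _"] cong: if_cong)
        finally have "?w y * \<delta> i = (\<Sum>j\<in>J. ?e j y * \<delta> j)"
          by (simp add: sum_distrib_left distrib_right sum.distrib mult.assoc)
        then have \<delta>i': "\<delta> i = inverse (?w y) * (\<Sum>j\<in>J. ?e j y * \<delta> j)"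
          using elim(7) by (simp add: field_simps)
        have "\<delta> h = d i y * \<delta> i + (\<Sum>j\<in>J. d j y * \<delta> j)"
          using elim(2)[rule_format, OF \<delta>] J i by simp
        then show "\<delta> h = (\<Sum>j\<in>J. (d j y + d i y * inverse (?w y) * ?e j y) * \<delta> j)"
          unfolding \<delta>i'
            by (simp add: sum_distrib_left distrib_right distrib_left sum.distrib mult.assoc add.commute)
      qed
    qed
  next
    fix j assume "j \<in> J"
    then show "regular_at C x (\<lambda>y. d j y + d i y * inverse (?w y) * ?e j y)"
      by (intro regular_at_add[OF d(1)] regular_at_mult[OF regular_at_mult[OF d(1)]] e
          regular_at_inverse[OF w wx]) auto
  qed
qed

lemma spanned_by_coordinate:
  assumes t: "local_coordinate C x t" and h: "regular_at C x h"
  shows "spanned_by x {t} h"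
proof -
  have x: "x \<in> points" using h by (rule regular_at_point)
  obtain A where A: "affine_open C A" "x \<in> A" using affine_neighbourhood[OF x] .
  obtain G where G: "finite G" "G \<subseteq> regular C A"
    "\<And>f. f \<in> regular C A \<Longrightarrow> \<exists>g\<in>generated_algebra G. \<forall>y\<in>A. f y = g y"
    using affine_open_finitely_generated[OF A(1)] by blast
  have "\<forall>h. regular_at C x h \<longrightarrow> spanned_by x J h"
    if "finite K" "K \<inter> J = {}" "finite J" "t \<in> J" "\<forall>i\<in>K. regular_at C x i"
      "\<forall>h. regular_at C x h \<longrightarrow> spanned_by x (K \<union> J) h" for K J
    using that
  proof (induction K rule: finite_induct)
    case (insert i K)
    show ?case
    proof (rule insert.IH)
      show "\<forall>h. regular_at C x h \<longrightarrow> spanned_by x (K \<union> J) h"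
        using insert spanned_by_eliminate[OF t, of "K \<union> J" i] by auto
    qed (use insert in auto)
  qed simp
  note elim = this[of "G - {t}" "{t}", rule_format, OF _ _ _ _ _ _ h]
  show ?thesis
  proof (rule elim)
    fix i assume "i \<in> G - {t}"
    then show "regular_at C x i" using G(2) A affine_open_zopen by (blast intro: regular_atI)
  next
    fix h assume h: "regular_at C x h"
    then obtain c where c: "\<And>j. j \<in> G \<Longrightarrow> regular_at C x (c j)"
      "eventually (\<lambda>y. \<forall>\<delta>. tangent_vector C y \<delta> \<longrightarrow> \<delta> h = (\<Sum>j\<in>G. c j y * \<delta> j)) (near x)"
      using spanned_byE[OF spanned_by_generators[OF A G h]] by blast
    let ?c = "\<lambda>j. if j \<in> G then c j else (\<lambda>_. 0)"
    have "(\<Sum>j\<in>G. c j y * \<delta> j) = (\<Sum>j\<in>G - {t} \<union> {t}. ?c j y * \<delta> j)" for \<delta> :: "('x \<Rightarrow> 'k) \<Rightarrow> 'k" and y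
      using G(1) by (intro sum.mono_neutral_cong_left) auto
    then show "spanned_by x (G - {t} \<union> {t}) h"
      using c x by (intro spanned_byI[where c = ?c]) (auto intro: regular_at_const)
  qed (use G in auto)
qed

text \<open>The differential \<open>dt\<close> generates the sheaf of differentials on \<open>D\<close>.\<close>

definition etale_coordinate :: "'x set \<Rightarrow> ('x \<Rightarrow> 'k) \<Rightarrow> bool" where
  "etale_coordinate D t \<longleftrightarrow> zopen D \<and> t \<in> regular C D \<and>
    (\<forall>y\<in>D. \<forall>h. regular_at C y h \<longrightarrow> spanned_by y {t} h)"

text \<open>At \<open>x\<close>, the differentials of the finitely many generators of an affine coordinate ring are multiples of
  \<open>dt\<close>. This holds on a common neighbourhood, and at each of its points these differentials span all others.\<close>

theorem etale_neighbourhood: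
  assumes t: "local_coordinate C x t"
  obtains D where "x \<in> D" "etale_coordinate D t"
proof -
  have tr: "regular_at C x t" using t by (rule local_coordinate_regular)
  have x: "x \<in> points" using tr by (rule regular_at_point)
  obtain A where A: "affine_open C A" "x \<in> A" using affine_neighbourhood[OF x] .
  obtain G where G: "finite G" "G \<subseteq> regular C A"
    "\<And>f. f \<in> regular C A \<Longrightarrow> \<exists>g\<in>generated_algebra G. \<forall>y\<in>A. f y = g y"
    using affine_open_finitely_generated[OF A(1)] by blast
  have "\<forall>g\<in>G. \<exists>c. regular_at C x c \<and> eventually (\<lambda>y. \<forall>\<delta>. tangent_vector C y \<delta> \<longrightarrow> \<delta> g = c y * \<delta> t) (near x)"
  proof
    fix g assume "g \<in> G"
    then have "regular_at C x g" using G(2) A affine_open_zopen by (blast intro: regular_atI)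
    from spanned_by_coordinate[OF t this, unfolded spanned_by_def] obtain c where
      "\<forall>j\<in>{t}. regular_at C x (c j)" and
      "eventually (\<lambda>y. \<forall>\<delta>. tangent_vector C y \<delta> \<longrightarrow> \<delta> g = (\<Sum>j\<in>{t}. c j y * \<delta> j)) (near x)"
      by blast
    then show "\<exists>c. regular_at C x c \<and> eventually (\<lambda>y. \<forall>\<delta>. tangent_vector C y \<delta> \<longrightarrow> \<delta> g = c y * \<delta> t) (near x)"
      by (intro exI[of _ "c t"]) simp
  qed
  from bchoice[OF this] obtain c where c: "\<And>g. g \<in> G \<Longrightarrow> regular_at C x (c g)"
    "\<And>g. g \<in> G \<Longrightarrow> eventually (\<lambda>y. \<forall>\<delta>. tangent_vector C y \<delta> \<longrightarrow> \<delta> g = c g y * \<delta> t) (near x)"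
    by blast
  have "eventually (\<lambda>y. (\<forall>g\<in>G. regular_at C y (c g)) \<and>
      (\<forall>g\<in>G. \<forall>\<delta>. tangent_vector C y \<delta> \<longrightarrow> \<delta> g = c g y * \<delta> t) \<and> regular_at C y t \<and> y \<in> A) (near x)"
    using c A affine_open_zopen[OF A(1)] x
    by (intro eventually_conj eventually_ball_finite G(1) ballI regular_at_near tr)
      (auto simp: eventually_near)
  then obtain D where D: "zopen D" "x \<in> D"
    "\<And>y. y \<in> D \<Longrightarrow> (\<forall>g\<in>G. regular_at C y (c g)) \<and>
      (\<forall>g\<in>G. \<forall>\<delta>. tangent_vector C y \<delta> \<longrightarrow> \<delta> g = c g y * \<delta> t) \<and> regular_at C y t \<and> y \<in> A"
    using x by (auto simp: eventually_near)
  have "spanned_by y {t} h" if y: "y \<in> D" and h: "regular_at C y h" for y h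
  proof -
    have yA: "y \<in> A" and yp: "y \<in> points" using D y h regular_at_point by auto
    obtain a where a: "\<And>j. j \<in> G \<Longrightarrow> regular_at C y (a j)"
      "eventually (\<lambda>z. \<forall>\<delta>. tangent_vector C z \<delta> \<longrightarrow> \<delta> h = (\<Sum>j\<in>G. a j z * \<delta> j)) (near y)"
      using spanned_byE[OF spanned_by_generators[OF A(1) yA G h]] by blast
    have inD: "eventually (\<lambda>z. z \<in> D) (near y)" using D(1) y yp by (auto simp: eventually_near)
    show ?thesis
    proof (rule spanned_byI[where c = "\<lambda>_ z. \<Sum>g\<in>G. a g z * c g z"])
      show "eventually (\<lambda>z. \<forall>\<delta>. tangent_vector C z \<delta> \<longrightarrow>
          \<delta> h = (\<Sum>j\<in>{t}. (\<Sum>g\<in>G. a g z * c g z) * \<delta> j)) (near y)"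
        using a(2) inD
      proof eventually_elim
        case (elim z)
        show ?case
        proof (intro allI impI)
          fix \<delta> assume \<delta>: "tangent_vector C z \<delta>"
          have "\<delta> h = (\<Sum>g\<in>G. a g z * \<delta> g)" by (rule elim(1)[rule_format, OF \<delta>])
          also have "\<dots> = (\<Sum>g\<in>G. a g z * (c g z * \<delta> t))"
            using D(3)[OF elim(2)] \<delta> by (intro sum.cong) auto
          finally show "\<delta> h = (\<Sum>j\<in>{t}. (\<Sum>g\<in>G. a g z * c g z) * \<delta> j)"
            by (simp add: sum_distrib_right mult.assoc)
        qed
      qed
    qed (intro regular_at_sum regular_at_mult yp a, use D y in auto)
  qed
  moreover have "t \<in> regular C D" using D by (simp add: regular_iff_regular_at)
  ultimately show thesis using that D by (simp add: etale_coordinate_def)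
qed

end

section \<open>Partial derivatives and vector fields\<close>

context curve
begin

text \<open>The tangent vector sends \<open>f\<close> to \<open>q(y)\<close> where \<open>f = f(y) + s q\<close>; the germ of \<open>q\<close> is unique because \<open>s\<close>
  can be cancelled.\<close>

lemma tangent_vector_exists:
  assumes s: "local_coordinate C y s"
  obtains \<delta> where "tangent_vector C y \<delta>" "\<delta> s = 1"
proof -
  have sr: "regular_at C y s" using s by (rule local_coordinate_regular)
  have y: "y \<in> points" using sr by (rule regular_at_point)
  let ?Q = "\<lambda>f q. regular_at C y q \<and> eventually (\<lambda>z. f z = f y + s z * q z) (near y)"
  have unique: "q y = r y" if "?Q f q" "?Q g r" "eventually (\<lambda>z. f z = g z) (near y)" for f g q r
  proof -
    have fg: "f y = g y" using near_at[OF that(3) y] .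
    have "eventually (\<lambda>z. s z ^ 1 * (q z - r z) = 0) (near y)"
      using conjunct2[OF that(1)] conjunct2[OF that(2)] that(3)
    proof eventually_elim
      case (elim z)
      then have "s z * q z = s z * r z" using fg by (metis add_left_cancel)
      then show ?case by (simp only: power_one_right right_diff_distrib diff_self)
    qed
    then have "eventually (\<lambda>z. q z - r z = 0) (near y)"
      by (rule local_coordinate_cancel[OF s, rotated]) (use that in \<open>auto intro: regular_at_diff\<close>)
    then have "q y - r y = 0" by (rule near_at[OF _ y])
    then show ?thesis by simp
  qed
  have ex: "\<exists>q. ?Q f q" if f: "regular_at C y f" for f
  proof -
    have "regular_at C y (\<lambda>z. f z - f y)" using f y by (intro regular_at_diff regular_at_const)
    then obtain q where q: "regular_at C y q" "eventually (\<lambda>z. f z - f y = s z * q z) (near y)"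
      by (rule local_coordinate_divides[OF s]) auto
    from q(2) have "eventually (\<lambda>z. f z = f y + s z * q z) (near y)"
      by eventually_elim (simp add: algebra_simps)
    with q(1) show ?thesis by blast
  qed
  define \<delta> where "\<delta> f = (SOME q. ?Q f q) y" for f
  have \<delta>: "\<delta> f = q y" if "?Q f q" for f q
  proof -
    have "?Q f (SOME q. ?Q f q)" using that by (rule someI[where P = "?Q f"])
    then show ?thesis using unique[OF _ that] by (simp add: \<delta>_def)
  qed
  have "tangent_vector C y \<delta>"
    unfolding tangent_vector_def
  proof (intro conjI allI impI)
    fix f g assume fg: "regular_at C y f \<and> regular_at C y g"
    obtain q where q: "?Q f q" using ex fg by blast
    obtain r where r: "?Q g r" using ex fg by blast
    have "?Q (\<lambda>z. f z + g z) (\<lambda>z. q z + r z)"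
    proof
      show "eventually (\<lambda>z. f z + g z = f y + g y + s z * (q z + r z)) (near y)"
        using conjunct2[OF q] conjunct2[OF r] by eventually_elim (simp add: algebra_simps)
    qed (use q r in \<open>auto intro: regular_at_add\<close>)
    then show "\<delta> (\<lambda>z. f z + g z) = \<delta> f + \<delta> g" using \<delta>[OF q] \<delta>[OF r] \<delta> by simp
    let ?p = "\<lambda>z. f y * r z + g y * q z + s z * (q z * r z)"
    have "?Q (\<lambda>z. f z * g z) ?p"
    proof
      show "eventually (\<lambda>z. f z * g z = f y * g y + s z * ?p z) (near y)"
        using conjunct2[OF q] conjunct2[OF r]
      proof eventually_elim
        case (elim z)
        have "f z * g z = (f y + s z * q z) * (g y + s z * r z)"
          using elim by (rule arg_cong2[of _ _ _ _ "(*)"])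
        then show ?case by (simp add: algebra_simps)
      qed
    qed (use q r y sr in \<open>auto intro!: regular_at_add regular_at_mult regular_at_const\<close>)
    then have "\<delta> (\<lambda>z. f z * g z) = ?p y" by (rule \<delta>)
    then show "\<delta> (\<lambda>z. f z * g z) = f y * \<delta> g + g y * \<delta> f"
      using \<delta>[OF q] \<delta>[OF r] local_coordinate_zero[OF s] by simp
    assume "same_germ C y f g"
    then show "\<delta> f = \<delta> g" using unique[OF q r] \<delta>[OF q] \<delta>[OF r] by (simp add: same_germ_iff[OF y])
  next
    fix c :: 'k
    have "?Q (\<lambda>_. c) (\<lambda>_. 0)" using y by (simp add: regular_at_const)
    then show "\<delta> (\<lambda>_. c) = 0" by (rule \<delta>)
  qed
  moreover have "?Q s (\<lambda>_. 1)" using y local_coordinate_zero[OF s] by (simp add: regular_at_const)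
  then have "\<delta> s = 1" by (rule \<delta>)
  ultimately show thesis by (rule that)
qed

lemma tangent_vector_scale:
  assumes "tangent_vector C y \<delta>"
  shows "tangent_vector C y (\<lambda>f. a * \<delta> f)"
  using assms by (auto simp: tangent_vector_def algebra_simps)

text \<open>On the domain of an etale coordinate \<open>t\<close>, this is \<open>d/dt\<close>: the chosen tangent vector is dual to \<open>dt\<close>,
  so its values at regular functions are determined.\<close>

definition partial :: "('x \<Rightarrow> 'k) \<Rightarrow> ('x \<Rightarrow> 'k) \<Rightarrow> 'x \<Rightarrow> 'k" where
  "partial t f y = (SOME \<delta>. tangent_vector C y \<delta> \<and> \<delta> t = 1) f"

lemma etale_coordinate_zopen: "etale_coordinate D t \<Longrightarrow> zopen D"
  and etale_coordinate_regular: "etale_coordinate D t \<Longrightarrow> t \<in> regular C D"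
  by (simp_all add: etale_coordinate_def)

lemma etale_coordinate_subset:
  "etale_coordinate D t \<Longrightarrow> zopen U \<Longrightarrow> U \<subseteq> D \<Longrightarrow> etale_coordinate U t"
  by (auto simp: etale_coordinate_def intro: regular_subset)

lemma etale_differential:
  assumes D: "etale_coordinate D t" and y: "y \<in> D" and h: "regular_at C y h"
  obtains c where "regular_at C y c"
    "eventually (\<lambda>z. \<forall>\<delta>. tangent_vector C z \<delta> \<longrightarrow> \<delta> h = c z * \<delta> t) (near y)"
proof -
  have "spanned_by y {t} h" using D y h by (simp add: etale_coordinate_def)
  then obtain c where "\<forall>j\<in>{t}. regular_at C y (c j)"
    "eventually (\<lambda>z. \<forall>\<delta>. tangent_vector C z \<delta> \<longrightarrow> \<delta> h = (\<Sum>j\<in>{t}. c j z * \<delta> j)) (near y)"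
    unfolding spanned_by_def by blast
  then show thesis using that[of "c t"] by simp
qed

text \<open>A coordinate \<open>s\<close> at \<open>y\<close> has a dual tangent vector \<open>\<delta>\<close>. Since \<open>ds\<close> is a multiple of \<open>dt\<close>, it
  follows that \<open>\<delta> t \<noteq> 0\<close>, so \<open>\<delta>\<close> can be rescaled.\<close>

lemma partial_tangent_vector:
  assumes D: "etale_coordinate D t" and y: "y \<in> D"
  shows "tangent_vector C y (\<lambda>f. partial t f y)" "partial t t y = 1"
proof -
  have yp: "y \<in> points" using zopen_subset_points[OF etale_coordinate_zopen[OF D] y] .
  obtain s where s: "local_coordinate C y s" using local_coordinate_exists[OF yp] by blast
  obtain \<delta> where \<delta>: "tangent_vector C y \<delta>" "\<delta> s = 1" using tangent_vector_exists[OF s] .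
  obtain c where c: "eventually (\<lambda>z. \<forall>\<delta>. tangent_vector C z \<delta> \<longrightarrow> \<delta> s = c z * \<delta> t) (near y)"
    using etale_differential[OF D y local_coordinate_regular[OF s]] by blast
  have "\<delta> s = c y * \<delta> t" using near_at[OF c yp] \<delta>(1) by blast
  then have nz: "\<delta> t \<noteq> 0" using \<delta>(2) by auto
  have "\<exists>\<delta>. tangent_vector C y \<delta> \<and> \<delta> t = 1"
    by (rule exI[of _ "\<lambda>f. inverse (\<delta> t) * \<delta> f"])
      (use nz tangent_vector_scale[OF \<delta>(1), of "inverse (\<delta> t)"] in simp)
  from someI_ex[OF this] show "tangent_vector C y (\<lambda>f. partial t f y)" "partial t t y = 1"
    by (simp_all add: partial_def)
qed

lemma tangent_vector_eq_partial:
  assumes D: "etale_coordinate D t" and y: "y \<in> D" and \<delta>: "tangent_vector C y \<delta>"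
    and f: "regular_at C y f"
  shows "\<delta> f = partial t f y * \<delta> t"
proof -
  have yp: "y \<in> points" using f by (rule regular_at_point)
  obtain c where c: "eventually (\<lambda>z. \<forall>\<delta>. tangent_vector C z \<delta> \<longrightarrow> \<delta> f = c z * \<delta> t) (near y)"
    using etale_differential[OF D y f] by blast
  have c': "\<delta>' f = c y * \<delta>' t" if "tangent_vector C y \<delta>'" for \<delta>' using near_at[OF c yp] that by blast
  show ?thesis using c'[OF \<delta>] c'[OF partial_tangent_vector(1)[OF D y]] partial_tangent_vector(2)[OF D y]
    by simp
qed

lemma partial_regular_at:
  assumes D: "etale_coordinate D t" and y: "y \<in> D" and f: "regular_at C y f"
  shows "regular_at C y (partial t f)"
proof -
  have yp: "y \<in> points" using f by (rule regular_at_point)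
  obtain c where c: "regular_at C y c"
    "eventually (\<lambda>z. \<forall>\<delta>. tangent_vector C z \<delta> \<longrightarrow> \<delta> f = c z * \<delta> t) (near y)"
    using etale_differential[OF D y f] .
  have inD: "eventually (\<lambda>z. z \<in> D) (near y)"
    using etale_coordinate_zopen[OF D] y yp by (auto simp: eventually_near)
  have "eventually (\<lambda>z. partial t f z = c z) (near y)"
    using c(2) inD
  proof eventually_elim
    case (elim z)
    then show ?case using partial_tangent_vector[OF D elim(2)] by fastforce
  qed
  then show ?thesis by (rule regular_at_cong[OF c(1)])
qed

lemma partial_regular:
  assumes D: "etale_coordinate D t" and V: "zopen V" "V \<subseteq> D" and f: "f \<in> regular C V"
  shows "partial t f \<in> regular C V"
  using f partial_regular_at[OF D] V by (auto simp: regular_iff_regular_at)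

lemma taylor_expansion_partial:
  assumes D: "etale_coordinate D t" and x: "x \<in> D" and F: "taylor_expansion C x t f F"
  shows "taylor_expansion C x t (partial t f) (fps_deriv F)"
proof -
  have f: "regular_at C x f" using F by (rule taylor_expansion_regular)
  have xp: "x \<in> points" using f by (rule regular_at_point)
  have tr: "regular_at C x t" using etale_coordinate_regular[OF D] etale_coordinate_zopen[OF D] x
    by (blast intro: regular_atI)
  have inD: "eventually (\<lambda>z. z \<in> D) (near x)"
    using etale_coordinate_zopen[OF D] x xp by (auto simp: eventually_near)
  show ?thesis
    unfolding taylor_expansion_iff[OF xp]
  proof (intro conjI allI partial_regular_at[OF D x f])
    fix m
    obtain g where g: "regular_at C x g"
      "eventually (\<lambda>y. f y = (\<Sum>i<Suc m. fps_nth F i * t y ^ i) + t y ^ Suc m * g y) (near x)"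
      using taylor_expansionE[OF F] .
    let ?r = "\<lambda>y. of_nat (Suc m) * g y + t y * partial t g y"
    have "eventually (\<lambda>y. partial t f y = (\<Sum>i<m. fps_nth (fps_deriv F) i * t y ^ i) + t y ^ m * ?r y) (near x)"
      using near_near[OF g(2)] inD regular_at_near[OF g(1)] regular_at_near[OF tr]
    proof eventually_elim
      case (elim y)
      have y: "y \<in> points" using elim(3) by (rule regular_at_point)
      note \<delta> = partial_tangent_vector(1)[OF D elim(2)]
      note reg = regular_at_const[OF y] regular_at_power[OF elim(4)] elim(3)
      have monomial: "partial t (\<lambda>z. a * t z ^ i) y = a * (of_nat i * t y ^ (i - 1))" for a i
        using tangent_vector_mult[OF \<delta> reg(1,2)] tangent_vector_const[OF \<delta>]
          tangent_vector_power[OF \<delta> elim(4)] partial_tangent_vector(2)[OF D elim(2)] by simp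
      have "partial t f y = partial t (\<lambda>z. (\<Sum>i<Suc m. fps_nth F i * t z ^ i) + t z ^ Suc m * g z) y"
        by (rule tangent_vector_cong[OF \<delta>, OF _ elim(1)])
          (intro regular_at_add regular_at_mult regular_at_sum y reg)
      also have "\<dots> = partial t (\<lambda>z. \<Sum>i<Suc m. fps_nth F i * t z ^ i) y + partial t (\<lambda>z. t z ^ Suc m * g z) y"
        by (rule tangent_vector_add[OF \<delta>]) (intro regular_at_mult regular_at_sum y reg)+
      also have "partial t (\<lambda>z. \<Sum>i<Suc m. fps_nth F i * t z ^ i) y
          = (\<Sum>i<Suc m. partial t (\<lambda>z. fps_nth F i * t z ^ i) y)"
        by (rule tangent_vector_sum[OF \<delta> y]) (intro regular_at_mult reg)
      also have "\<dots> = (\<Sum>i<m. fps_nth (fps_deriv F) i * t y ^ i)"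
        unfolding monomial by (simp only: sum.lessThan_Suc_shift) (simp add: mult_ac)
      also have "partial t (\<lambda>z. t z ^ Suc m * g z) y = t y ^ m * ?r y"
        using tangent_vector_mult[OF \<delta> reg(2,3), of "Suc m"] monomial[of 1 "Suc m"]
        by (simp add: algebra_simps)
      finally show ?case .
    qed
    moreover have "regular_at C x ?r"
      by (intro regular_at_add regular_at_mult regular_at_const xp g tr partial_regular_at[OF D x])
    ultimately show "\<exists>g. regular_at C x g \<and>
      eventually (\<lambda>y. partial t f y = (\<Sum>i<m. fps_nth (fps_deriv F) i * t y ^ i) + t y ^ m * g y) (near x)"
      by blast
  qed
qed

lemma vector_fieldD:
  assumes "vector_field C U \<theta>" "zopen V" "V \<subseteq> U"
  shows "\<forall>f\<in>regular C V. \<theta> f \<in> regular C V"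
    and "\<forall>f\<in>regular C V. \<forall>g\<in>regular C V. \<forall>x\<in>V.
        \<theta> (\<lambda>y. f y + g y) x = \<theta> f x + \<theta> g x \<and>
        \<theta> (\<lambda>y. f y * g y) x = f x * \<theta> g x + g x * \<theta> f x \<and>
        ((\<forall>y\<in>V. f y = g y) \<longrightarrow> \<theta> f x = \<theta> g x)"
    and "\<forall>c. \<forall>x\<in>V. \<theta> (\<lambda>_. c) x = 0"
proof -
  note D = assms(1)[unfolded vector_field_def, THEN spec, of V, THEN mp, OF conjI[OF assms(2,3)]]
  show "\<forall>f\<in>regular C V. \<theta> f \<in> regular C V" using D by (rule conjunct1)
  show "\<forall>f\<in>regular C V. \<forall>g\<in>regular C V. \<forall>x\<in>V.
        \<theta> (\<lambda>y. f y + g y) x = \<theta> f x + \<theta> g x \<and>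
        \<theta> (\<lambda>y. f y * g y) x = f x * \<theta> g x + g x * \<theta> f x \<and>
        ((\<forall>y\<in>V. f y = g y) \<longrightarrow> \<theta> f x = \<theta> g x)" using D by (elim conjE)
  show "\<forall>c. \<forall>x\<in>V. \<theta> (\<lambda>_. c) x = 0" using D by (elim conjE)
qed

lemma vector_field_regular:
  "vector_field C U \<theta> \<Longrightarrow> zopen V \<Longrightarrow> V \<subseteq> U \<Longrightarrow> f \<in> regular C V \<Longrightarrow> \<theta> f \<in> regular C V"
  using vector_fieldD(1) by blast

lemma vector_field_subset:
  assumes \<theta>: "vector_field C U \<theta>" and VU: "V \<subseteq> U"
  shows "vector_field C V \<theta>"
  unfolding vector_field_def
proof (intro allI, rule impI)
  fix T assume T: "zopen T \<and> T \<subseteq> V"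
  then have "zopen T \<and> T \<subseteq> U" using VU by blast
  then show "(\<forall>f\<in>regular C T. \<theta> f \<in> regular C T) \<and>
      (\<forall>f\<in>regular C T. \<forall>g\<in>regular C T. \<forall>x\<in>T.
        \<theta> (\<lambda>y. f y + g y) x = \<theta> f x + \<theta> g x \<and>
        \<theta> (\<lambda>y. f y * g y) x = f x * \<theta> g x + g x * \<theta> f x \<and>
        ((\<forall>y\<in>T. f y = g y) \<longrightarrow> \<theta> f x = \<theta> g x)) \<and>
      (\<forall>c. \<forall>x\<in>T. \<theta> (\<lambda>_. c) x = 0)"
    by (rule \<theta>[unfolded vector_field_def, THEN spec, of T, THEN mp])
qed

lemma vector_field_tangent_vector:
  assumes \<theta>: "vector_field C U \<theta>" and U: "zopen U" and x: "x \<in> U"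
  shows "tangent_vector C x (\<lambda>f. \<theta> f x)"
  unfolding tangent_vector_def
proof (intro conjI allI impI)
  fix f g assume "regular_at C x f \<and> regular_at C x g"
  then obtain V where V: "zopen V" "x \<in> V" "f \<in> regular C V" "g \<in> regular C V"
    using regular_at_common by blast
  have rule: "\<theta> (\<lambda>y. f y + g y) x = \<theta> f x + \<theta> g x \<and>
      \<theta> (\<lambda>y. f y * g y) x = f x * \<theta> g x + g x * \<theta> f x \<and> ((\<forall>y\<in>T. f y = g y) \<longrightarrow> \<theta> f x = \<theta> g x)"
    if T: "zopen T" "x \<in> T" "T \<subseteq> U \<inter> V" for T
  proof -
    have "f \<in> regular C T" "g \<in> regular C T" using T V by (auto intro: regular_subset)
    moreover have "T \<subseteq> U" using T by blast
    ultimately show ?thesis using vector_fieldD(2)[OF \<theta> T(1), rule_format, of f g x] T(2) by auto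
  qed
  have UV: "zopen (U \<inter> V)" "x \<in> U \<inter> V" using U V x by auto
  show "\<theta> (\<lambda>y. f y + g y) x = \<theta> f x + \<theta> g x" "\<theta> (\<lambda>y. f y * g y) x = f x * \<theta> g x + g x * \<theta> f x"
    using rule[OF UV] by auto
  assume "same_germ C x f g"
  then obtain T where T: "zopen T" "x \<in> T" "\<forall>y\<in>T. f y = g y" unfolding same_germ_def by blast
  have "zopen (U \<inter> V \<inter> T)" using UV T by blast
  then show "\<theta> f x = \<theta> g x" using rule[of "U \<inter> V \<inter> T"] T UV by blast
next
  fix c show "\<theta> (\<lambda>_. c) x = 0" using vector_fieldD(3)[OF \<theta> U subset_refl] x by simp
qed

text \<open>A derivation of the structure sheaf is a family of tangent vectors that preserves regularity; in this
  form, facts on tangent vectors apply to vector fields.\<close>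

lemma vector_fieldI:
  assumes "\<And>V f. zopen V \<Longrightarrow> V \<subseteq> U \<Longrightarrow> f \<in> regular C V \<Longrightarrow> \<theta> f \<in> regular C V"
    and "\<And>x. x \<in> U \<Longrightarrow> tangent_vector C x (\<lambda>f. \<theta> f x)"
  shows "vector_field C U \<theta>"
  unfolding vector_field_def
proof (intro allI impI, elim conjE, intro conjI ballI allI)
  fix V assume V: "zopen V" "V \<subseteq> U"
  show "\<theta> f \<in> regular C V" if "f \<in> regular C V" for f using assms(1) V that by blast
  fix x assume x: "x \<in> V"
  have \<delta>: "tangent_vector C x (\<lambda>f. \<theta> f x)" using assms(2) x V by blast
  show "\<theta> (\<lambda>_. c) x = 0" for c using tangent_vector_const[OF \<delta>] .
  fix f g assume "f \<in> regular C V" "g \<in> regular C V"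
  then have reg: "regular_at C x f" "regular_at C x g" using V x by (auto intro: regular_atI)
  show "\<theta> (\<lambda>y. f y + g y) x = \<theta> f x + \<theta> g x" using tangent_vector_add[OF \<delta> reg] .
  show "\<theta> (\<lambda>y. f y * g y) x = f x * \<theta> g x + g x * \<theta> f x" using tangent_vector_mult[OF \<delta> reg] .
  show "(\<forall>y\<in>V. f y = g y) \<longrightarrow> \<theta> f x = \<theta> g x"
    using tangent_vector_cong[OF \<delta> reg(2), of f] V x zopen_subset_points[OF V(1) x]
    by (auto simp: eventually_near)
qed

lemma vector_field_funpow_regular:
  "vector_field C U \<theta> \<Longrightarrow> zopen V \<Longrightarrow> V \<subseteq> U \<Longrightarrow> f \<in> regular C V \<Longrightarrow> (\<theta> ^^ m) f \<in> regular C V"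
  by (induction m) (auto intro: vector_field_regular)

lemma vector_field_cong:
  assumes \<theta>: "vector_field C U \<theta>" and V: "zopen V" "V \<subseteq> U" and g: "g \<in> regular C V"
    and fg: "\<And>y. y \<in> V \<Longrightarrow> f y = g y" and x: "x \<in> V"
  shows "(\<theta> ^^ m) f x = (\<theta> ^^ m) g x"
  using x
proof (induction m arbitrary: x)
  case (Suc m)
  have "tangent_vector C x (\<lambda>f. \<theta> f x)"
    using vector_field_tangent_vector[OF vector_field_subset[OF \<theta> V(2)] V(1) Suc.prems] .
  moreover have "regular_at C x ((\<theta> ^^ m) g)"
    using vector_field_funpow_regular[OF \<theta> V g] V Suc.prems by (blast intro: regular_atI)
  moreover have "eventually (\<lambda>y. (\<theta> ^^ m) f y = (\<theta> ^^ m) g y) (near x)"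
    using Suc V zopen_subset_points[OF V(1) Suc.prems] by (auto simp: eventually_near)
  ultimately have "\<theta> ((\<theta> ^^ m) f) x = \<theta> ((\<theta> ^^ m) g) x" by (rule tangent_vector_cong)
  then show ?case by simp
qed (use fg in simp)

lemma vector_field_funpow_mult:
  assumes \<theta>: "vector_field C U \<theta>" and V: "zopen V" "V \<subseteq> U"
    and fg: "f \<in> regular C V" "g \<in> regular C V" and x: "x \<in> V"
  shows "(\<theta> ^^ m) (\<lambda>y. f y * g y) x = (\<Sum>i\<le>m. of_nat (m choose i) * ((\<theta> ^^ i) f x * (\<theta> ^^ (m - i)) g x))"
  using x
proof (induction m arbitrary: x)
  case (Suc m)
  let ?h = "\<lambda>y. \<Sum>i\<le>m. of_nat (m choose i) * ((\<theta> ^^ i) f y * (\<theta> ^^ (m - i)) g y)"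
  have xp: "x \<in> points" using zopen_subset_points[OF V(1) Suc.prems] .
  have \<delta>: "tangent_vector C x (\<lambda>f. \<theta> f x)"
    using vector_field_tangent_vector[OF vector_field_subset[OF \<theta> V(2)] V(1) Suc.prems] .
  have reg: "regular_at C x ((\<theta> ^^ i) f)" "regular_at C x ((\<theta> ^^ i) g)" for i
    using vector_field_funpow_regular[OF \<theta> V] fg V Suc.prems by (blast intro: regular_atI)+
  have "(\<theta> ^^ Suc m) (\<lambda>y. f y * g y) x = \<theta> ((\<theta> ^^ m) (\<lambda>y. f y * g y)) x" by simp
  also have "\<dots> = \<theta> ?h x"
  proof (rule tangent_vector_cong[OF \<delta>])
    show "regular_at C x ?h"
      by (intro regular_at_sum regular_at_mult regular_at_const xp reg)
    show "eventually (\<lambda>y. (\<theta> ^^ m) (\<lambda>y. f y * g y) y = ?h y) (near x)"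
      using Suc V xp by (auto simp: eventually_near)
  qed
  also have "\<dots> = (\<Sum>i\<le>m. \<theta> (\<lambda>y. of_nat (m choose i) * ((\<theta> ^^ i) f y * (\<theta> ^^ (m - i)) g y)) x)"
    by (rule tangent_vector_sum[OF \<delta> xp]) (intro regular_at_mult regular_at_const xp reg)
  also have "\<dots> = (\<Sum>i\<le>m. of_nat (m choose i) *
      ((\<theta> ^^ Suc i) f x * (\<theta> ^^ (m - i)) g x + (\<theta> ^^ i) f x * (\<theta> ^^ Suc (m - i)) g x))"
    by (intro sum.cong refl)
      (simp add: tangent_vector_mult[OF \<delta>] tangent_vector_const[OF \<delta>] regular_at_mult regular_at_const
        reg xp algebra_simps)
  also have "\<dots> = (\<Sum>i\<le>Suc m. of_nat (Suc m choose i) * ((\<theta> ^^ i) f x * (\<theta> ^^ (Suc m - i)) g x))"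
    by (rule sum_choose_Suc[of m "\<lambda>i j. (\<theta> ^^ i) f x * (\<theta> ^^ j) g x"])
  finally show ?case .
qed simp

lemma vector_field_power_CHAR:
  assumes \<theta>: "vector_field C U \<theta>" and U: "zopen U" and p: "CHAR('k) > 0"
  shows "vector_field C U (\<theta> ^^ CHAR('k))"
proof (rule vector_fieldI)
  let ?p = "CHAR('k)"
  have prime: "prime ?p" using p by (rule prime_CHAR_semidom)
  show "(\<theta> ^^ ?p) f \<in> regular C V" if "zopen V" "V \<subseteq> U" "f \<in> regular C V" for V f
    using vector_field_funpow_regular[OF \<theta> that] .
  fix x assume x: "x \<in> U"
  have xp: "x \<in> points" using zopen_subset_points[OF U x] .
  show "tangent_vector C x (\<lambda>f. (\<theta> ^^ ?p) f x)"
    unfolding tangent_vector_def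
  proof (intro conjI allI impI)
    fix f g assume "regular_at C x f \<and> regular_at C x g"
    then obtain V' where V': "zopen V'" "x \<in> V'" "f \<in> regular C V'" "g \<in> regular C V'"
      using regular_at_common by blast
    define V where "V = U \<inter> V'"
    have V: "zopen V" "V \<subseteq> U" "x \<in> V" "f \<in> regular C V" "g \<in> regular C V"
      using V' U x unfolding V_def by (auto intro: regular_subset)
    have "(\<theta> ^^ m) (\<lambda>y. f y + g y) z = (\<theta> ^^ m) f z + (\<theta> ^^ m) g z" if "z \<in> V" for z m
      using that
    proof (induction m arbitrary: z)
      case (Suc m)
      have \<delta>: "tangent_vector C z (\<lambda>f. \<theta> f z)"
        using vector_field_tangent_vector[OF vector_field_subset[OF \<theta> V(2)] V(1) Suc.prems] .
      have reg: "regular_at C z ((\<theta> ^^ m) f)" "regular_at C z ((\<theta> ^^ m) g)"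
        using vector_field_funpow_regular[OF \<theta> V(1,2)] V Suc.prems by (blast intro: regular_atI)+
      have "eventually (\<lambda>y. (\<theta> ^^ m) (\<lambda>y. f y + g y) y = (\<theta> ^^ m) f y + (\<theta> ^^ m) g y) (near z)"
        using Suc V zopen_subset_points[OF V(1) Suc.prems] by (auto simp: eventually_near)
      from tangent_vector_cong[OF \<delta> regular_at_add[OF reg] this] tangent_vector_add[OF \<delta> reg]
      show ?case by simp
    qed simp
    then show "(\<theta> ^^ ?p) (\<lambda>y. f y + g y) x = (\<theta> ^^ ?p) f x + (\<theta> ^^ ?p) g x" using V by blast
    show "(\<theta> ^^ ?p) (\<lambda>y. f y * g y) x = f x * (\<theta> ^^ ?p) g x + g x * (\<theta> ^^ ?p) f x"
      unfolding vector_field_funpow_mult[OF \<theta> V(1,2,4,5,3)]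
      by (subst sum_choose_CHAR[OF prime refl]) (simp add: mult.commute)
    assume "same_germ C x f g"
    then obtain T where T: "zopen T" "x \<in> T" "\<forall>y\<in>T. f y = g y" unfolding same_germ_def by blast
    have VT: "zopen (V \<inter> T)" using V T by blast
    show "(\<theta> ^^ ?p) f x = (\<theta> ^^ ?p) g x"
      by (rule vector_field_cong[OF \<theta> VT]) (use V T VT in \<open>auto intro: regular_subset\<close>)
  next
    fix c :: 'k
    have "(\<theta> ^^ Suc m) (\<lambda>_. c) z = 0" if "z \<in> U" for m z
      using that
    proof (induction m arbitrary: z)
      case 0
      show ?case using tangent_vector_const[OF vector_field_tangent_vector[OF \<theta> U 0]] by simp
    next
      case (Suc m)
      have \<delta>: "tangent_vector C z (\<lambda>f. \<theta> f z)" using vector_field_tangent_vector[OF \<theta> U Suc.prems] .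
      have zp: "z \<in> points" using zopen_subset_points[OF U Suc.prems] .
      have "eventually (\<lambda>y. (\<theta> ^^ Suc m) (\<lambda>_. c) y = 0) (near z)"
        unfolding eventually_near[OF zp] using Suc U by blast
      from tangent_vector_cong[OF \<delta> regular_at_const[OF zp] this] tangent_vector_const[OF \<delta>]
      show ?case by simp
    qed
    from this[OF x, of "?p - 1"] show "(\<theta> ^^ ?p) (\<lambda>_. c) x = 0" using p by (simp del: funpow.simps)
  qed
qed

end

section \<open>Sections, forms and connections\<close>

locale bundle_connection = curve C
  for C :: "('x, 'k::alg_closed_field) fun_space" +
  fixes E :: "('x, 'k, 'v::ab_group_add) vbundle" and n :: nat and W :: "'x set"
    and nabla :: "('x, 'k, 'v) conn"
  assumes bundle_E: "vector_bundle C E n" and connection: "connection_on C E W nabla"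
    and W_nonempty: "W \<noteq> {}"
begin

sublocale vs: vector_space "scale E"
  using bundle_E by (simp add: vector_bundle_def)

abbreviation scaled :: "'k \<Rightarrow> 'v \<Rightarrow> 'v" (infixr "\<cdot>\<^sub>E" 75) where "a \<cdot>\<^sub>E v \<equiv> scale E a v"

lemma W_zopen: "zopen W"
  using connection by (simp add: connection_on_def)

lemma fibre_subspace: "x \<in> points \<Longrightarrow> vs.subspace (fibre E x)"
  using bundle_E by (simp add: vector_bundle_def)

lemma frame_exists:
  assumes "x \<in> points"
  obtains U e where "x \<in> U" "frame_on C E n U e"
  using bundle_E assms unfolding vector_bundle_def frame_at_def by blast

lemma section_sheaf: "function_sheaf (zariski C) (sections E)"
  using bundle_E by (simp add: vector_bundle_def)

lemma section_cong:
  assumes "zopen U" "s \<in> sections E U" "\<And>x. x \<in> U \<Longrightarrow> s' x = s x"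
  shows "s' \<in> sections E U"
  using section_sheaf[unfolded function_sheaf_def, THEN conjunct1, rule_format, of U s s'] assms by simp

lemma section_subset: "s \<in> sections E U \<Longrightarrow> zopen U \<Longrightarrow> zopen V \<Longrightarrow> V \<subseteq> U \<Longrightarrow> s \<in> sections E V"
  using section_sheaf[unfolded function_sheaf_def, THEN conjunct2, THEN conjunct1, rule_format, of U V s]
  by simp

lemma section_local:
  assumes "zopen U" "\<And>x. x \<in> U \<Longrightarrow> \<exists>V. zopen V \<and> x \<in> V \<and> V \<subseteq> U \<and> s \<in> sections E V"
  shows "s \<in> sections E U"
  using section_sheaf[unfolded function_sheaf_def, THEN conjunct2, THEN conjunct2, rule_format, of U s] assms
  by simp

lemma frame_zopen: "frame_on C E n U e \<Longrightarrow> zopen U"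
  by (simp add: frame_on_def)

lemma frame_section_iff:
  assumes "frame_on C E n U e" "zopen V" "V \<subseteq> U"
  shows "s \<in> sections E V \<longleftrightarrow> (\<exists>f. (\<forall>i<n. f i \<in> regular C V) \<and> (\<forall>x\<in>V. s x = (\<Sum>i<n. f i x \<cdot>\<^sub>E e i x)))"
proof -
  have "\<forall>V s. zopen V \<and> V \<subseteq> U \<longrightarrow> (s \<in> sections E V \<longleftrightarrow>
      (\<exists>f. (\<forall>i<n. f i \<in> regular C V) \<and> (\<forall>x\<in>V. s x = (\<Sum>i<n. f i x \<cdot>\<^sub>E e i x))))"
    using assms(1) unfolding frame_on_def by (elim conjE)
  from this[THEN spec, of V, THEN spec, of s] assms(2,3) show ?thesis by (rule mp[OF _ conjI])
qed

lemma frame_combination_section: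
  assumes "frame_on C E n U e" "zopen V" "V \<subseteq> U" "\<And>i. i < n \<Longrightarrow> f i \<in> regular C V"
  shows "(\<lambda>x. \<Sum>i<n. f i x \<cdot>\<^sub>E e i x) \<in> sections E V"
  using frame_section_iff[OF assms(1-3), of "\<lambda>x. \<Sum>i<n. f i x \<cdot>\<^sub>E e i x"] assms(4) by blast

lemma frame_section_coefficients:
  assumes "frame_on C E n U e" "zopen V" "V \<subseteq> U" "s \<in> sections E V"
  obtains f where "\<And>i. i < n \<Longrightarrow> f i \<in> regular C V" "\<And>x. x \<in> V \<Longrightarrow> s x = (\<Sum>i<n. f i x \<cdot>\<^sub>E e i x)"
  using frame_section_iff[OF assms(1-3), of s] assms(4) by blast

lemma frame_subset:
  assumes e: "frame_on C E n U e" and V: "zopen V" "V \<subseteq> U"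
  shows "frame_on C E n V e"
  unfolding frame_on_def
proof (intro conjI allI impI V(1))
  show "\<forall>x\<in>V. \<forall>v\<in>fibre E x. \<exists>!c. c \<in> extensional {..<n} \<and> v = (\<Sum>i<n. c i \<cdot>\<^sub>E e i x)"
    "\<forall>x\<in>V. \<forall>i<n. e i x \<in> fibre E x"
    using e V(2) unfolding frame_on_def by (elim conjE, simp add: subset_iff)+
  fix T s assume "zopen T \<and> T \<subseteq> V"
  then show "(s \<in> sections E T) =
      (\<exists>f. (\<forall>i<n. f i \<in> regular C T) \<and> (\<forall>x\<in>T. s x = (\<Sum>i<n. f i x \<cdot>\<^sub>E e i x)))"
    using V(2) by (intro frame_section_iff[OF e]) auto
qed

lemma frame_coefficients_unique:
  assumes e: "frame_on C E n U e" and y: "y \<in> U"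
    and eq: "(\<Sum>i<n. a i \<cdot>\<^sub>E e i y) = (\<Sum>i<n. b i \<cdot>\<^sub>E e i y)" and i: "i < n"
  shows "a i = b i"
proof -
  have yp: "y \<in> points" using zopen_subset_points[OF frame_zopen[OF e] y] .
  have fib: "e i y \<in> fibre E y" if "i < n" for i
    using e y that unfolding frame_on_def by (elim conjE) simp
  let ?v = "\<Sum>i<n. a i \<cdot>\<^sub>E e i y"
  have "?v \<in> fibre E y"
    using fibre_subspace[OF yp] fib by (intro vs.subspace_sum vs.subspace_scale) auto
  then have "\<exists>!c. c \<in> extensional {..<n} \<and> ?v = (\<Sum>i<n. c i \<cdot>\<^sub>E e i y)"
    using e y unfolding frame_on_def by (elim conjE) simp
  moreover have "restrict a {..<n} \<in> extensional {..<n} \<and> ?v = (\<Sum>i<n. restrict a {..<n} i \<cdot>\<^sub>E e i y)"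
    by simp
  moreover have "restrict b {..<n} \<in> extensional {..<n} \<and> ?v = (\<Sum>i<n. restrict b {..<n} i \<cdot>\<^sub>E e i y)"
    using eq by simp
  ultimately have "restrict a {..<n} = restrict b {..<n}" by blast
  then have "restrict a {..<n} i = restrict b {..<n} i" by simp
  then show ?thesis using i by simp
qed

lemma frame_member_section:
  assumes e: "frame_on C E n U e" and V: "zopen V" "V \<subseteq> U" and j: "j < n"
  shows "e j \<in> sections E V"
proof (rule section_cong[OF V(1)])
  show "(\<lambda>x. \<Sum>i<n. (if i = j then 1 else 0) \<cdot>\<^sub>E e i x) \<in> sections E V"
    by (rule frame_combination_section[OF e V, of "\<lambda>i _. if i = j then 1 else 0"])
      (auto intro: regular_const[OF V(1)])
  show "e j x = (\<Sum>i<n. (if i = j then 1 else 0) \<cdot>\<^sub>E e i x)" for x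
    using j by (simp add: if_distrib[of "\<lambda>a. a \<cdot>\<^sub>E _"] cong: if_cong)
qed

text \<open>In a frame, the coefficients of the combination are regular; the sheaf condition glues.\<close>

lemma section_linear:
  assumes U: "zopen U" and s: "s \<in> sections E U" "s' \<in> sections E U"
    and f: "f \<in> regular C U" "f' \<in> regular C U"
  shows "(\<lambda>x. f x \<cdot>\<^sub>E s x + f' x \<cdot>\<^sub>E s' x) \<in> sections E U"
proof (rule section_local[OF U])
  fix x assume x: "x \<in> U"
  obtain T e where e: "x \<in> T" "frame_on C E n T e" using frame_exists[OF zopen_subset_points[OF U x]] .
  define V where "V = U \<inter> T"
  have V: "zopen V" "V \<subseteq> U" "V \<subseteq> T" "x \<in> V" using e U x frame_zopen[OF e(2)] by (auto simp: V_def)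
  obtain g where g: "\<And>i. i < n \<Longrightarrow> g i \<in> regular C V" "\<And>x. x \<in> V \<Longrightarrow> s x = (\<Sum>i<n. g i x \<cdot>\<^sub>E e i x)"
    using frame_section_coefficients[OF e(2) V(1,3) section_subset[OF s(1) U V(1,2)]] by blast
  obtain h where h: "\<And>i. i < n \<Longrightarrow> h i \<in> regular C V" "\<And>x. x \<in> V \<Longrightarrow> s' x = (\<Sum>i<n. h i x \<cdot>\<^sub>E e i x)"
    using frame_section_coefficients[OF e(2) V(1,3) section_subset[OF s(2) U V(1,2)]] by blast
  have "(\<lambda>x. \<Sum>i<n. (f x * g i x + f' x * h i x) \<cdot>\<^sub>E e i x) \<in> sections E V"
    using f g h by (intro frame_combination_section[OF e(2) V(1,3)] regular_add regular_mult V)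
      (auto intro: regular_subset[OF _ U V(1,2)])
  then have "(\<lambda>x. f x \<cdot>\<^sub>E s x + f' x \<cdot>\<^sub>E s' x) \<in> sections E V"
    by (rule section_cong[OF V(1)])
      (simp add: g h vs.scale_sum_right vs.scale_left_distrib sum.distrib)
  then show "\<exists>V. zopen V \<and> x \<in> V \<and> V \<subseteq> U \<and> (\<lambda>x. f x \<cdot>\<^sub>E s x + f' x \<cdot>\<^sub>E s' x) \<in> sections E V"
    using V by blast
qed

lemma section_add:
  "zopen U \<Longrightarrow> s \<in> sections E U \<Longrightarrow> s' \<in> sections E U \<Longrightarrow> (\<lambda>x. s x + s' x) \<in> sections E U"
  using section_linear[of U s s' "\<lambda>_. 1" "\<lambda>_. 1"] by (simp add: regular_const)

lemma section_diff:
  "zopen U \<Longrightarrow> s \<in> sections E U \<Longrightarrow> s' \<in> sections E U \<Longrightarrow> (\<lambda>x. s x - s' x) \<in> sections E U"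
  using section_linear[of U s s' "\<lambda>_. 1" "\<lambda>_. -1"] by (simp add: regular_const)

lemma section_scale:
  "zopen U \<Longrightarrow> s \<in> sections E U \<Longrightarrow> f \<in> regular C U \<Longrightarrow> (\<lambda>x. f x \<cdot>\<^sub>E s x) \<in> sections E U"
  using section_linear[of U s s f "\<lambda>_. 0"] by (simp add: regular_const)

lemma section_zero:
  assumes U: "zopen U"
  shows "(\<lambda>_. 0) \<in> sections E U"
proof (rule section_local[OF U])
  fix x assume x: "x \<in> U"
  obtain T e where e: "x \<in> T" "frame_on C E n T e" using frame_exists[OF zopen_subset_points[OF U x]] .
  have V: "zopen (U \<inter> T)" using U frame_zopen[OF e(2)] by blast
  have "(\<lambda>x. \<Sum>i<n. 0 \<cdot>\<^sub>E e i x) \<in> sections E (U \<inter> T)"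
    by (rule frame_combination_section[OF e(2) V, of "\<lambda>_ _. 0"]) (auto intro: regular_const[OF V])
  then show "\<exists>V. zopen V \<and> x \<in> V \<and> V \<subseteq> U \<and> (\<lambda>_. 0) \<in> sections E V"
    using V x e(1) by (intro exI[of _ "U \<inter> T"]) simp
qed

lemma section_sum:
  "zopen U \<Longrightarrow> (\<And>i. i \<in> I \<Longrightarrow> s i \<in> sections E U) \<Longrightarrow> (\<lambda>x. \<Sum>i\<in>I. s i x) \<in> sections E U"
  by (induction I rule: infinite_finite_induct) (simp_all add: section_zero section_add)

lemma section_zero_on_dense:
  assumes U: "zopen U" "s \<in> sections E U" and V: "zopen V" "V \<noteq> {}"
    and 0: "\<And>y. y \<in> V \<inter> U \<Longrightarrow> s y = 0" and x: "x \<in> U"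
  shows "s x = 0"
proof -
  obtain T e where e: "x \<in> T" "frame_on C E n T e" using frame_exists[OF zopen_subset_points[OF U(1) x]] .
  define S where "S = U \<inter> T"
  have S: "zopen S" "S \<subseteq> U" "S \<subseteq> T" "x \<in> S" using e U x frame_zopen[OF e(2)] by (auto simp: S_def)
  obtain g where g: "\<And>i. i < n \<Longrightarrow> g i \<in> regular C S" "\<And>x. x \<in> S \<Longrightarrow> s x = (\<Sum>i<n. g i x \<cdot>\<^sub>E e i x)"
    using frame_section_coefficients[OF e(2) S(1,3) section_subset[OF U(2,1) S(1,2)]] by blast
  have "g i x = 0" if i: "i < n" for i
  proof (rule regular_zero_on_dense[OF S(1) g(1)[OF i] V _ S(4)])
    fix y assume y: "y \<in> V \<inter> S"
    have "(\<Sum>i<n. g i y \<cdot>\<^sub>E e i y) = (\<Sum>i<n. 0 \<cdot>\<^sub>E e i y)" using 0[of y] g(2)[of y] y S by auto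
    then show "g i y = 0" using frame_coefficients_unique[OF e(2), of y "\<lambda>i. g i y" "\<lambda>_. 0"] y S i by auto
  qed
  then show ?thesis using g(2)[OF S(4)] by simp
qed

lemma bundle_form_local:
  assumes "\<omega> \<in> bundle_forms C E U" "x \<in> U"
  obtains V m g s where "zopen V" "x \<in> V" "V \<subseteq> U"
    "\<And>i. i < m \<Longrightarrow> g i \<in> regular C V" "\<And>i. i < m \<Longrightarrow> s i \<in> sections E V"
    "\<And>y \<delta>. y \<in> V \<Longrightarrow> tangent_vector C y \<delta> \<Longrightarrow> \<omega> y \<delta> = (\<Sum>i<(m::nat). \<delta> (g i) \<cdot>\<^sub>E s i y)"
proof -
  have "\<exists>V (m::nat) g s. zopen V \<and> x \<in> V \<and> V \<subseteq> U \<and>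
    (\<forall>i<m. g i \<in> regular C V \<and> s i \<in> sections E V) \<and>
    (\<forall>y\<in>V. \<forall>\<delta>. tangent_vector C y \<delta> \<longrightarrow> \<omega> y \<delta> = (\<Sum>i<m. \<delta> (g i) \<cdot>\<^sub>E s i y))"
    using assms unfolding bundle_forms_def by blast
  then obtain V g s and m :: nat where H: "zopen V" "x \<in> V" "V \<subseteq> U"
    "\<forall>i<m. g i \<in> regular C V \<and> s i \<in> sections E V"
    "\<forall>y\<in>V. \<forall>\<delta>. tangent_vector C y \<delta> \<longrightarrow> \<omega> y \<delta> = (\<Sum>i<m. \<delta> (g i) \<cdot>\<^sub>E s i y)"
    by (elim exE conjE)
  show thesis by (rule that[OF H(1-3), of m g s]) (use H(4,5) in blast)+
qed

lemma bundle_form_contraction: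
  assumes U: "zopen U" and \<omega>: "\<omega> \<in> bundle_forms C E U" and \<theta>: "vector_field C U \<theta>"
  shows "(\<lambda>y. \<omega> y (\<lambda>f. \<theta> f y)) \<in> sections E U"
proof (rule section_local[OF U])
  fix x assume x: "x \<in> U"
  obtain V m g s where V: "zopen V" "x \<in> V" "V \<subseteq> U"
    and g: "\<And>i. i < m \<Longrightarrow> g i \<in> regular C V" and s: "\<And>i. i < m \<Longrightarrow> s i \<in> sections E V"
    and eq: "\<And>y \<delta>. y \<in> V \<Longrightarrow> tangent_vector C y \<delta> \<Longrightarrow> \<omega> y \<delta> = (\<Sum>i<(m::nat). \<delta> (g i) \<cdot>\<^sub>E s i y)"
    using bundle_form_local[OF \<omega> x] by blast
  have "(\<lambda>y. \<Sum>i<m. \<theta> (g i) y \<cdot>\<^sub>E s i y) \<in> sections E V"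
    using g s by (intro section_sum section_scale V vector_field_regular[OF \<theta> V(1,3)]) auto
  then have "(\<lambda>y. \<omega> y (\<lambda>f. \<theta> f y)) \<in> sections E V"
    by (rule section_cong[OF V(1)])
      (use eq vector_field_tangent_vector[OF \<theta> U] V in auto)
  then show "\<exists>V. zopen V \<and> x \<in> V \<and> V \<subseteq> U \<and> (\<lambda>y. \<omega> y (\<lambda>f. \<theta> f y)) \<in> sections E V" using V by blast
qed

text \<open>The tangent spaces in the domain of an etale coordinate are one-dimensional, so a form is determined
  by its contraction with \<open>d/dt\<close>.\<close>

lemma bundle_form_multiple:
  assumes D: "etale_coordinate D t" and \<omega>: "\<omega> \<in> bundle_forms C E U" and y: "y \<in> U" "y \<in> D"
    and \<delta>: "tangent_vector C y \<delta>"
  shows "\<omega> y \<delta> = \<delta> t \<cdot>\<^sub>E \<omega> y (\<lambda>f. partial t f y)"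
proof -
  obtain V m g s where V: "zopen V" "y \<in> V" "V \<subseteq> U"
    and g: "\<And>i. i < m \<Longrightarrow> g i \<in> regular C V" and s: "\<And>i. i < m \<Longrightarrow> s i \<in> sections E V"
    and eq: "\<And>y \<delta>. y \<in> V \<Longrightarrow> tangent_vector C y \<delta> \<Longrightarrow> \<omega> y \<delta> = (\<Sum>i<(m::nat). \<delta> (g i) \<cdot>\<^sub>E s i y)"
    using bundle_form_local[OF \<omega> y(1)] by blast
  have "\<delta> (g i) = partial t (g i) y * \<delta> t" if "i < m" for i
    using V g[OF that] by (intro tangent_vector_eq_partial[OF D y(2) \<delta>]) (blast intro: regular_atI)
  then show ?thesis
    using eq[OF V(2) \<delta>] eq[OF V(2) partial_tangent_vector(1)[OF D y(2)]]
    by (simp add: vs.scale_sum_right mult.commute)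
qed

lemma bundle_form_subset:
  assumes "\<omega> \<in> bundle_forms C E U" "zopen U" "zopen V" "V \<subseteq> U"
  shows "\<omega> \<in> bundle_forms C E V"
  unfolding bundle_forms_def
proof (intro CollectI ballI)
  fix x assume x: "x \<in> V"
  then have "x \<in> U" using assms by blast
  obtain T m g s where T: "zopen T" "x \<in> T" "T \<subseteq> U"
    and g: "\<And>i. i < m \<Longrightarrow> g i \<in> regular C T" and s: "\<And>i. i < m \<Longrightarrow> s i \<in> sections E T"
    and eq: "\<And>y \<delta>. y \<in> T \<Longrightarrow> tangent_vector C y \<delta> \<Longrightarrow> \<omega> y \<delta> = (\<Sum>i<(m::nat). \<delta> (g i) \<cdot>\<^sub>E s i y)"
    using bundle_form_local[OF assms(1) \<open>x \<in> U\<close>] by blast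
  have TV: "zopen (T \<inter> V)" using T assms by blast
  show "\<exists>V' (m::nat) g s. zopen V' \<and> x \<in> V' \<and> V' \<subseteq> V \<and>
    (\<forall>i<m. g i \<in> regular C V' \<and> s i \<in> sections E V') \<and>
    (\<forall>y\<in>V'. \<forall>\<delta>. tangent_vector C y \<delta> \<longrightarrow> \<omega> y \<delta> = (\<Sum>i<m. \<delta> (g i) \<cdot>\<^sub>E s i y))"
    by (rule exI[of _ "T \<inter> V"], rule exI[of _ m], rule exI[of _ g], rule exI[of _ s])
      (use TV T(2) x eq regular_subset[OF g T(1) TV] section_subset[OF s T(1) TV] in auto)
qed

lemma connectionD:
  assumes "zopen U" "U \<subseteq> W"
  shows nabla_form: "s \<in> sections E U \<Longrightarrow> nabla s \<in> bundle_forms C E U"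
    and nabla_cong: "s \<in> sections E U \<Longrightarrow> s' \<in> sections E U \<Longrightarrow> (\<And>y. y \<in> U \<Longrightarrow> s y = s' y) \<Longrightarrow>
      x \<in> U \<Longrightarrow> tangent_vector C x \<delta> \<Longrightarrow> nabla s x \<delta> = nabla s' x \<delta>"
    and nabla_add: "s \<in> sections E U \<Longrightarrow> s' \<in> sections E U \<Longrightarrow>
      x \<in> U \<Longrightarrow> tangent_vector C x \<delta> \<Longrightarrow> nabla (\<lambda>y. s y + s' y) x \<delta> = nabla s x \<delta> + nabla s' x \<delta>"
    and nabla_leibniz: "f \<in> regular C U \<Longrightarrow> s \<in> sections E U \<Longrightarrow>
      x \<in> U \<Longrightarrow> tangent_vector C x \<delta> \<Longrightarrow> nabla (\<lambda>y. f y \<cdot>\<^sub>E s y) x \<delta> = \<delta> f \<cdot>\<^sub>E s x + f x \<cdot>\<^sub>E nabla s x \<delta>"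
proof -
  note D = connection[unfolded connection_on_def, THEN conjunct2, THEN spec, of U, THEN mp, OF conjI[OF assms]]
  show "s \<in> sections E U \<Longrightarrow> nabla s \<in> bundle_forms C E U" using D[THEN conjunct1] by blast
  show "s \<in> sections E U \<Longrightarrow> s' \<in> sections E U \<Longrightarrow> (\<And>y. y \<in> U \<Longrightarrow> s y = s' y) \<Longrightarrow>
      x \<in> U \<Longrightarrow> tangent_vector C x \<delta> \<Longrightarrow> nabla s x \<delta> = nabla s' x \<delta>"
    using D[THEN conjunct2, THEN conjunct1, rule_format, of s s' x \<delta>] by blast
  show "s \<in> sections E U \<Longrightarrow> s' \<in> sections E U \<Longrightarrow>
      x \<in> U \<Longrightarrow> tangent_vector C x \<delta> \<Longrightarrow> nabla (\<lambda>y. s y + s' y) x \<delta> = nabla s x \<delta> + nabla s' x \<delta>"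
    using D[THEN conjunct2, THEN conjunct2, THEN conjunct1, rule_format, of s s' x \<delta>] by blast
  show "f \<in> regular C U \<Longrightarrow> s \<in> sections E U \<Longrightarrow>
      x \<in> U \<Longrightarrow> tangent_vector C x \<delta> \<Longrightarrow> nabla (\<lambda>y. f y \<cdot>\<^sub>E s y) x \<delta> = \<delta> f \<cdot>\<^sub>E s x + f x \<cdot>\<^sub>E nabla s x \<delta>"
    using D[THEN conjunct2, THEN conjunct2, THEN conjunct2, rule_format, of f s x \<delta>] by blast
qed

lemma nabla_zero:
  assumes U: "zopen U" "U \<subseteq> W" and x: "x \<in> U" and \<delta>: "tangent_vector C x \<delta>"
  shows "nabla (\<lambda>_. 0) x \<delta> = 0"
  using nabla_add[OF U section_zero[OF U(1)] section_zero[OF U(1)] x \<delta>] by simp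

lemma nabla_sum:
  assumes U: "zopen U" "U \<subseteq> W" and x: "x \<in> U" and \<delta>: "tangent_vector C x \<delta>"
    and f: "\<And>k. k \<in> K \<Longrightarrow> f k \<in> regular C U" and s: "\<And>k. k \<in> K \<Longrightarrow> s k \<in> sections E U"
  shows "nabla (\<lambda>y. \<Sum>k\<in>K. f k y \<cdot>\<^sub>E s k y) x \<delta> = (\<Sum>k\<in>K. \<delta> (f k) \<cdot>\<^sub>E s k x + f k x \<cdot>\<^sub>E nabla (s k) x \<delta>)"
  using f s
proof (induction K rule: infinite_finite_induct)
  case (insert k K)
  have "nabla (\<lambda>y. f k y \<cdot>\<^sub>E s k y + (\<Sum>k\<in>K. f k y \<cdot>\<^sub>E s k y)) x \<delta> =
      nabla (\<lambda>y. f k y \<cdot>\<^sub>E s k y) x \<delta> + nabla (\<lambda>y. \<Sum>k\<in>K. f k y \<cdot>\<^sub>E s k y) x \<delta>"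
    using insert.prems by (intro nabla_add[OF U _ _ x \<delta>] section_sum section_scale U(1)) auto
  then show ?case using insert by (simp add: nabla_leibniz[OF U _ _ x \<delta>])
qed (simp_all add: nabla_zero[OF U x \<delta>])

lemma covariant_derivative_section:
  assumes "zopen U" "U \<subseteq> W" "vector_field C U \<theta>" "s \<in> sections E U"
  shows "covariant_derivative nabla \<theta> s \<in> sections E U"
  using bundle_form_contraction[OF assms(1) nabla_form[OF assms(1,2,4)] assms(3)]
  by (simp add: covariant_derivative_def[abs_def])

end

section \<open>The p-curvature near a logarithmic pole\<close>

context curve
begin

text \<open>The vector field \<open>t d/dt\<close>.\<close>

definition euler_field :: "('x \<Rightarrow> 'k) \<Rightarrow> ('x \<Rightarrow> 'k) \<Rightarrow> 'x \<Rightarrow> 'k" where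
  "euler_field t f y = t y * partial t f y"

text \<open>The counterpart of \<open>log_connection\<close> for columns of functions on the curve.\<close>

definition log_derivative ::
  "nat \<Rightarrow> ('x \<Rightarrow> 'k) \<Rightarrow> (nat \<Rightarrow> nat \<Rightarrow> 'x \<Rightarrow> 'k) \<Rightarrow> (nat \<Rightarrow> 'x \<Rightarrow> 'k) \<Rightarrow> nat \<Rightarrow> 'x \<Rightarrow> 'k" where
  "log_derivative n t b v i = (\<lambda>y. euler_field t (v i) y + (\<Sum>l<n. b i l y * v l y))"

lemma euler_field_tangent_vector:
  assumes "etale_coordinate D t" "y \<in> D"
  shows "tangent_vector C y (\<lambda>f. euler_field t f y)"
  using tangent_vector_scale[OF partial_tangent_vector(1)[OF assms], of "t y"]
  by (simp add: euler_field_def)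

lemma partial_vector_field:
  assumes D: "etale_coordinate D t"
  shows "vector_field C D (partial t)"
  by (intro vector_fieldI partial_regular[OF D] partial_tangent_vector(1)[OF D])

lemma euler_vector_field:
  assumes D: "etale_coordinate D t"
  shows "vector_field C D (euler_field t)"
proof (intro vector_fieldI euler_field_tangent_vector[OF D])
  fix V f assume V: "zopen V" "V \<subseteq> D" "f \<in> regular C V"
  have "(\<lambda>y. t y * partial t f y) \<in> regular C V"
    by (intro regular_mult V partial_regular[OF D]
        regular_subset[OF etale_coordinate_regular[OF D] etale_coordinate_zopen[OF D]])
  then show "euler_field t f \<in> regular C V" by (simp add: euler_field_def[abs_def])
qed

lemma euler_field_coordinate: "etale_coordinate D t \<Longrightarrow> y \<in> D \<Longrightarrow> euler_field t t y = t y"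
  by (simp add: euler_field_def partial_tangent_vector(2))

lemma euler_field_funpow_coordinate:
  assumes D: "etale_coordinate D t" and y: "y \<in> D"
  shows "(euler_field t ^^ m) t y = t y"
proof (induction m)
  case (Suc m)
  have "(euler_field t ^^ m) (euler_field t t) y = (euler_field t ^^ m) t y"
    by (rule vector_field_cong[OF euler_vector_field[OF D] etale_coordinate_zopen[OF D] subset_refl
          etale_coordinate_regular[OF D] _ y]) (rule euler_field_coordinate[OF D])
  then show ?case using Suc by (simp add: funpow_swap1)
qed simp

lemma log_derivative_regular:
  assumes D: "etale_coordinate D t" and V: "zopen V" "V \<subseteq> D"
    and b: "\<And>i l. i < n \<Longrightarrow> l < n \<Longrightarrow> b i l \<in> regular C D"
    and v: "\<And>i. i < n \<Longrightarrow> v i \<in> regular C V" and i: "i < n"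
  shows "log_derivative n t b v i \<in> regular C V"
  unfolding log_derivative_def
  using v b i
  by (intro regular_add regular_sum regular_mult V vector_field_regular[OF euler_vector_field[OF D]])
    (auto intro: regular_subset[OF _ etale_coordinate_zopen[OF D] V])

lemma log_derivative_funpow_regular:
  assumes D: "etale_coordinate D t" and V: "zopen V" "V \<subseteq> D"
    and b: "\<And>i l. i < n \<Longrightarrow> l < n \<Longrightarrow> b i l \<in> regular C D"
    and v: "\<And>i. i < n \<Longrightarrow> v i \<in> regular C V" and i: "i < n"
  shows "(log_derivative n t b ^^ k) v i \<in> regular C V"
  using i
proof (induction k arbitrary: i)
  case (Suc k)
  have "log_derivative n t b ((log_derivative n t b ^^ k) v) i \<in> regular C V"
    by (rule log_derivative_regular[OF D V b Suc.IH Suc.prems])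
  then show ?case by simp
qed (use v in simp)

lemma taylor_expansion_log_derivative:
  assumes D: "etale_coordinate D t" and x: "x \<in> D"
    and b: "\<And>i l. i < n \<Longrightarrow> l < n \<Longrightarrow> taylor_expansion C x t (b i l) (B i l)"
    and v: "\<And>i. i < n \<Longrightarrow> taylor_expansion C x t (v i) (F i)" and i: "i < n"
  shows "taylor_expansion C x t ((log_derivative n t b ^^ k) v i) ((log_connection n B ^^ k) F i)"
  using i
proof (induction k arbitrary: i)
  case (Suc k)
  define w where "w = (log_derivative n t b ^^ k) v"
  define G where "G = (log_connection n B ^^ k) F"
  have IH: "taylor_expansion C x t (w i) (G i)" if "i < n" for i
    using Suc.IH[OF that] by (simp add: w_def G_def)
  have xp: "x \<in> points" using zopen_subset_points[OF etale_coordinate_zopen[OF D] x] .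
  have tr: "regular_at C x t" using etale_coordinate_regular[OF D] etale_coordinate_zopen[OF D] x
    by (blast intro: regular_atI)
  have "taylor_expansion C x t (\<lambda>y. t y * partial t (w i) y + (\<Sum>l<n. b i l y * w l y))
      (fps_X * fps_deriv (G i) + (\<Sum>l<n. B i l * G l))"
    using Suc.prems by (intro taylor_expansion_add taylor_expansion_mult[OF tr] taylor_expansion_sum xp
        taylor_expansion_coordinate[OF tr] taylor_expansion_partial[OF D x] b IH) auto
  then have "taylor_expansion C x t (log_derivative n t b w i) (log_connection n B G i)"
    by (simp add: log_derivative_def euler_field_def log_connection_def)
  then show ?case by (simp add: w_def G_def)
qed (use v in simp)

lemma taylor_expansion_std_basis:
  "x \<in> points \<Longrightarrow> taylor_expansion C x t (\<lambda>_. std_basis j i) (std_basis j i)"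
  using taylor_expansion_const[of x t "std_basis j i"] by (simp add: std_basis_def split: if_splits)

end

context bundle_connection
begin

text \<open>
  On \<open>D\<close>, the connection has the matrix \<open>b dt/t\<close> with respect to the frame \<open>e\<close>. The equation is stated without
  a denominator, at the points of \<open>D\<close> where \<open>\<nabla>\<close> is defined, and for the contraction with \<open>d/dt\<close>.
\<close>

definition log_form :: "'x set \<Rightarrow> ('x \<Rightarrow> 'k) \<Rightarrow> (nat \<Rightarrow> 'x \<Rightarrow> 'v) \<Rightarrow> (nat \<Rightarrow> nat \<Rightarrow> 'x \<Rightarrow> 'k) \<Rightarrow> bool" where
  "log_form D t e b \<longleftrightarrow> etale_coordinate D t \<and> frame_on C E n D e \<and>
    (\<forall>i<n. \<forall>j<n. b i j \<in> regular C D) \<and>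
    (\<forall>y\<in>D \<inter> W. \<forall>j<n. t y \<cdot>\<^sub>E nabla (e j) y (\<lambda>f. partial t f y) = (\<Sum>i<n. b i j y \<cdot>\<^sub>E e i y))"

lemma log_formD:
  assumes "log_form D t e b"
  shows "etale_coordinate D t" "frame_on C E n D e" "zopen D"
    "i < n \<Longrightarrow> j < n \<Longrightarrow> b i j \<in> regular C D"
    "y \<in> D \<Longrightarrow> y \<in> W \<Longrightarrow> j < n \<Longrightarrow>
      t y \<cdot>\<^sub>E nabla (e j) y (\<lambda>f. partial t f y) = (\<Sum>i<n. b i j y \<cdot>\<^sub>E e i y)"
  using assms etale_coordinate_zopen by (auto simp: log_form_def)

lemma nabla_multiple:
  assumes D: "etale_coordinate D t" and U: "zopen U" "U \<subseteq> W" and s: "s \<in> sections E U"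
    and y: "y \<in> U" "y \<in> D" and \<delta>: "tangent_vector C y \<delta>"
  shows "nabla s y \<delta> = \<delta> t \<cdot>\<^sub>E nabla s y (\<lambda>f. partial t f y)"
  by (rule bundle_form_multiple[OF D nabla_form[OF U s] y \<delta>])

lemma covariant_derivative_euler:
  assumes L: "log_form D t e b" and V: "zopen V" "V \<subseteq> D" "V \<subseteq> W"
    and v: "\<And>i. i < n \<Longrightarrow> v i \<in> regular C V" and y: "y \<in> V"
  shows "covariant_derivative nabla (euler_field t) (\<lambda>y. \<Sum>i<n. v i y \<cdot>\<^sub>E e i y) y =
    (\<Sum>i<n. log_derivative n t b v i y \<cdot>\<^sub>E e i y)"
proof -
  note D = log_formD[OF L]
  have yD: "y \<in> D" "y \<in> W" using y V by auto
  let ?\<delta> = "\<lambda>f. euler_field t f y"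
  have \<delta>: "tangent_vector C y ?\<delta>" by (rule euler_field_tangent_vector[OF D(1) yD(1)])
  have e: "e j \<in> sections E V" if "j < n" for j using frame_member_section[OF D(2) V(1,2) that] .
  have ne: "nabla (e j) y ?\<delta> = (\<Sum>i<n. b i j y \<cdot>\<^sub>E e i y)" if "j < n" for j
    using nabla_multiple[OF D(1) V(1,3) e[OF that] y yD(1) \<delta>] D(5)[OF yD that]
    by (simp add: euler_field_coordinate[OF D(1) yD(1)])
  have "nabla (\<lambda>y. \<Sum>j<n. v j y \<cdot>\<^sub>E e j y) y ?\<delta>
      = (\<Sum>j<n. euler_field t (v j) y \<cdot>\<^sub>E e j y + v j y \<cdot>\<^sub>E nabla (e j) y ?\<delta>)"
    by (rule nabla_sum[OF V(1,3) y \<delta>]) (use v e in auto)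
  also have "\<dots> = (\<Sum>j<n. euler_field t (v j) y \<cdot>\<^sub>E e j y) + (\<Sum>j<n. \<Sum>i<n. (b i j y * v j y) \<cdot>\<^sub>E e i y)"
    by (simp add: sum.distrib ne vs.scale_sum_right mult.commute)
  also have "(\<Sum>j<n. \<Sum>i<n. (b i j y * v j y) \<cdot>\<^sub>E e i y) = (\<Sum>i<n. \<Sum>j<n. (b i j y * v j y) \<cdot>\<^sub>E e i y)"
    by (rule sum.swap)
  also have "(\<Sum>j<n. euler_field t (v j) y \<cdot>\<^sub>E e j y) + \<dots> = (\<Sum>i<n. log_derivative n t b v i y \<cdot>\<^sub>E e i y)"
    by (simp add: log_derivative_def vs.scale_left_distrib vs.scale_sum_left sum.distrib)
  finally show ?thesis by (simp add: covariant_derivative_def)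
qed

lemma covariant_derivative_funpow_euler:
  assumes L: "log_form D t e b" and V: "zopen V" "V \<subseteq> D" "V \<subseteq> W" and j: "j < n" and y: "y \<in> V"
  shows "(covariant_derivative nabla (euler_field t) ^^ k) (e j) y =
    (\<Sum>i<n. (log_derivative n t b ^^ k) (\<lambda>i _. std_basis j i) i y \<cdot>\<^sub>E e i y)"
  using y
proof (induction k arbitrary: y)
  case 0
  have "(\<Sum>i<n. std_basis j i \<cdot>\<^sub>E e i y) = (\<Sum>i<n. if i = j then e i y else 0)"
    by (intro sum.cong) (auto simp: std_basis_def)
  then show ?case using j by simp
next
  case (Suc k)
  note D = log_formD[OF L]
  let ?v = "(log_derivative n t b ^^ k) (\<lambda>i _. std_basis j i)"
  let ?s = "(covariant_derivative nabla (euler_field t) ^^ k) (e j)"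
  have v: "?v i \<in> regular C V" if "i < n" for i
    by (rule log_derivative_funpow_regular[OF D(1) V(1,2) D(4)]) (use that in \<open>auto intro: regular_const V\<close>)
  have s': "(\<lambda>y. \<Sum>i<n. ?v i y \<cdot>\<^sub>E e i y) \<in> sections E V"
    by (rule frame_combination_section[OF D(2) V(1,2) v])
  then have s: "?s \<in> sections E V" by (rule section_cong[OF V(1)]) (use Suc.IH in simp)
  have \<delta>: "tangent_vector C y (\<lambda>f. euler_field t f y)"
    by (rule euler_field_tangent_vector[OF D(1)]) (use Suc.prems V in auto)
  have "covariant_derivative nabla (euler_field t) ?s y =
      covariant_derivative nabla (euler_field t) (\<lambda>y. \<Sum>i<n. ?v i y \<cdot>\<^sub>E e i y) y"
    using nabla_cong[OF V(1,3) s s' Suc.IH Suc.prems \<delta>]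
    by (simp only: covariant_derivative_def[of nabla "euler_field t" ?s y]
        covariant_derivative_def[of nabla "euler_field t" "\<lambda>y. \<Sum>i<n. ?v i y \<cdot>\<^sub>E e i y" y])
  also have "\<dots> = (\<Sum>i<n. log_derivative n t b ?v i y \<cdot>\<^sub>E e i y)"
    by (rule covariant_derivative_euler[OF L V v Suc.prems])
  finally show ?case by simp
qed

text \<open>
  The vector field \<open>\<theta> = t d/dt\<close> and its p-th power are both tangent vectors with the value \<open>t\<close> at the
  coordinate, so they coincide. The p-curvature at \<open>\<theta>\<close> is therefore the difference of the two sides,
  first where \<open>\<nabla>\<close> is defined, then on \<open>D\<close> by density.
\<close>

lemma p_curvature_zero_imp_log_derivative:
  assumes p: "CHAR('k) > 0" and L: "log_form D t e b" and D0: "D \<noteq> {}"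
    and pc: "vanishing_p_curvature C E W nabla" and ij: "i < n" "j < n" and y: "y \<in> D"
  shows "(log_derivative n t b ^^ CHAR('k)) (\<lambda>i _. std_basis j i) i y =
    log_derivative n t b (\<lambda>i _. std_basis j i) i y"
proof -
  note D = log_formD[OF L]
  let ?p = "CHAR('k)" and ?\<theta> = "euler_field t" and ?cd = "covariant_derivative nabla (euler_field t)"
  let ?v = "\<lambda>k. (log_derivative n t b ^^ k) (\<lambda>i _. std_basis j i)"
  define V where "V = D \<inter> W"
  have V: "zopen V" "V \<subseteq> D" "V \<subseteq> W" "V \<noteq> {}"
    using D(3) W_zopen D0 W_nonempty zopens_meet by (auto simp: V_def)
  have reg: "?v k i \<in> regular C D" for k
    by (rule log_derivative_funpow_regular[OF D(1,3) subset_refl D(4)])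
      (use ij in \<open>auto intro: regular_const D(3)\<close>)
  have \<theta>: "vector_field C V ?\<theta>" using vector_field_subset[OF euler_vector_field[OF D(1)] V(2)] .
  have "?v ?p i z = ?v 1 i z" if z: "z \<in> V" for z
  proof (rule frame_coefficients_unique[OF D(2) _ _ ij(1), where a = "\<lambda>i. ?v ?p i z"])
    show zD: "z \<in> D" using z V by auto
    have e: "e j \<in> sections E V" using frame_member_section[OF D(2) V(1,2) ij(2)] .
    let ?\<delta> = "\<lambda>f. (?\<theta> ^^ ?p) f z"
    have \<delta>: "tangent_vector C z ?\<delta>"
      by (rule vector_field_tangent_vector[OF vector_field_power_CHAR[OF \<theta> V(1) p] V(1) z])
    have "covariant_derivative nabla (?\<theta> ^^ ?p) (e j) z = nabla (e j) z ?\<delta>"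
      by (simp add: covariant_derivative_def)
    also have "\<dots> = nabla (e j) z (\<lambda>f. ?\<theta> f z)"
      unfolding nabla_multiple[OF D(1) V(1,3) e z zD \<delta>]
        nabla_multiple[OF D(1) V(1,3) e z zD euler_field_tangent_vector[OF D(1) zD]]
        euler_field_funpow_coordinate[OF D(1) zD] euler_field_coordinate[OF D(1) zD] ..
    also have "\<dots> = (?cd ^^ 1) (e j) z" by (simp add: covariant_derivative_def)
    finally have "covariant_derivative nabla (?\<theta> ^^ ?p) (e j) z = (?cd ^^ 1) (e j) z" .
    moreover have "(?cd ^^ ?p) (e j) z - covariant_derivative nabla (?\<theta> ^^ ?p) (e j) z = 0"
      using pc V(1,3) \<theta> e z unfolding vanishing_p_curvature_def by blast
    ultimately have "(?cd ^^ ?p) (e j) z = (?cd ^^ 1) (e j) z" by simp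
    then show "(\<Sum>i<n. ?v ?p i z \<cdot>\<^sub>E e i z) = (\<Sum>i<n. ?v 1 i z \<cdot>\<^sub>E e i z)"
      unfolding covariant_derivative_funpow_euler[OF L V(1-3) ij(2) z] .
  qed
  then have "?v ?p i y = ?v 1 i y"
    by (intro regular_eq_on_dense[OF D(3) reg reg V(1,4) _ y]) auto
  then show ?thesis by simp
qed

text \<open>On sections \<open>\<Sum> f\<^sub>k h\<^sub>k\<close> with horizontal \<open>h\<^sub>k\<close>, the covariant derivative along any vector field acts
  on the coefficients \<open>f\<^sub>k\<close> only.\<close>

lemma horizontal_span_p_curvature:
  assumes p: "CHAR('k) > 0" and V: "zopen V" "V \<subseteq> W" and \<theta>: "vector_field C V \<theta>"
    and h: "\<And>k. k \<in> K \<Longrightarrow> h k \<in> sections E V"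
    and flat: "\<And>k y \<delta>. k \<in> K \<Longrightarrow> y \<in> V \<Longrightarrow> tangent_vector C y \<delta> \<Longrightarrow> nabla (h k) y \<delta> = 0"
    and f: "\<And>k. k \<in> K \<Longrightarrow> f k \<in> regular C V"
    and s: "\<And>y. y \<in> V \<Longrightarrow> s y = (\<Sum>k\<in>K. f k y \<cdot>\<^sub>E h k y)" and y: "y \<in> V"
  shows "(covariant_derivative nabla \<theta> ^^ CHAR('k)) s y =
    covariant_derivative nabla (\<theta> ^^ CHAR('k)) s y"
proof -
  have step: "covariant_derivative nabla \<eta> s' y = (\<Sum>k\<in>K. \<eta> (g k) y \<cdot>\<^sub>E h k y)"
    if \<eta>: "vector_field C V \<eta>" and g: "\<And>k. k \<in> K \<Longrightarrow> g k \<in> regular C V"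
      and s': "\<And>y. y \<in> V \<Longrightarrow> s' y = (\<Sum>k\<in>K. g k y \<cdot>\<^sub>E h k y)" and y: "y \<in> V" for \<eta> g s' y
  proof -
    have \<delta>: "tangent_vector C y (\<lambda>f. \<eta> f y)" using vector_field_tangent_vector[OF \<eta> V(1) y] .
    have sec: "(\<lambda>y. \<Sum>k\<in>K. g k y \<cdot>\<^sub>E h k y) \<in> sections E V" by (intro section_sum section_scale V(1) h g)
    have "s' \<in> sections E V" by (rule section_cong[OF V(1) sec]) (rule s')
    then have "covariant_derivative nabla \<eta> s' y = nabla (\<lambda>y. \<Sum>k\<in>K. g k y \<cdot>\<^sub>E h k y) y (\<lambda>f. \<eta> f y)"
      unfolding covariant_derivative_def by (rule nabla_cong[OF V _ sec s' y \<delta>])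
    also have "\<dots> = (\<Sum>k\<in>K. \<eta> (g k) y \<cdot>\<^sub>E h k y + g k y \<cdot>\<^sub>E nabla (h k) y (\<lambda>f. \<eta> f y))"
      by (rule nabla_sum[OF V y \<delta> g h])
    also have "\<dots> = (\<Sum>k\<in>K. \<eta> (g k) y \<cdot>\<^sub>E h k y)"
      using flat[OF _ y \<delta>] by simp
    finally show ?thesis .
  qed
  have "(covariant_derivative nabla \<theta> ^^ m) s y = (\<Sum>k\<in>K. (\<theta> ^^ m) (f k) y \<cdot>\<^sub>E h k y)" if "y \<in> V" for m y
    using that
  proof (induction m arbitrary: y)
    case (Suc m)
    show ?case
      using step[OF \<theta> vector_field_funpow_regular[OF \<theta> V(1) subset_refl f] Suc.IH Suc.prems] by simp
  qed (use s in simp)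
  moreover have "covariant_derivative nabla (\<theta> ^^ CHAR('k)) s y = (\<Sum>k\<in>K. (\<theta> ^^ CHAR('k)) (f k) y \<cdot>\<^sub>E h k y)"
    by (rule step[OF vector_field_power_CHAR[OF \<theta> V(1) p] f s y])
  ultimately show ?thesis using y by simp
qed

text \<open>
  The eigenprojections split each \<open>e\<^sub>j\<close> into eigenvectors \<open>u j m\<close> of \<open>\<nabla>\<close> along \<open>t d/dt\<close>. Where \<open>t\<close> is
  invertible, their multiples by \<open>t\<^sup>p\<^sup>-\<^sup>m\<close> are horizontal and span all sections, so the p-curvature
  vanishes there for every vector field, and then everywhere by density.
\<close>

lemma log_derivative_imp_p_curvature_zero:
  assumes p: "CHAR('k) > 0" and L: "log_form D t e b"
    and t0: "y0 \<in> D" "t y0 \<noteq> 0"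
    and root: "\<And>i j y. i < n \<Longrightarrow> j < n \<Longrightarrow> y \<in> D \<Longrightarrow>
      (log_derivative n t b ^^ CHAR('k)) (\<lambda>i _. std_basis j i) i y =
      log_derivative n t b (\<lambda>i _. std_basis j i) i y"
  shows "vanishing_p_curvature C E W nabla"
proof -
  note D = log_formD[OF L]
  let ?p = "CHAR('k)"
  have tD: "t \<in> regular C D" by (rule etale_coordinate_regular[OF D(1)])
  define V where "V = {y\<in>D. t y \<noteq> 0} \<inter> W"
  have zt: "zopen {y\<in>D. t y \<noteq> 0}" by (rule regular_nonvanishing_zopen[OF D(3) tD])
  have V: "zopen V" "V \<subseteq> D" "V \<subseteq> W" "V \<noteq> {}"
    using zt W_zopen W_nonempty t0 zopens_meet[OF zt W_zopen] by (auto simp: V_def)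
  have tV: "t y \<noteq> 0" if "y \<in> V" for y using that by (simp add: V_def)
  have tVreg: "t \<in> regular C V" using regular_subset[OF tD D(3) V(1,2)] .
  obtain c :: "nat \<Rightarrow> nat \<Rightarrow> 'k" where
    c1: "\<And>a m. a ?p = a 1 \<Longrightarrow> (\<Sum>k<?p. c m k * a (Suc k)) = of_nat m * (\<Sum>k<?p. c m k * a k)" and
    c2: "\<And>a. (\<Sum>m<?p. \<Sum>k<?p. c m k * a k) = a 0"
    by (rule eigenprojection_coefficients[OF refl p]) (erule that; assumption)
  define w where "w j k = (log_derivative n t b ^^ k) (\<lambda>i _. std_basis j i)" for j k
  define u where "u j m i = (\<lambda>y. \<Sum>k<?p. c m k * w j k i y)" for j m i
  have w: "w j k i \<in> regular C V" if "i < n" for i j k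
    unfolding w_def
    by (rule log_derivative_funpow_regular[OF D(1) V(1,2) D(4)]) (use that in \<open>auto intro: regular_const V\<close>)
  have u: "u j m i \<in> regular C V" if "i < n" for i j m
    unfolding u_def by (intro regular_sum regular_mult regular_const V(1) w that)
  \<comment> \<open>The factor has eigenvalue \<open>p - m = -m\<close> under \<open>t d/dt\<close>, which cancels the eigenvalue \<open>m\<close> of \<open>u j m\<close>;
    the exponent \<open>p - m\<close> is positive, so \<open>g\<close> is polynomial in \<open>t\<close> and \<open>u\<close>.\<close>
  define g where "g j m i = (\<lambda>y. t y ^ (?p - m) * u j m i y)" for j m i
  have g: "g j m i \<in> regular C V" if "i < n" for i j m
    unfolding g_def by (intro regular_mult regular_power V(1) tVreg u that)
  have g_flat: "log_derivative n t b (g j m) i y = 0" if i: "i < n" and j: "j < n" and m: "m < ?p" and y: "y \<in> V"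
    for i j m y
  proof -
    have yD: "y \<in> D" and yp: "y \<in> points" using y V zopen_subset_points[OF V(1) y] by auto
    note \<delta> = euler_field_tangent_vector[OF D(1) yD]
    have at: "regular_at C y f" if "f \<in> regular C V" for f using that V(1) y by (blast intro: regular_atI)
    have ut: "euler_field t (u j m i) y = (\<Sum>k<?p. c m k * euler_field t (w j k i) y)"
      unfolding u_def
      using tangent_vector_sum[OF \<delta> yp, of "{..<?p}" "\<lambda>k y. c m k * w j k i y"] at[OF w[OF i]] yp
      by (simp add: tangent_vector_mult[OF \<delta>] tangent_vector_const[OF \<delta>] regular_at_mult regular_at_const)
    have "euler_field t (u j m i) y + (\<Sum>l<n. b i l y * u j m l y)
        = (\<Sum>k<?p. c m k * euler_field t (w j k i) y) + (\<Sum>k<?p. \<Sum>l<n. c m k * (b i l y * w j k l y))"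
      unfolding ut unfolding u_def sum_distrib_left by (subst (2) sum.swap) (simp add: mult_ac)
    also have "\<dots> = (\<Sum>k<?p. c m k * w j (Suc k) i y)"
      by (simp add: w_def log_derivative_def sum_distrib_left distrib_left sum.distrib)
    also have "\<dots> = of_nat m * u j m i y"
      unfolding u_def by (rule c1[of "\<lambda>k. w j k i y"]) (use root[OF i j yD] in \<open>simp add: w_def\<close>)
    finally have eigen: "euler_field t (u j m i) y + (\<Sum>l<n. b i l y * u j m l y) = of_nat m * u j m i y" .
    let ?q = "?p - m"
    have tq: "t y ^ (?q - 1) * t y = t y ^ ?q" using m by (cases ?q) auto
    have "euler_field t (\<lambda>y. t y ^ ?q) y = of_nat ?q * t y ^ ?q"
      using tangent_vector_power[OF \<delta> at[OF tVreg], of ?q] tq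
      by (simp add: euler_field_coordinate[OF D(1) yD] mult.assoc)
    then have "euler_field t (g j m i) y = t y ^ ?q * euler_field t (u j m i) y + u j m i y * (of_nat ?q * t y ^ ?q)"
      unfolding g_def using tangent_vector_mult[OF \<delta> regular_at_power[OF at[OF tVreg]] at[OF u[OF i]]] by simp
    then have "log_derivative n t b (g j m) i y =
        t y ^ ?q * (euler_field t (u j m i) y + (\<Sum>l<n. b i l y * u j m l y)) + u j m i y * (of_nat ?q * t y ^ ?q)"
      by (simp add: log_derivative_def g_def sum_distrib_left distrib_left mult_ac)
    also have "\<dots> = (of_nat m + of_nat ?q) * (t y ^ ?q * u j m i y)"
      unfolding eigen by (simp add: algebra_simps)
    also have "(of_nat m + of_nat ?q :: 'k) = of_nat ?p" using m by (simp add: of_nat_add[symmetric] del: of_nat_add)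
    finally show ?thesis by simp
  qed
  define h where "h = (\<lambda>(j, m) y. \<Sum>i<n. g j m i y \<cdot>\<^sub>E e i y)"
  let ?K = "{..<n} \<times> {..<?p}"
  have h: "h k \<in> sections E V" for k
    unfolding h_def by (cases k) (auto intro: frame_combination_section[OF D(2) V(1,2)] g)
  have flat: "nabla (h k) y \<delta> = 0" if k: "k \<in> ?K" and y: "y \<in> V" and \<delta>: "tangent_vector C y \<delta>" for k y \<delta>
  proof -
    obtain j m where jm: "k = (j, m)" "j < n" "m < ?p" using k by auto
    have yD: "y \<in> D" using y V by auto
    have "t y \<cdot>\<^sub>E nabla (h k) y (\<lambda>f. partial t f y) = covariant_derivative nabla (euler_field t) (h k) y"
      using nabla_multiple[OF D(1) V(1,3) h y yD euler_field_tangent_vector[OF D(1) yD]]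
      by (simp add: covariant_derivative_def euler_field_coordinate[OF D(1) yD])
    also have "\<dots> = (\<Sum>i<n. log_derivative n t b (g j m) i y \<cdot>\<^sub>E e i y)"
      unfolding h_def jm prod.case by (rule covariant_derivative_euler[OF L V(1-3) g y])
    also have "\<dots> = 0" using g_flat jm y by simp
    finally have "nabla (h k) y (\<lambda>f. partial t f y) = 0" using tV[OF y] by simp
    then show ?thesis using nabla_multiple[OF D(1) V(1,3) h y yD \<delta>] by simp
  qed
  have on_V: "(covariant_derivative nabla \<theta> ^^ ?p) s y = covariant_derivative nabla (\<theta> ^^ ?p) s y"
    if T: "zopen T" "T \<subseteq> V" and \<theta>: "vector_field C T \<theta>" and s: "s \<in> sections E T" and y: "y \<in> T" for T \<theta> s y
  proof -
    have TD: "T \<subseteq> D" and TW: "T \<subseteq> W" using T V by auto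
    obtain f where f: "\<And>i. i < n \<Longrightarrow> f i \<in> regular C T" "\<And>x. x \<in> T \<Longrightarrow> s x = (\<Sum>i<n. f i x \<cdot>\<^sub>E e i x)"
      using frame_section_coefficients[OF D(2) T(1) TD s] by blast
    let ?F = "\<lambda>(j, m) y. f j y / t y ^ (?p - m)"
    show ?thesis
    proof (rule horizontal_span_p_curvature[OF p T(1) TW \<theta>, where K = ?K and h = h and f = ?F])
      show "h k \<in> sections E T" for k using section_subset[OF h V(1) T] .
      show "nabla (h k) z \<delta> = 0" if "k \<in> ?K" "z \<in> T" "tangent_vector C z \<delta>" for k z \<delta>
        using flat that T by blast
      show "?F k \<in> regular C T" if k: "k \<in> ?K" for k
      proof -
        obtain j m where jm: "k = (j, m)" "j < n" using k by auto
        have "(\<lambda>y. f j y / t y ^ (?p - m)) \<in> regular C T"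
          by (intro regular_divide regular_power T(1) f jm regular_subset[OF tVreg V(1) T])
            (use tV T in auto)
        then show ?thesis by (simp add: jm)
      qed
      show "y \<in> T" by fact
      fix z assume z: "z \<in> T"
      then have tz: "t z \<noteq> 0" using tV T by auto
      have "(\<Sum>m<?p. (f j z / t z ^ (?p - m)) \<cdot>\<^sub>E h (j, m) z) = f j z \<cdot>\<^sub>E e j z" if j: "j < n" for j
      proof -
        have "(\<Sum>m<?p. (f j z / t z ^ (?p - m)) \<cdot>\<^sub>E h (j, m) z)
            = (\<Sum>m<?p. \<Sum>i<n. (f j z * u j m i z) \<cdot>\<^sub>E e i z)"
          using tz by (simp add: h_def g_def vs.scale_sum_right)
        also have "\<dots> = (\<Sum>i<n. (f j z * (\<Sum>m<?p. u j m i z)) \<cdot>\<^sub>E e i z)"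
          by (subst sum.swap) (simp add: sum_distrib_left vs.scale_sum_left)
        also have "\<dots> = (\<Sum>i<n. (f j z * std_basis j i) \<cdot>\<^sub>E e i z)"
          using c2[of "\<lambda>k. w j k i z" for i] by (simp add: u_def w_def)
        also have "\<dots> = (\<Sum>i<n. if i = j then f j z \<cdot>\<^sub>E e j z else 0)"
          by (intro sum.cong) (auto simp: std_basis_def)
        finally show ?thesis using j by simp
      qed
      then show "s z = (\<Sum>k\<in>?K. ?F k z \<cdot>\<^sub>E h k z)"
        by (simp add: f(2)[OF z] sum.cartesian_product[symmetric] split_def)
          (simp add: sum.cartesian_product')
    qed
  qed
  show ?thesis
    unfolding vanishing_p_curvature_def
  proof (intro allI impI ballI, elim conjE)
    fix U \<theta> s x assume U: "zopen U" "U \<subseteq> W" and \<theta>: "vector_field C U \<theta>" and s: "s \<in> sections E U" and x: "x \<in> U"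
    have "(covariant_derivative nabla \<theta> ^^ m) s \<in> sections E U" for m
      by (induction m) (auto intro: s covariant_derivative_section[OF U \<theta>])
    moreover have "covariant_derivative nabla (\<theta> ^^ ?p) s \<in> sections E U"
      by (rule covariant_derivative_section[OF U vector_field_power_CHAR[OF \<theta> U(1) p] s])
    ultimately have sec: "(\<lambda>y. (covariant_derivative nabla \<theta> ^^ ?p) s y - covariant_derivative nabla (\<theta> ^^ ?p) s y) \<in> sections E U"
      by (intro section_diff U)
    have UV: "zopen (U \<inter> V)" using U V by blast
    show "(covariant_derivative nabla \<theta> ^^ ?p) s x - covariant_derivative nabla (\<theta> ^^ ?p) s x = 0"
    proof (rule section_zero_on_dense[OF U(1) sec V(1,4) _ x])
      fix y assume "y \<in> V \<inter> U"
      then show "(covariant_derivative nabla \<theta> ^^ ?p) s y - covariant_derivative nabla (\<theta> ^^ ?p) s y = 0"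
        using on_V[OF UV _ vector_field_subset[OF \<theta>] section_subset[OF s U(1) UV]] by auto
    qed
  qed
qed

end

section \<open>Comparison with the formal connection matrix\<close>

context curve
begin

lemma zopens_meet_finite:
  assumes "finite I" "\<And>i. i \<in> I \<Longrightarrow> zopen (V i)" "\<And>i. i \<in> I \<Longrightarrow> V i \<noteq> {}"
  obtains S where "zopen S" "S \<noteq> {}" "\<And>i. i \<in> I \<Longrightarrow> S \<subseteq> V i"
proof -
  have "\<exists>S. zopen S \<and> S \<noteq> {} \<and> (\<forall>i\<in>I. S \<subseteq> V i)"
    using assms
  proof (induction I rule: finite_induct)
    case empty
    have "points \<noteq> {}" using smooth by (simp add: smooth_curve_def irreducible_space_def)
    then show ?case using openin_topspace by blast
  next
    case (insert i I)
    then obtain S where S: "zopen S" "S \<noteq> {}" "\<forall>i\<in>I. S \<subseteq> V i" by auto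
    have "zopen (S \<inter> V i)" "S \<inter> V i \<noteq> {}" using S insert.prems zopens_meet by auto
    then show ?case using S(3) by (intro exI[of _ "S \<inter> V i"]) auto
  qed
  then show thesis using that by blast
qed

lemma local_coordinate_nonzero_zopen:
  assumes t: "local_coordinate C x t" and T: "zopen T" "x \<in> T"
  obtains S where "zopen S" "S \<noteq> {}" "S \<subseteq> T" "\<And>y. y \<in> S \<Longrightarrow> t y \<noteq> 0"
proof -
  have tr: "regular_at C x t" using t by (rule local_coordinate_regular)
  then obtain U where U: "zopen U" "x \<in> U" "t \<in> regular C U" unfolding regular_at_def by blast
  have UT: "zopen (U \<inter> T)" using U T by blast
  have reg: "t \<in> regular C (U \<inter> T)" using regular_subset[OF U(3,1) UT] by blast
  have "\<exists>y\<in>U \<inter> T. t y \<noteq> 0"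
    using local_coordinate_nonzero[OF t] UT U T regular_at_point[OF tr] by (auto simp: eventually_near)
  then show thesis
    by (intro that[OF regular_nonvanishing_zopen[OF UT reg]]) auto
qed

lemma taylor_expansion_coordinate_power:
  assumes t: "regular_at C x t"
  shows "taylor_expansion C x t (\<lambda>y. t y ^ d) (fps_X ^ d)"
proof (induction d)
  case 0
  then show ?case using taylor_expansion_const[OF regular_at_point[OF t], of t 1] by simp
next
  case (Suc d)
  then show ?case using taylor_expansion_mult[OF t taylor_expansion_coordinate[OF t] Suc] by simp
qed

text \<open>
  Let \<open>a = g / h\<close>. As \<open>h\<close> has a nonzero expansion, it is \<open>t\<^sup>d u\<close> with a unit \<open>u\<close>. If the expansion of \<open>a\<close> has
  at most a simple pole, then the expansion of \<open>t g\<close> is divisible by \<open>t\<^sup>d\<close>, hence so is \<open>t g\<close> itself, and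
  \<open>t a\<close> is regular.
\<close>

lemma laurent_expansion_simple_pole:
  assumes t: "local_coordinate C x t"
    and a: "laurent_expansion C x t a (fps_to_fls B * inverse fls_X)"
  obtains b V where "taylor_expansion C x t b B" "zopen V" "V \<noteq> {}" "\<And>y. y \<in> V \<Longrightarrow> t y * a y = b y"
proof -
  have tr: "regular_at C x t" using t by (rule local_coordinate_regular)
  have xp: "x \<in> points" using tr by (rule regular_at_point)
  obtain g h G H V where g: "taylor_expansion C x t g G" and h: "taylor_expansion C x t h H" and H: "H \<noteq> 0"
    and V: "zopen V" "V \<noteq> {}" and ah: "\<And>y. y \<in> V \<Longrightarrow> a y * h y = g y"
    and eq: "fps_to_fls B * inverse fls_X * fps_to_fls H = fps_to_fls G"
    using a unfolding laurent_expansion_def by blast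
  have "fls_X * (fps_to_fls B * inverse fls_X * fps_to_fls H) = fps_to_fls (B * H)"
    by (simp add: fls_times_fps_to_fls mult_ac fls_X_mult_inverse_mult)
  then have "fps_to_fls (B * H) = fps_to_fls (fps_X * G)"
    unfolding eq by (simp add: fls_times_fps_to_fls)
  then have BH: "B * H = fps_X * G" by (simp only: fps_to_fls_eq_iff)
  have hr: "regular_at C x h" using h by (rule taylor_expansion_regular)
  have "\<not> infinitely_divisible x t h"
  proof
    assume "infinitely_divisible x t h"
    then have "eventually (\<lambda>y. h y = 0) (near x)" by (rule infinitely_divisible_zero[OF t hr])
    then have "taylor_expansion C x t h (fps_const 0)"
      by (rule taylor_expansion_cong[OF taylor_expansion_const[OF xp]])
    then show False using taylor_expansion_unique[OF t h] H by simp
  qed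
  then obtain d u where u: "regular_at C x u" "u x \<noteq> 0" "eventually (\<lambda>y. h y = t y ^ d * u y) (near x)"
    using uniformizer_factorization[OF t hr] by blast
  obtain U where U: "taylor_expansion C x t u U" using taylor_expansion_exists[OF t u(1)] .
  have "taylor_expansion C x t (\<lambda>y. t y ^ d * u y) (fps_X ^ d * U)"
    by (rule taylor_expansion_mult[OF tr taylor_expansion_coordinate_power[OF tr] U])
  then have "taylor_expansion C x t h (fps_X ^ d * U)" using u(3) by (rule taylor_expansion_cong)
  then have HU: "H = fps_X ^ d * U" by (rule taylor_expansion_unique[OF t h])
  have tg: "taylor_expansion C x t (\<lambda>y. t y * g y) (fps_X ^ d * (B * U))"
    using taylor_expansion_mult[OF tr taylor_expansion_coordinate[OF tr] g] BH HU by (simp add: mult_ac)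
  obtain q where q: "regular_at C x q" "eventually (\<lambda>y. t y * g y = t y ^ d * q y) (near x)"
  proof -
    obtain q where q: "regular_at C x q" "eventually (\<lambda>y. t y * g y =
        (\<Sum>i<d. fps_nth (fps_X ^ d * (B * U)) i * t y ^ i) + t y ^ d * q y) (near x)"
      using taylor_expansionE[OF tg] .
    moreover have "(\<Sum>i<d. fps_nth (fps_X ^ d * (B * U)) i * s ^ i) = 0" for s
      by (intro sum.neutral) (simp add: fps_X_power_mult_nth)
    ultimately show thesis using that by simp
  qed
  define b where "b y = q y * inverse (u y)" for y
  have br: "regular_at C x b"
    unfolding b_def by (intro regular_at_mult regular_at_inverse q u)
  obtain B' where B': "taylor_expansion C x t b B'" using taylor_expansion_exists[OF t br] .
  have near: "eventually (\<lambda>y. h y = t y ^ d * u y \<and> t y * g y = t y ^ d * q y \<and> u y \<noteq> 0) (near x)"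
    using u(3) q(2) regular_at_nonzero_near[OF u(1,2)] by eventually_elim simp
  have "eventually (\<lambda>y. t y * g y = b y * h y) (near x)"
    using near by eventually_elim (simp add: b_def)
  then have "taylor_expansion C x t (\<lambda>y. t y * g y) (B' * H)"
    by (rule taylor_expansion_cong[OF taylor_expansion_mult[OF tr B' h]])
  then have "B' * H = fps_X ^ d * (B * U)" by (rule taylor_expansion_unique[OF t _ tg])
  then have "B' * H = B * H" unfolding HU by (simp only: mult_ac)
  then have "B' = B" using H by simp
  with B' have bB: "taylor_expansion C x t b B" by simp
  obtain T where T: "zopen T" "x \<in> T"
    "\<And>y. y \<in> T \<Longrightarrow> h y = t y ^ d * u y \<and> t y * g y = t y ^ d * q y \<and> u y \<noteq> 0"
    using near xp by (auto simp: eventually_near)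
  obtain S where S: "zopen S" "S \<noteq> {}" "S \<subseteq> T" "\<And>y. y \<in> S \<Longrightarrow> t y \<noteq> 0"
    using local_coordinate_nonzero_zopen[OF t T(1,2)] by blast
  have "t y * a y = b y" if y: "y \<in> S \<inter> V" for y
  proof -
    have T': "h y = t y ^ d * u y" "t y * g y = t y ^ d * q y" "u y \<noteq> 0" using T(3) S(3) y by auto
    have "t y ^ d * (t y * a y * u y) = t y * (a y * h y)" by (simp add: T' mult_ac)
    also have "\<dots> = t y ^ d * q y" using ah[of y] y T' by simp
    finally have "t y * a y * u y = q y" using S(4)[of y] y by simp
    then show ?thesis using T'(3) by (auto simp: b_def field_simps)
  qed
  moreover have "zopen (S \<inter> V)" "S \<inter> V \<noteq> {}" using S V zopens_meet by auto
  ultimately show thesis using that[OF bB] by blast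
qed

end

context bundle_connection
begin

text \<open>For \<open>s = \<Sum> f\<^sub>i e\<^sub>i\<close>, the form \<open>t \<nabla> s = \<Sum> df\<^sub>i \<otimes> t e\<^sub>i + dt \<otimes> r\<close> with \<open>r = \<Sum> b\<^sub>i\<^sub>j f\<^sub>j e\<^sub>i\<close> is
  regular on \<open>D\<close>.\<close>

lemma log_form_imp_simple_pole:
  assumes L: "log_form D t e b" and x: "x \<in> D" and t: "local_coordinate C x t"
  shows "pole_order_le C E W nabla x 1"
  unfolding pole_order_le_def
proof (intro exI[of _ t] conjI t allI impI, elim conjE)
  fix U s assume U: "zopen U" "x \<in> U" and s: "s \<in> sections E U"
  note D = log_formD[OF L]
  define V where "V = U \<inter> D"
  have V: "zopen V" "x \<in> V" "V \<subseteq> U" "V \<subseteq> D" using U D(3) x by (auto simp: V_def)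
  have sV: "s \<in> sections E V" using section_subset[OF s U(1) V(1,3)] .
  obtain f where f: "\<And>i. i < n \<Longrightarrow> f i \<in> regular C V" "\<And>y. y \<in> V \<Longrightarrow> s y = (\<Sum>i<n. f i y \<cdot>\<^sub>E e i y)"
    using frame_section_coefficients[OF D(2) V(1,4) sV] by blast
  have tV: "t \<in> regular C V" using regular_subset[OF etale_coordinate_regular[OF D(1)] D(3) V(1,4)] .
  have bV: "b i j \<in> regular C V" if "i < n" "j < n" for i j using regular_subset[OF D(4)[OF that] D(3) V(1,4)] .
  have e: "e i \<in> sections E V" if "i < n" for i using frame_member_section[OF D(2) V(1,4) that] .
  define r where "r y = (\<Sum>i<n. (\<Sum>j<n. b i j y * f j y) \<cdot>\<^sub>E e i y)" for y
  have r: "r \<in> sections E V"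
    unfolding r_def by (intro frame_combination_section[OF D(2) V(1,4)] regular_sum regular_mult V(1) bV f) auto
  define \<omega> where "\<omega> y \<delta> = (\<Sum>i<n. \<delta> (f i) \<cdot>\<^sub>E (t y \<cdot>\<^sub>E e i y)) + \<delta> t \<cdot>\<^sub>E r y"
    for y and \<delta> :: "('x \<Rightarrow> 'k) \<Rightarrow> 'k"
  have "\<omega> \<in> bundle_forms C E V"
    unfolding bundle_forms_def
  proof (intro CollectI ballI)
    fix z assume z: "z \<in> V"
    let ?g = "\<lambda>i. if i < n then f i else t" and ?s = "\<lambda>i. if i < n then (\<lambda>y. t y \<cdot>\<^sub>E e i y) else r"
    show "\<exists>T (m::nat) g s. zopen T \<and> z \<in> T \<and> T \<subseteq> V \<and> (\<forall>i<m. g i \<in> regular C T \<and> s i \<in> sections E T) \<and>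
        (\<forall>y\<in>T. \<forall>\<delta>. tangent_vector C y \<delta> \<longrightarrow> \<omega> y \<delta> = (\<Sum>i<m. \<delta> (g i) \<cdot>\<^sub>E s i y))"
      by (rule exI[of _ V], rule exI[of _ "Suc n"], rule exI[of _ ?g], rule exI[of _ ?s])
        (use z V f tV r section_scale[OF V(1) e tV] in \<open>auto simp: \<omega>_def\<close>)
  qed
  moreover have "\<omega> y \<delta> = t y ^ 1 \<cdot>\<^sub>E nabla s y \<delta>" if y: "y \<in> V \<inter> W" and \<delta>: "tangent_vector C y \<delta>" for y \<delta>
  proof -
    have VW: "zopen (V \<inter> W)" "V \<inter> W \<subseteq> W" "V \<inter> W \<subseteq> V" using V W_zopen by auto
    have yD: "y \<in> D" "y \<in> W" using y V by auto
    have f': "f i \<in> regular C (V \<inter> W)" if "i < n" for i using regular_subset[OF f(1)[OF that] V(1) VW(1,3)] .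
    have e': "e i \<in> sections E (V \<inter> W)" if "i < n" for i using section_subset[OF e[OF that] V(1) VW(1,3)] .
    have comb: "(\<lambda>y. \<Sum>i<n. f i y \<cdot>\<^sub>E e i y) \<in> sections E (V \<inter> W)"
      by (intro section_sum section_scale VW f' e') auto
    have ne: "t y \<cdot>\<^sub>E nabla (e j) y \<delta> = \<delta> t \<cdot>\<^sub>E (\<Sum>i<n. b i j y \<cdot>\<^sub>E e i y)" if j: "j < n" for j
      unfolding nabla_multiple[OF D(1) VW(1,2) e'[OF j] y yD(1) \<delta>] D(5)[OF yD j, symmetric]
      by (simp add: mult.commute)
    have "nabla s y \<delta> = nabla (\<lambda>y. \<Sum>i<n. f i y \<cdot>\<^sub>E e i y) y \<delta>"
      by (rule nabla_cong[OF VW(1,2) section_subset[OF sV V(1) VW(1,3)] comb _ y \<delta>]) (use f(2) in auto)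
    also have "\<dots> = (\<Sum>j<n. \<delta> (f j) \<cdot>\<^sub>E e j y + f j y \<cdot>\<^sub>E nabla (e j) y \<delta>)"
      by (rule nabla_sum[OF VW(1,2) y \<delta>]) (use f' e' in auto)
    finally have "t y \<cdot>\<^sub>E nabla s y \<delta> =
        (\<Sum>j<n. \<delta> (f j) \<cdot>\<^sub>E (t y \<cdot>\<^sub>E e j y)) + (\<Sum>j<n. f j y \<cdot>\<^sub>E (t y \<cdot>\<^sub>E nabla (e j) y \<delta>))"
      by (simp add: vs.scale_sum_right vs.scale_right_distrib sum.distrib mult.commute)
    also have "(\<Sum>j<n. f j y \<cdot>\<^sub>E (t y \<cdot>\<^sub>E nabla (e j) y \<delta>)) = (\<Sum>j<n. \<Sum>i<n. (\<delta> t * (b i j y * f j y)) \<cdot>\<^sub>E e i y)"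
      using ne by (intro sum.cong) (simp_all add: vs.scale_sum_right mult_ac)
    also have "\<dots> = \<delta> t \<cdot>\<^sub>E r y"
      unfolding r_def by (subst sum.swap) (simp add: vs.scale_sum_right vs.scale_sum_left sum_distrib_left)
    finally show ?thesis by (simp add: \<omega>_def)
  qed
  ultimately show "\<exists>V. zopen V \<and> x \<in> V \<and> V \<subseteq> U \<and>
      (\<exists>\<omega>\<in>bundle_forms C E V. \<forall>y\<in>V \<inter> W. \<forall>\<delta>. tangent_vector C y \<delta> \<longrightarrow> \<omega> y \<delta> = t y ^ 1 \<cdot>\<^sub>E nabla s y \<delta>)"
    using V by blast
qed

text \<open>The regular extensions of \<open>t' \<nabla> e\<^sub>j\<close>, contracted with \<open>d/dt\<close>, have regular coordinates; the
  coordinate \<open>t'\<close> of the definition is replaced by \<open>t = t' u\<close>.\<close>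

lemma simple_pole_imp_log_form:
  assumes t: "local_coordinate C x t" and e: "frame_on C E n U e" "x \<in> U"
    and pole: "pole_order_le C E W nabla x 1"
  obtains D b where "x \<in> D" "log_form D t e b"
proof -
  have xp: "x \<in> points" using zopen_subset_points[OF frame_zopen[OF e(1)] e(2)] .
  obtain t' where t': "local_coordinate C x t'"
    and ext: "\<forall>U s. zopen U \<and> x \<in> U \<and> s \<in> sections E U \<longrightarrow>
        (\<exists>V. zopen V \<and> x \<in> V \<and> V \<subseteq> U \<and>
          (\<exists>\<omega>\<in>bundle_forms C E V. \<forall>y\<in>V \<inter> W. \<forall>\<delta>. tangent_vector C y \<delta> \<longrightarrow> \<omega> y \<delta> = t' y ^ 1 \<cdot>\<^sub>E nabla s y \<delta>))"
    using pole unfolding pole_order_le_def by (elim exE conjE)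
  obtain u where u: "regular_at C x u" "eventually (\<lambda>y. t y = t' y * u y) (near x)"
    using local_coordinate_divides[OF t' local_coordinate_regular[OF t] local_coordinate_zero[OF t]] .
  have "\<forall>j\<in>{..<n}. \<exists>V \<omega>. zopen V \<and> x \<in> V \<and> \<omega> \<in> bundle_forms C E V \<and>
      (\<forall>y\<in>V \<inter> W. \<forall>\<delta>. tangent_vector C y \<delta> \<longrightarrow> \<omega> y \<delta> = t' y \<cdot>\<^sub>E nabla (e j) y \<delta>)"
  proof
    fix j assume "j \<in> {..<n}"
    then have "e j \<in> sections E U" using frame_member_section[OF e(1) frame_zopen[OF e(1)]] by auto
    from ext[THEN spec, THEN spec, THEN mp, OF conjI[OF frame_zopen[OF e(1)] conjI[OF e(2) this]]]
    show "\<exists>V \<omega>. zopen V \<and> x \<in> V \<and> \<omega> \<in> bundle_forms C E V \<and>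
      (\<forall>y\<in>V \<inter> W. \<forall>\<delta>. tangent_vector C y \<delta> \<longrightarrow> \<omega> y \<delta> = t' y \<cdot>\<^sub>E nabla (e j) y \<delta>)"
      unfolding power_one_right by blast
  qed
  from bchoice[OF this] obtain V where "\<forall>j\<in>{..<n}. \<exists>\<omega>. zopen (V j) \<and> x \<in> V j \<and> \<omega> \<in> bundle_forms C E (V j) \<and>
      (\<forall>y\<in>V j \<inter> W. \<forall>\<delta>. tangent_vector C y \<delta> \<longrightarrow> \<omega> y \<delta> = t' y \<cdot>\<^sub>E nabla (e j) y \<delta>)" ..
  from bchoice[OF this] obtain \<omega> where \<omega>: "\<forall>j\<in>{..<n}. zopen (V j) \<and> x \<in> V j \<and> \<omega> j \<in> bundle_forms C E (V j) \<and>
      (\<forall>y\<in>V j \<inter> W. \<forall>\<delta>. tangent_vector C y \<delta> \<longrightarrow> \<omega> j y \<delta> = t' y \<cdot>\<^sub>E nabla (e j) y \<delta>)" ..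
  obtain D0 where D0: "x \<in> D0" "etale_coordinate D0 t" using etale_neighbourhood[OF t] .
  have "eventually (\<lambda>y. (\<forall>j\<in>{..<n}. y \<in> V j) \<and> t y = t' y * u y \<and> regular_at C y u \<and> y \<in> D0 \<and> y \<in> U) (near x)"
    using u(2) \<omega> D0 e frame_zopen[OF e(1)] etale_coordinate_zopen[OF D0(2)] xp
    by (intro eventually_conj eventually_ball_finite ballI regular_at_near u(1)) (auto simp: eventually_near)
  then obtain D where D: "zopen D" "x \<in> D" "\<And>y. y \<in> D \<Longrightarrow>
      (\<forall>j\<in>{..<n}. y \<in> V j) \<and> t y = t' y * u y \<and> regular_at C y u \<and> y \<in> D0 \<and> y \<in> U"
    using xp by (auto simp: eventually_near)
  have et: "etale_coordinate D t" using etale_coordinate_subset[OF D0(2) D(1)] D(3) by blast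
  have eD: "frame_on C E n D e" using frame_subset[OF e(1) D(1)] D(3) by blast
  have uD: "u \<in> regular C D" using D by (simp add: regular_iff_regular_at)
  have "\<forall>j\<in>{..<n}. \<exists>f. (\<forall>i<n. f i \<in> regular C D) \<and>
      (\<forall>y\<in>D. u y \<cdot>\<^sub>E \<omega> j y (\<lambda>f. partial t f y) = (\<Sum>i<n. f i y \<cdot>\<^sub>E e i y))"
  proof
    fix j assume j: "j \<in> {..<n}"
    have "\<omega> j \<in> bundle_forms C E D"
      by (rule bundle_form_subset[of _ "V j"]) (use \<omega> j D in auto)
    then have "(\<lambda>y. \<omega> j y (\<lambda>f. partial t f y)) \<in> sections E D"
      by (rule bundle_form_contraction[OF D(1) _ partial_vector_field[OF et]])
    then have "(\<lambda>y. u y \<cdot>\<^sub>E \<omega> j y (\<lambda>f. partial t f y)) \<in> sections E D"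
      by (rule section_scale[OF D(1) _ uD])
    then show "\<exists>f. (\<forall>i<n. f i \<in> regular C D) \<and>
      (\<forall>y\<in>D. u y \<cdot>\<^sub>E \<omega> j y (\<lambda>f. partial t f y) = (\<Sum>i<n. f i y \<cdot>\<^sub>E e i y))"
      by (rule iffD1[OF frame_section_iff[OF eD D(1) subset_refl]])
  qed
  from bchoice[OF this] obtain f where f: "\<forall>j\<in>{..<n}. (\<forall>i<n. f j i \<in> regular C D) \<and>
      (\<forall>y\<in>D. u y \<cdot>\<^sub>E \<omega> j y (\<lambda>f. partial t f y) = (\<Sum>i<n. f j i y \<cdot>\<^sub>E e i y))" ..
  have "t y \<cdot>\<^sub>E nabla (e j) y (\<lambda>f. partial t f y) = (\<Sum>i<n. f j i y \<cdot>\<^sub>E e i y)"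
    if y: "y \<in> D \<inter> W" and j: "j < n" for y j
  proof -
    have \<delta>: "tangent_vector C y (\<lambda>f. partial t f y)" using partial_tangent_vector(1)[OF et] y by blast
    have "\<omega> j y (\<lambda>f. partial t f y) = t' y \<cdot>\<^sub>E nabla (e j) y (\<lambda>f. partial t f y)"
      using \<omega> j y D(3)[of y] \<delta> by auto
    moreover have "t y = t' y * u y" using D(3)[of y] y by blast
    ultimately have "t y \<cdot>\<^sub>E nabla (e j) y (\<lambda>f. partial t f y) = u y \<cdot>\<^sub>E \<omega> j y (\<lambda>f. partial t f y)"
      by (simp add: mult.commute)
    then show ?thesis using f j y by auto
  qed
  then have "log_form D t e (\<lambda>i j. f j i)"
    using et eD f by (auto simp: log_form_def)
  with D(2) show thesis by (rule that)
qed

lemma log_form_imp_formal_connection_matrix: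
  assumes L: "log_form D t e b" and x: "x \<in> D" and t: "local_coordinate C x t"
    and B: "\<And>i j. i < n \<Longrightarrow> j < n \<Longrightarrow> taylor_expansion C x t (b i j) (B i j)"
  shows "formal_connection_matrix C E n W nabla x t e (log_matrix n B)"
proof -
  note D = log_formD[OF L]
  obtain S where S: "zopen S" "S \<noteq> {}" "S \<subseteq> D" "\<And>y. y \<in> S \<Longrightarrow> t y \<noteq> 0"
    using local_coordinate_nonzero_zopen[OF t D(3) x] by blast
  define V where "V = S \<inter> W"
  have V: "zopen V" "V \<noteq> {}" "V \<subseteq> W" "V \<subseteq> D" "\<And>y. y \<in> V \<Longrightarrow> t y \<noteq> 0"
    using S W_zopen W_nonempty zopens_meet[OF S(1) W_zopen] by (auto simp: V_def)
  have tV: "t \<in> regular C V" using regular_subset[OF etale_coordinate_regular[OF D(1)] D(3) V(1,4)] .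
  let ?a = "\<lambda>i j y. b i j y / t y"
  have a: "?a i j \<in> regular C V" if "i < n" "j < n" for i j
    using regular_divide[OF V(1) regular_subset[OF D(4)[OF that] D(3) V(1,4)] tV V(5)] .
  have "laurent_expansion C x t (?a i j) (log_matrix n B $$ (i, j))" if ij: "i < n" "j < n" for i j
    unfolding laurent_expansion_def
  proof (rule exI[of _ "b i j"], rule exI[of _ t], rule exI[of _ "B i j"], rule exI[of _ fps_X],
      rule exI[of _ V], intro conjI ballI B ij V a)
    show "taylor_expansion C x t t fps_X" by (rule taylor_expansion_coordinate[OF local_coordinate_regular[OF t]])
    show "?a i j y * t y = b i j y" if "y \<in> V" for y using V(5)[OF that] by simp
    show "log_matrix n B $$ (i, j) * fps_to_fls fps_X = fps_to_fls (B i j)"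
      using ij by (simp add: log_matrix_def mult.assoc)
  qed simp
  moreover have "nabla (e j) y \<delta> = (\<Sum>i<n. (?a i j y * \<delta> t) \<cdot>\<^sub>E e i y)"
    if j: "j < n" and y: "y \<in> V" and \<delta>: "tangent_vector C y \<delta>" for j y \<delta>
  proof -
    have yD: "y \<in> D" "y \<in> W" using y V by auto
    have "nabla (e j) y \<delta> = (\<delta> t / t y) \<cdot>\<^sub>E (t y \<cdot>\<^sub>E nabla (e j) y (\<lambda>f. partial t f y))"
      using nabla_multiple[OF D(1) V(1,3) frame_member_section[OF D(2) V(1,4) j] y yD(1) \<delta>] V(5)[OF y]
      by simp
    then show ?thesis unfolding D(5)[OF yD j] by (simp add: vs.scale_sum_right mult.commute)
  qed
  ultimately have "\<exists>a V. zopen V \<and> V \<noteq> {} \<and> V \<subseteq> W \<and> frame_on C E n V e \<and> t \<in> regular C V \<and>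
      (\<forall>i<n. \<forall>j<n. a i j \<in> regular C V \<and> laurent_expansion C x t (a i j) (log_matrix n B $$ (i, j))) \<and>
      (\<forall>j<n. \<forall>y\<in>V. \<forall>\<delta>. tangent_vector C y \<delta> \<longrightarrow>
        nabla (e j) y \<delta> = (\<Sum>i<n. (a i j y * \<delta> t) \<cdot>\<^sub>E e i y))"
    using V(1-3) frame_subset[OF D(2) V(1,4)] tV a by (intro exI[of _ ?a] exI[of _ V]) auto
  then show ?thesis by (simp add: formal_connection_matrix_def log_matrix_def)
qed

text \<open>The matrix \<open>a\<close> describes \<open>\<nabla>\<close> on some nonempty open set only, and \<open>t a\<close> agrees with a matrix \<open>b\<close> of
  functions regular at \<open>x\<close> on another one. By density the resulting equation extends to all points
  near \<open>x\<close> at which \<open>\<nabla>\<close> is defined.\<close>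

lemma formal_connection_matrix_imp_log_form:
  assumes t: "local_coordinate C x t" and e: "frame_on C E n U e" "x \<in> U"
    and fcm: "formal_connection_matrix C E n W nabla x t e (log_matrix n B)"
  obtains D b where "x \<in> D" "log_form D t e b"
    "\<And>i j. i < n \<Longrightarrow> j < n \<Longrightarrow> taylor_expansion C x t (b i j) (B i j)"
proof -
  have xp: "x \<in> points" using zopen_subset_points[OF frame_zopen[OF e(1)] e(2)] .
  obtain a V where V: "zopen V" "V \<noteq> {}" "V \<subseteq> W"
    and a': "\<forall>i<n. \<forall>j<n. a i j \<in> regular C V \<and> laurent_expansion C x t (a i j) (log_matrix n B $$ (i, j))"
    and nab': "\<forall>j<n. \<forall>y\<in>V. \<forall>\<delta>. tangent_vector C y \<delta> \<longrightarrow>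
        nabla (e j) y \<delta> = (\<Sum>i<n. (a i j y * \<delta> t) \<cdot>\<^sub>E e i y)"
    using fcm unfolding formal_connection_matrix_def by (elim exE conjE)
  have a: "laurent_expansion C x t (a i j) (log_matrix n B $$ (i, j))" if "i < n" "j < n" for i j
    using a' that by simp
  note nab = nab'[rule_format]
  let ?I = "{..<n} \<times> {..<n}"
  have "\<forall>k\<in>?I. \<exists>b V. taylor_expansion C x t b (B (fst k) (snd k)) \<and> zopen V \<and> V \<noteq> {} \<and>
      (\<forall>y\<in>V. t y * a (fst k) (snd k) y = b y)"
  proof
    fix k assume "k \<in> ?I"
    then have "laurent_expansion C x t (a (fst k) (snd k)) (fps_to_fls (B (fst k) (snd k)) * inverse fls_X)"
      using a[of "fst k" "snd k"] by (auto simp: log_matrix_def)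
    then obtain b V where "taylor_expansion C x t b (B (fst k) (snd k))" "zopen V" "V \<noteq> {}"
      "\<And>y. y \<in> V \<Longrightarrow> t y * a (fst k) (snd k) y = b y"
      by (rule laurent_expansion_simple_pole[OF t]) (erule that; assumption)
    then show "\<exists>b V. taylor_expansion C x t b (B (fst k) (snd k)) \<and> zopen V \<and> V \<noteq> {} \<and>
      (\<forall>y\<in>V. t y * a (fst k) (snd k) y = b y)" by blast
  qed
  from bchoice[OF this] obtain b where "\<forall>k\<in>?I. \<exists>V. taylor_expansion C x t (b k) (B (fst k) (snd k)) \<and>
      zopen V \<and> V \<noteq> {} \<and> (\<forall>y\<in>V. t y * a (fst k) (snd k) y = b k y)" ..
  from bchoice[OF this] obtain V' where b: "\<forall>k\<in>?I. taylor_expansion C x t (b k) (B (fst k) (snd k)) \<and>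
      zopen (V' k) \<and> V' k \<noteq> {} \<and> (\<forall>y\<in>V' k. t y * a (fst k) (snd k) y = b k y)" ..
  obtain S where S: "zopen S" "S \<noteq> {}" "\<And>k. k \<in> ?I \<Longrightarrow> S \<subseteq> V' k"
    using zopens_meet_finite[of ?I V'] b by auto
  have SV: "zopen (S \<inter> V)" "S \<inter> V \<noteq> {}" using S V zopens_meet by auto
  obtain D0 where D0: "x \<in> D0" "etale_coordinate D0 t" using etale_neighbourhood[OF t] .
  have "eventually (\<lambda>y. (\<forall>k\<in>?I. regular_at C y (b k)) \<and> y \<in> D0 \<and> y \<in> U) (near x)"
    using D0 e frame_zopen[OF e(1)] etale_coordinate_zopen[OF D0(2)] xp b
    by (intro eventually_conj eventually_ball_finite ballI regular_at_near)
      (auto simp: eventually_near dest: taylor_expansion_regular)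
  then obtain D where D: "zopen D" "x \<in> D" "\<And>y. y \<in> D \<Longrightarrow>
      (\<forall>k\<in>?I. regular_at C y (b k)) \<and> y \<in> D0 \<and> y \<in> U"
    using xp by (auto simp: eventually_near)
  have et: "etale_coordinate D t" using etale_coordinate_subset[OF D0(2) D(1)] D(3) by blast
  have eD: "frame_on C E n D e" using frame_subset[OF e(1) D(1)] D(3) by blast
  have bD: "b (i, j) \<in> regular C D" if "i < n" "j < n" for i j
    using D that by (simp add: regular_iff_regular_at)
  have "t y \<cdot>\<^sub>E nabla (e j) y (\<lambda>f. partial t f y) = (\<Sum>i<n. b (i, j) y \<cdot>\<^sub>E e i y)"
    if y: "y \<in> D \<inter> W" and j: "j < n" for y j
  proof -
    have DW: "zopen (D \<inter> W)" "D \<inter> W \<subseteq> W" "D \<inter> W \<subseteq> D" using D W_zopen by auto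
    let ?s = "\<lambda>y. t y \<cdot>\<^sub>E nabla (e j) y (\<lambda>f. partial t f y) - (\<Sum>i<n. b (i, j) y \<cdot>\<^sub>E e i y)"
    have sub: "f \<in> regular C (D \<inter> W)" if "f \<in> regular C D" for f using regular_subset[OF that D(1) DW(1,3)] .
    have "(\<lambda>y. nabla (e j) y (\<lambda>f. partial t f y)) \<in> sections E (D \<inter> W)"
      by (rule bundle_form_contraction[OF DW(1) nabla_form[OF DW(1,2) frame_member_section[OF eD DW(1,3) j]]
            vector_field_subset[OF partial_vector_field[OF et] DW(3)]])
    then have sec: "?s \<in> sections E (D \<inter> W)"
      by (intro section_diff section_scale frame_combination_section[OF eD DW(1,3)] DW(1) sub bD
          etale_coordinate_regular[OF et] j)
    have "?s y = 0"
    proof (rule section_zero_on_dense[OF DW(1) sec SV _ y])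
      fix z assume z: "z \<in> S \<inter> V \<inter> (D \<inter> W)"
      have zD: "z \<in> D" using z by blast
      have "t z * a i j z = b (i, j) z" if "i < n" for i
        using b S(3)[of "(i, j)"] that j z by auto
      then have "(\<Sum>i<n. (t z * a i j z) \<cdot>\<^sub>E e i z) = (\<Sum>i<n. b (i, j) z \<cdot>\<^sub>E e i z)" by simp
      then show "?s z = 0"
        using nab[OF j _ partial_tangent_vector(1)[OF et zD]] z partial_tangent_vector(2)[OF et zD]
        by (simp add: vs.scale_sum_right)
    qed
    then show ?thesis by simp
  qed
  then have "log_form D t e (\<lambda>i j. b (i, j))"
    using et eD bD by (auto simp: log_form_def)
  moreover have "taylor_expansion C x t (b (i, j)) (B i j)" if "i < n" "j < n" for i j
    using b that by auto
  ultimately show thesis using that[OF D(2)] by blast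
qed

text \<open>Both conditions compare the same two columns, once as power series and once as functions; Taylor
  expansion is unique and injective.\<close>

lemma log_p_curvature_zero_iff:
  assumes L: "log_form D t e b" and x: "x \<in> D" and t: "local_coordinate C x t"
    and B: "\<And>i j. i < n \<Longrightarrow> j < n \<Longrightarrow> taylor_expansion C x t (b i j) (B i j)"
  shows "log_p_curvature_zero n B \<longleftrightarrow> (\<forall>i<n. \<forall>j<n. \<forall>y\<in>D.
    (log_derivative n t b ^^ CHAR('k)) (\<lambda>i _. std_basis j i) i y =
    log_derivative n t b (\<lambda>i _. std_basis j i) i y)"
proof -
  note D = log_formD[OF L]
  have xp: "x \<in> points" using zopen_subset_points[OF D(3) x] .
  let ?p = "CHAR('k)"
  let ?v = "\<lambda>j k. (log_derivative n t b ^^ k) (\<lambda>i _. std_basis j i)"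
  let ?w = "\<lambda>j k. (log_connection n B ^^ k) (std_basis j)"
  have taylor: "taylor_expansion C x t (?v j k i) (?w j k i)" if "i < n" for i j k
    by (rule taylor_expansion_log_derivative[OF D(1) x B taylor_expansion_std_basis[OF xp] that])
  have reg: "?v j k i \<in> regular C D" if "i < n" for i j k
    by (rule log_derivative_funpow_regular[OF D(1,3) subset_refl D(4)])
      (use that in \<open>auto intro: regular_const D(3)\<close>)
  have "?w j ?p i = ?w j 1 i \<longleftrightarrow> (\<forall>y\<in>D. ?v j ?p i y = ?v j 1 i y)" if i: "i < n" for i j
  proof
    assume "\<forall>y\<in>D. ?v j ?p i y = ?v j 1 i y"
    then have "eventually (\<lambda>y. ?v j ?p i y = ?v j 1 i y) (near x)"
      using D(3) x xp by (auto simp: eventually_near)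
    then have "taylor_expansion C x t (?v j ?p i) (?w j 1 i)"
      by (rule taylor_expansion_cong[OF taylor[OF i]])
    then show "?w j ?p i = ?w j 1 i" by (rule taylor_expansion_unique[OF t taylor[OF i]])
  next
    assume eq: "?w j ?p i = ?w j 1 i"
    have tr: "regular_at C x t" using t by (rule local_coordinate_regular)
    have "taylor_expansion C x t (\<lambda>y. ?v j ?p i y + (-1) * ?v j 1 i y) (?w j ?p i + fps_const (-1) * ?w j 1 i)"
      by (intro taylor_expansion_add taylor_expansion_mult[OF tr] taylor_expansion_const xp taylor i)
    also have "?w j ?p i + fps_const (-1) * ?w j 1 i = 0"
      unfolding eq by (simp add: fps_const_neg[symmetric] del: fps_const_neg)
    finally have "eventually (\<lambda>y. ?v j ?p i y + (-1) * ?v j 1 i y = 0) (near x)"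
      by (rule taylor_expansion_zero_germ[OF t])
    then obtain S where S: "zopen S" "x \<in> S" "\<forall>y\<in>S. ?v j ?p i y + (-1) * ?v j 1 i y = 0"
      using xp by (auto simp: eventually_near)
    have S': "S \<noteq> {}" using S(2) by blast
    have "?v j ?p i y = ?v j 1 i y" if "y \<in> S \<inter> D" for y
      using S(3) that by (simp add: add_eq_0_iff2)
    then show "\<forall>y\<in>D. ?v j ?p i y = ?v j 1 i y"
      using regular_eq_on_dense[OF D(3) reg[OF i] reg[OF i] S(1) S'] by blast
  qed
  then have "?w j ?p i = log_connection n B (std_basis j) i \<longleftrightarrow>
      (\<forall>y\<in>D. ?v j ?p i y = log_derivative n t b (\<lambda>i _. std_basis j i) i y)" if "i < n" for i j
    using that by simp
  then show ?thesis unfolding log_p_curvature_zero_def by auto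
qed

theorem log_pole_formal_connection:
  assumes p: "CHAR('k) > 0" and t: "local_coordinate C x t" and e: "frame_at C E n x e"
    and pole: "pole_order_le C E W nabla x 1" and pc: "vanishing_p_curvature C E W nabla"
  obtains B where "formal_connection_matrix C E n W nabla x t e (log_matrix n B)" "log_p_curvature_zero n B"
proof -
  obtain U where U: "x \<in> U" "frame_on C E n U e" using e unfolding frame_at_def by blast
  obtain D b where D: "x \<in> D" "log_form D t e b"
    using simple_pole_imp_log_form[OF t U(2,1) pole] .
  have "\<exists>F. i < n \<longrightarrow> j < n \<longrightarrow> taylor_expansion C x t (b i j) F" for i j
    using taylor_expansion_exists[OF t, of "b i j"] log_formD(3,4)[OF D(2)] D(1)
    by (metis regular_atI)
  then obtain B where B: "\<And>i j. i < n \<Longrightarrow> j < n \<Longrightarrow> taylor_expansion C x t (b i j) (B i j)" by metis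
  show thesis
  proof (rule that)
    show "formal_connection_matrix C E n W nabla x t e (log_matrix n B)"
      by (rule log_form_imp_formal_connection_matrix[OF D(2,1) t B])
    show "log_p_curvature_zero n B"
    proof (rule iffD2[OF log_p_curvature_zero_iff[OF D(2,1) t B]], assumption+, intro allI impI ballI)
      fix i j y assume "i < n" "j < n" "y \<in> D"
      then show "(log_derivative n t b ^^ CHAR('k)) (\<lambda>i _. std_basis j i) i y =
          log_derivative n t b (\<lambda>i _. std_basis j i) i y"
        using p_curvature_zero_imp_log_derivative[OF p D(2) _ pc] by blast
    qed
  qed
qed

theorem formal_connection_log_pole:
  assumes p: "CHAR('k) > 0" and t: "local_coordinate C x t" and e: "frame_at C E n x e"
    and fcm: "formal_connection_matrix C E n W nabla x t e (log_matrix n B)" and B0: "log_p_curvature_zero n B"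
  shows "pole_order_le C E W nabla x 1" "vanishing_p_curvature C E W nabla"
proof -
  obtain U where U: "x \<in> U" "frame_on C E n U e" using e unfolding frame_at_def by blast
  obtain D b where D: "x \<in> D" "log_form D t e b"
    and B: "\<And>i j. i < n \<Longrightarrow> j < n \<Longrightarrow> taylor_expansion C x t (b i j) (B i j)"
  proof (rule formal_connection_matrix_imp_log_form[OF t U(2,1) fcm])
    fix D b assume D: "x \<in> D" "log_form D t e b"
      and B: "\<And>i j. i < n \<Longrightarrow> j < n \<Longrightarrow> taylor_expansion C x t (b i j) (B i j)"
    show thesis by (rule that[OF D B])
  qed
  show "pole_order_le C E W nabla x 1" by (rule log_form_imp_simple_pole[OF D(2,1) t])
  obtain S where S: "zopen S" "S \<noteq> {}" "S \<subseteq> D" "\<And>y. y \<in> S \<Longrightarrow> t y \<noteq> 0"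
    using local_coordinate_nonzero_zopen[OF t log_formD(3)[OF D(2)] D(1)] by blast
  then obtain y where y: "y \<in> D" "t y \<noteq> 0" by blast
  have "\<forall>i<n. \<forall>j<n. \<forall>y\<in>D. (log_derivative n t b ^^ CHAR('k)) (\<lambda>i _. std_basis j i) i y =
      log_derivative n t b (\<lambda>i _. std_basis j i) i y"
    by (rule iffD1[OF log_p_curvature_zero_iff[OF D(2,1) t B] B0])
  then show "vanishing_p_curvature C E W nabla"
    by (intro log_derivative_imp_p_curvature_zero[OF p D(2) y]) auto
qed

end

theorem corollary2p10:
  fixes C :: "('x, 'k::alg_closed_field) fun_space"
    and E :: "('x, 'k, 'v::ab_group_add) vbundle"
    and n p :: nat
    and W :: "'x set"
    and nabla :: "('x, 'k, 'v) conn"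
    and t :: "'x \<Rightarrow> 'x \<Rightarrow> 'k"
    and e :: "'x \<Rightarrow> nat \<Rightarrow> 'x \<Rightarrow> 'v"
  assumes "CHAR('k) = p" and "p > 0"
    and "smooth_curve C"
    and "vector_bundle C E n"
    and "rational_connection C E W nabla"
    and "poles C E W nabla \<noteq> {}"
    and "\<forall>x\<in>poles C E W nabla. local_coordinate C x (t x) \<and> frame_at C E n x (e x)"
  shows "(logarithmic C E W nabla \<and> vanishing_p_curvature C E W nabla \<longleftrightarrow>
      (\<forall>x\<in>poles C E W nabla. \<exists>A. formal_connection_matrix C E n W nabla x (t x) (e x) A \<and>
        formally_diagonalizable n A)) \<and>
    (logarithmic C E W nabla \<and> vanishing_p_curvature C E W nabla \<longleftrightarrow>
      (\<forall>x\<in>poles C E W nabla. \<exists>A. formal_connection_matrix C E n W nabla x (t x) (e x) A \<and>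
        formally_sum_of_log_lines n A))"
proof -
  have p: "CHAR('k) > 0" using assms(1,2) by simp
  interpret curve C using assms(3) by unfold_locales
  have "W \<noteq> {}"
  proof
    assume "W = {}"
    then have "points = {}" using assms(5) by (simp add: rational_connection_def)
    then show False using smooth by (simp add: smooth_curve_def irreducible_space_def)
  qed
  then interpret bundle_connection C E n W nabla
    using assms(4,5) by unfold_locales (simp_all add: rational_connection_def)
  let ?P = "poles C E W nabla" and ?fcm = "\<lambda>x. formal_connection_matrix C E n W nabla x (t x) (e x)"
  have t: "local_coordinate C x (t x)" and e: "frame_at C E n x (e x)" if "x \<in> ?P" for x
    using assms(7) that by blast+
  let ?log = "logarithmic C E W nabla \<and> vanishing_p_curvature C E W nabla"
    and ?diag = "\<forall>x\<in>?P. \<exists>A. ?fcm x A \<and> formally_diagonalizable n A"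
    and ?lines = "\<forall>x\<in>?P. \<exists>A. ?fcm x A \<and> formally_sum_of_log_lines n A"
  have carrier: "A \<in> carrier_mat n n" if "?fcm x A" for x A
    using that by (simp add: formal_connection_matrix_def)
  have "?log \<Longrightarrow> ?diag"
  proof
    fix x assume log: ?log and x: "x \<in> ?P"
    then have "pole_order_le C E W nabla x 1" by (simp add: logarithmic_def)
    then obtain B where "?fcm x (log_matrix n B)" "log_p_curvature_zero n B"
      using log_pole_formal_connection[OF p t[OF x] e[OF x]] log by blast
    then show "\<exists>A. ?fcm x A \<and> formally_diagonalizable n A"
      using log_p_curvature_zero_imp_diagonalizable[OF p] by blast
  qed
  moreover have "?diag \<Longrightarrow> ?lines"
    using formally_diagonalizable_imp_sum_of_log_lines[OF carrier p] by blast
  moreover have "?lines \<Longrightarrow> ?log"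
  proof -
    assume lines: ?lines
    have "pole_order_le C E W nabla x 1 \<and> vanishing_p_curvature C E W nabla" if x: "x \<in> ?P" for x
    proof -
      obtain A where A: "?fcm x A" "formally_sum_of_log_lines n A" using lines x by blast
      obtain B where B: "A = log_matrix n B" "log_p_curvature_zero n B"
        using sum_of_log_lines_imp_log_p_curvature_zero[OF carrier[OF A(1)] p A(2)] .
      show ?thesis
        using formal_connection_log_pole[OF p t[OF x] e[OF x] A(1)[unfolded B(1)] B(2)] by blast
    qed
    then show ?log using assms(6) by (auto simp: logarithmic_def)
  qed
  ultimately show ?thesis by blast
qed

end
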